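(* $\mathrm{P}_\omega(\omega_1,2,{\sqsubseteq},1,\mathrm{NS}^+_{\omega_1},2,1)$ implies the existence of an $\mathbb R$-embeddable almost-Souslin $\aleph_1$-tree $T$ such that $X_T$ is perfectly normal, but $(X_T)^2$ is not cmc.
   Context: $\mathrm{P}_\omega(\omega_1,2,{\sqsubseteq},1,\mathrm{NS}^+_{\omega_1},2,1)$ is an instance of the proxy principles (Brodsky–Rinot); as used here it amounts to $\diamondsuit(\omega_1)$ together with the existence of a ladder system $\langle C_\alpha\mid\alpha<\omega_1\rangle$ such that for every countable limit $\alpha$, $C_\alpha$ is a cofinal subset of $\alpha$ of order-type $\omega$, and for every uncountable $B\subseteq\omega_1$ there are club many $\alpha<\omega_1$ with $\sup(C_\alpha\cap B)=\alpha$. A tree is a downward closed $T\subseteq{}^{<\omega_1}w$ for a countable $w$ (closed under $t\mapsto t\restriction\alpha$ for $\alpha<\mathrm{dom}(t)$); an $\aleph_1$-tree has height $\omega_1$ and countable levels $T_\alpha=T\cap{}^\alpha w$. Almost-Souslin: for every antichain $A\subseteq T$, $\{\mathrm{dom}(x)\mid x\in A\}$ is nonstationary. $\mathbb R$-embeddable: there is a strictly $\subsetneq$-increasing map $T\to\mathbb R$. $X_T$ is the interval topology (basic open sets $(x,y]=\{z\mid x\subsetneq z\subseteq y\}$ and $\{\emptyset\}$); cmc means every countable open cover has a point-finite open refinement. *)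

theory Defs
  imports "HOL-Analysis.Analysis" "HOL-Library.Countable_Set_Type"
begin

subsection \<open>The ordinal \<open>\<omega>\<^sub>1\<close>\<close>

text \<open>The elements of the type are the countable ordinals.  It carries the initial
  well-order of the successor cardinal of \<open>\<aleph>\<^sub>0\<close>; the ordinal \<open>\<alpha>\<close>, as
  a set of ordinals, is \<open>{..<\<alpha>}\<close>.\<close>

typedef omega1 = "Field (cardSuc natLeq)"
proof -
  have "cardSuc natLeq \<noteq> {}"
    using cardSuc_finite[OF natLeq_Card_order] by (auto simp: Field_natLeq)
  then show ?thesis by (auto simp: Field_def)
qed

instantiation omega1 :: wellorder
begin

definition less_eq_omega1 :: "omega1 \<Rightarrow> omega1 \<Rightarrow> bool" where
  "a \<le> b \<longleftrightarrow> (Rep_omega1 a, Rep_omega1 b) \<in> cardSuc natLeq"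

definition less_omega1 :: "omega1 \<Rightarrow> omega1 \<Rightarrow> bool" where
  "a < b \<longleftrightarrow> a \<le> b \<and> a \<noteq> b" for a b :: omega1

instance
proof -
  let ?r = "cardSuc natLeq"
  have wo: "Well_order ?r"
    using cardSuc_Card_order[OF natLeq_Card_order] by (simp add: card_order_on_def)
  then have lin: "Linear_order ?r" and wf: "wf (?r - Id)"
    by (simp_all add: well_order_on_def)
  then have rfl: "refl_on (Field ?r) ?r" and trn: "trans ?r" and asym: "antisym ?r"
    and tot: "total_on (Field ?r) ?r"
    by (simp_all add: order_on_defs)
  have refl: "x \<le> x" for x :: omega1
    using refl_onD[OF rfl Rep_omega1] by (simp add: less_eq_omega1_def)
  have antis: "x = y" if "x \<le> y" "y \<le> x" for x y :: omega1
    using antisymD[OF asym] that by (simp add: less_eq_omega1_def flip: Rep_omega1_inject)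
  show "OFCLASS(omega1, wellorder_class)"
  proof
    fix x y z :: omega1
    show "x < y \<longleftrightarrow> x \<le> y \<and> \<not> y \<le> x"
      using antis refl by (auto simp: less_omega1_def)
    show "x \<le> x" by (rule refl)
    show "x \<le> z" if "x \<le> y" "y \<le> z"
      using transD[OF trn] that by (auto simp: less_eq_omega1_def)
    show "x = y" if "x \<le> y" "y \<le> x" using antis that by blast
    show "x \<le> y \<or> y \<le> x"
    proof (cases "x = y")
      case True
      then show ?thesis using refl by simp
    next
      case False
      then have "Rep_omega1 x \<noteq> Rep_omega1 y" by (simp add: Rep_omega1_inject)
      with tot Rep_omega1[of x] Rep_omega1[of y] show ?thesis
        unfolding less_eq_omega1_def total_on_def by blast
    qed
  next
    fix P :: "omega1 \<Rightarrow> bool" and a :: omega1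
    assume step: "\<And>x. (\<And>y. y < x \<Longrightarrow> P y) \<Longrightarrow> P x"
    have "wf (inv_image (?r - Id) Rep_omega1)" using wf by (rule wf_inv_image)
    then show "P a"
    proof (induction a rule: wf_induct_rule)
      case (less x)
      show ?case
      proof (rule step)
        fix y assume "y < x"
        then have "(y, x) \<in> inv_image (?r - Id) Rep_omega1"
          by (simp add: less_omega1_def less_eq_omega1_def Rep_omega1_inject)
        then show "P y" by (rule less)
      qed
    qed
  qed
qed

end

lemma uncountable_omega1: "uncountable (UNIV :: omega1 set)"
proof
  include cardinal_syntax
  assume "countable (UNIV :: omega1 set)"
  then have "countable (Rep_omega1 ` UNIV)" by simp
  then have "countable (Field (cardSuc natLeq))"
    using type_definition.Rep_range[OF type_definition_omega1] by simp
  then have "|Field (cardSuc natLeq)| \<le>o natLeq" by (simp add: countable_card_le_natLeq)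
  moreover have "|Field (cardSuc natLeq)| =o cardSuc natLeq"
    by (rule card_of_Field_ordIso[OF cardSuc_Card_order[OF natLeq_Card_order]])
  ultimately have "cardSuc natLeq \<le>o natLeq"
    using ordIso_ordLeq_trans ordIso_symmetric by blast
  then show False
    using cardSuc_greater[OF natLeq_Card_order] not_ordLess_ordLeq by blast
qed

lemma countable_lessThan_omega1: "countable {..<a :: omega1}"
proof -
  include cardinal_syntax
  let ?r = "cardSuc natLeq"
  have "|underS ?r (Rep_omega1 a)| <o ?r"
    by (rule card_of_underS[OF cardSuc_Card_order[OF natLeq_Card_order] Rep_omega1])
  then have "|underS ?r (Rep_omega1 a)| \<le>o natLeq"
    by (rule iffD1[OF cardSuc_ordLeq_ordLess[OF natLeq_Card_order card_of_Card_order]])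
  then have "countable (underS ?r (Rep_omega1 a))" by (simp add: countable_card_le_natLeq)
  moreover have "Rep_omega1 ` {..<a} \<subseteq> underS ?r (Rep_omega1 a)"
    by (auto simp: underS_def less_omega1_def less_eq_omega1_def Rep_omega1_inject)
  ultimately have "countable (Rep_omega1 ` {..<a})" by (rule countable_subset[rotated])
  then show ?thesis
    by (rule countable_image_inj_on) (simp add: inj_on_def Rep_omega1_inject)
qed

text \<open>\<open>acc_of A \<alpha>\<close> says \<open>\<alpha> \<noteq> 0\<close> and \<open>sup (A \<inter> \<alpha>) = \<alpha>\<close>.  Because of the strict
  inequalities this forces \<open>\<alpha>\<close> to be a limit ordinal.\<close>

definition acc_of :: "omega1 set \<Rightarrow> omega1 \<Rightarrow> bool" where
  "acc_of A \<alpha> \<longleftrightarrow> {..<\<alpha>} \<noteq> {} \<and> (\<forall>\<gamma><\<alpha>. \<exists>\<delta>\<in>A. \<gamma> < \<delta> \<and> \<delta> < \<alpha>)"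

definition limit_ord :: "omega1 \<Rightarrow> bool" where
  "limit_ord \<alpha> \<longleftrightarrow> acc_of UNIV \<alpha>"

definition club :: "omega1 set \<Rightarrow> bool" where
  "club E \<longleftrightarrow> (\<forall>\<beta>. \<exists>\<gamma>\<in>E. \<beta> < \<gamma>) \<and> (\<forall>\<alpha>. acc_of E \<alpha> \<longrightarrow> \<alpha> \<in> E)"

definition stationary :: "omega1 set \<Rightarrow> bool" where
  "stationary S \<longleftrightarrow> (\<forall>E. club E \<longrightarrow> S \<inter> E \<noteq> {})"


subsection \<open>The proxy principle\<close>

definition diamond_omega1 :: bool where
  "diamond_omega1 \<longleftrightarrow> (\<exists>A :: omega1 \<Rightarrow> omega1 set.
     (\<forall>\<alpha>. A \<alpha> \<subseteq> {..<\<alpha>}) \<and> (\<forall>B. stationary {\<alpha>. B \<inter> {..<\<alpha>} = A \<alpha>}))"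

definition order_type_omega :: "omega1 set \<Rightarrow> bool" where
  "order_type_omega C \<longleftrightarrow> (\<exists>f :: nat \<Rightarrow> omega1. strict_mono f \<and> range f = C)"

definition ladder_system :: "(omega1 \<Rightarrow> omega1 set) \<Rightarrow> bool" where
  "ladder_system C \<longleftrightarrow>
     (\<forall>\<alpha>. limit_ord \<alpha> \<longrightarrow> C \<alpha> \<subseteq> {..<\<alpha>} \<and> acc_of (C \<alpha>) \<alpha> \<and> order_type_omega (C \<alpha>))"

text \<open>The instance \<open>P\<^sub>\<omega>(\<omega>\<^sub>1, 2, \<sqsubseteq>, 1, NS\<^sup>+, 2, 1)\<close> of the Brodsky--Rinot proxy
  principle, unfolded: sequences of order type \<open>\<omega>\<close> are vacuously \<open>\<sqsubseteq>\<close>-coherent, and hitting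
  stationarily often in each stationary set is hitting on a club.\<close>

definition proxy_omega1 :: bool where
  "proxy_omega1 \<longleftrightarrow> diamond_omega1 \<and>
     (\<exists>C. ladder_system C \<and>
        (\<forall>B. uncountable B \<longrightarrow> (\<exists>E. club E \<and> (\<forall>\<alpha>\<in>E. acc_of (C \<alpha> \<inter> B) \<alpha>))))"


subsection \<open>Trees\<close>

text \<open>A node, i.e. a function from a countable ordinal \<open>\<alpha>\<close> to \<open>w\<close>, is a partial map on
  \<^typ>\<open>omega1\<close> with domain \<open>{..<\<alpha>}\<close>; inclusion of functions is \<open>\<subseteq>\<^sub>m\<close>.\<close>

definition nodes :: "'w set \<Rightarrow> (omega1 \<rightharpoonup> 'w) set" where
  "nodes w = {t. (\<exists>\<alpha>. dom t = {..<\<alpha>}) \<and> ran t \<subseteq> w}"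

definition ht :: "(omega1 \<rightharpoonup> 'w) \<Rightarrow> omega1" where
  "ht t = (THE \<alpha>. dom t = {..<\<alpha>})"

definition map_less :: "('a \<rightharpoonup> 'b) \<Rightarrow> ('a \<rightharpoonup> 'b) \<Rightarrow> bool" where
  "map_less x y \<longleftrightarrow> x \<subseteq>\<^sub>m y \<and> x \<noteq> y"

definition is_tree :: "(omega1 \<rightharpoonup> 'w) set \<Rightarrow> bool" where
  "is_tree T \<longleftrightarrow> (\<exists>w. countable w \<and> T \<subseteq> nodes w) \<and>
     (\<forall>t\<in>T. \<forall>\<alpha><ht t. t |` {..<\<alpha>} \<in> T)"

definition level :: "(omega1 \<rightharpoonup> 'w) set \<Rightarrow> omega1 \<Rightarrow> (omega1 \<rightharpoonup> 'w) set" where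
  "level T \<alpha> = {t \<in> T. dom t = {..<\<alpha>}}"

text \<open>Having height \<open>\<omega>\<^sub>1\<close> means that no level of countable index is empty.\<close>

definition aleph1_tree :: "(omega1 \<rightharpoonup> 'w) set \<Rightarrow> bool" where
  "aleph1_tree T \<longleftrightarrow> is_tree T \<and> (\<forall>\<alpha>. level T \<alpha> \<noteq> {} \<and> countable (level T \<alpha>))"

definition tree_antichain :: "(omega1 \<rightharpoonup> 'w) set \<Rightarrow> bool" where
  "tree_antichain A \<longleftrightarrow> (\<forall>x\<in>A. \<forall>y\<in>A. x \<subseteq>\<^sub>m y \<longrightarrow> x = y)"

definition almost_Souslin :: "(omega1 \<rightharpoonup> 'w) set \<Rightarrow> bool" where
  "almost_Souslin T \<longleftrightarrow> (\<forall>A\<subseteq>T. tree_antichain A \<longrightarrow> \<not> stationary (ht ` A))"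

definition real_embeddable :: "(omega1 \<rightharpoonup> 'w) set \<Rightarrow> bool" where
  "real_embeddable T \<longleftrightarrow>
     (\<exists>f :: (omega1 \<rightharpoonup> 'w) \<Rightarrow> real. \<forall>x\<in>T. \<forall>y\<in>T. map_less x y \<longrightarrow> f x < f y)"


subsection \<open>Topology\<close>

definition tree_interval ::
    "(omega1 \<rightharpoonup> 'w) set \<Rightarrow> (omega1 \<rightharpoonup> 'w) \<Rightarrow> (omega1 \<rightharpoonup> 'w) \<Rightarrow> (omega1 \<rightharpoonup> 'w) set" where
  "tree_interval T x y = {z \<in> T. map_less x z \<and> z \<subseteq>\<^sub>m y}"

text \<open>The generating family is a base and not merely a subbase: if \<open>z\<close> lies in two
  intervals with lower ends \<open>x\<close>, \<open>x'\<close>, then \<open>x\<close> and \<open>x'\<close> are comparable and, for the larger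
  one \<open>m\<close>, the interval \<open>(m, z]\<close> is contained in both.\<close>

definition interval_topology :: "(omega1 \<rightharpoonup> 'w) set \<Rightarrow> (omega1 \<rightharpoonup> 'w) topology" where
  "interval_topology T =
     topology_generated_by (insert {Map.empty} {tree_interval T x y | x y. x \<in> T \<and> y \<in> T})"

text \<open>Normality includes \<open>T\<^sub>1\<close> here.\<close>

definition perfectly_normal_space :: "'a topology \<Rightarrow> bool" where
  "perfectly_normal_space X \<longleftrightarrow>
     t1_space X \<and> normal_space X \<and> (\<forall>F. closedin X F \<longrightarrow> gdelta_in X F)"

definition point_finite :: "'a topology \<Rightarrow> 'a set set \<Rightarrow> bool" where
  "point_finite X \<V> \<longleftrightarrow> (\<forall>x\<in>topspace X. finite {V \<in> \<V>. x \<in> V})"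

definition open_cover :: "'a topology \<Rightarrow> 'a set set \<Rightarrow> bool" where
  "open_cover X \<U> \<longleftrightarrow> (\<forall>U\<in>\<U>. openin X U) \<and> \<Union>\<U> = topspace X"

definition countably_metacompact :: "'a topology \<Rightarrow> bool" where
  "countably_metacompact X \<longleftrightarrow>
     (\<forall>\<U>. countable \<U> \<and> open_cover X \<U> \<longrightarrow>
        (\<exists>\<V>. open_cover X \<V> \<and> (\<forall>V\<in>\<V>. \<exists>U\<in>\<U>. V \<subseteq> U) \<and> point_finite X \<V>))"

end

theory Submission
  imports Defs
begin

text \<open>A node is a sequence \<open>t\<close> of labelled rationals in \<open>(0, 1)\<close>, each exceeding the supremum of its
  predecessors; \<open>fv t\<close>, the supremum of \<open>t\<close>, is a continuous strictly increasing map into the reals.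
  A branch through a limit level \<open>\<alpha>\<close> climbs along the ladder \<open>C \<alpha>\<close>, keeping a promise \<open>fv < q\<close>.
  On the way to a level \<open>\<beta> \<in> C \<alpha>\<close> it meets the set of nodes below \<open>\<beta>\<close> predicted by \<open>\<diamondsuit>\<close> if this is
  compatible with the promise.  As every stationary set of correct predictions is hit by \<open>C \<alpha>\<close> for
  club many \<open>\<alpha>\<close>, for every set \<open>B\<close> of nodes club many levels consist of limits of \<open>B\<close> and of nodes in
  an open cone \<open>{z. y \<subset> z, fv z < q}\<close> that misses \<open>B\<close>.

  For the square one selects on the way a coloured antichain \<open>A\<close> of pairs of the same height, at most
  one pair on each level; the pairs of colour at least \<open>n\<close> form closed sets \<open>F n\<close> with empty
  intersection.  Let open \<open>U n \<supseteq> F n\<close> be predicted at \<open>\<alpha>\<close>.  If for some \<open>k\<close> the complement of \<open>U k\<close> is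
  dense among the pairs not above \<open>A\<close>, below some condition, then a limit of points outside \<open>U k\<close> joins
  \<open>A\<close> with colour \<open>k\<close>, contradicting openness.  Otherwise conditions that force the pair into \<open>U k\<close> are
  dense for every \<open>k\<close>, and a pair that meets them all and is not put into \<open>A\<close> lies in every \<open>U n\<close>.\<close>

subsection \<open>Clubs and stationary sets\<close>

text \<open>Two demands on pairs of branches conflict. Each coordinate has to meet predicted sets of
  nodes, and whenever it does so the other one must be prolonged to the same height; this could
  carry the pair above a member of the antichain, where no condition is left. The labels resolve
  this: members of the antichain are limits of simultaneous labels, so it suffices that the other
  coordinate climbs without labels. Such climbing must then be possible through every level, so
  branches above single nodes are built without labels beyond their start, and they can only meet
  predictions compatible with that. This is the origin of the flag \<open>Z\<close> that accompanies
  the bound \<open>q\<close> in a promise. Bounds are rational so that a level carries only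
  countably many promises and clubs of ordinals closed under witnesses exist. The diamond is correct
  only stationarily often, while a club of levels is wanted; sets of nodes are therefore predicted
  at the ladder points of \<alpha> and not at \<alpha>. The pair at level \<alpha> uses the
  prediction at \<alpha> itself, since a single correct level yields the contradiction.\<close>

lemma countable_bounded_omega1:
  fixes A :: "omega1 set"
  assumes "countable A"
  shows "\<exists>\<delta>. \<forall>a\<in>A. a < \<delta>"
proof -
  have "countable (\<Union>a\<in>A. insert a {..<a})"
    using assms by (intro countable_UN) (auto simp: countable_lessThan_omega1)
  then have "(\<Union>a\<in>A. insert a {..<a}) \<noteq> UNIV"
    using uncountable_omega1 by metis
  then obtain \<delta> where "\<delta> \<notin> (\<Union>a\<in>A. insert a {..<a})"
    by blast
  then have "\<forall>a\<in>A. a < \<delta>" by force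
  then show ?thesis ..
qed

lemma least_omega1: "\<exists>\<zeta>::omega1. {..<\<zeta>} = {} \<and> (\<forall>\<gamma>. \<zeta> \<le> \<gamma>)"
proof -
  define \<zeta> where "\<zeta> = (LEAST x::omega1. True)"
  have "\<zeta> \<le> \<gamma>" for \<gamma> unfolding \<zeta>_def by (simp add: Least_le)
  moreover from this have "{..<\<zeta>} = {}" by (auto dest: leD)
  ultimately show ?thesis by blast
qed

lemma exists_greater_omega1: "\<exists>\<delta>::omega1. \<beta> < \<delta>"
  using countable_bounded_omega1[of "{\<beta>}"] by auto

lemma omega1_cases:
  fixes \<alpha> :: omega1
  obtains "{..<\<alpha>} = {}" | \<beta> where "{..<\<alpha>} = {..\<beta>}" | "limit_ord \<alpha>"
proof (cases "limit_ord \<alpha> \<or> {..<\<alpha>} = {}")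
  case False
  then obtain \<gamma> where "\<gamma> < \<alpha>" "\<And>\<delta>. \<delta> < \<alpha> \<Longrightarrow> \<delta> \<le> \<gamma>"
    by (auto simp: limit_ord_def acc_of_def not_less) (metis not_less)
  then have "{..<\<alpha>} = {..\<gamma>}" by (auto intro: le_less_trans)
  then show ?thesis using that(2) by blast
qed (use that in blast)

lemma acc_of_limit: "acc_of A \<alpha> \<Longrightarrow> limit_ord \<alpha>"
  by (auto simp: acc_of_def limit_ord_def)

lemma limit_ord_between: "limit_ord \<alpha> \<Longrightarrow> \<gamma> < \<alpha> \<Longrightarrow> \<exists>\<delta>. \<gamma> < \<delta> \<and> \<delta> < \<alpha>"
  by (auto simp: acc_of_def limit_ord_def)

lemma limit_ord_nonempty: "limit_ord \<alpha> \<Longrightarrow> \<exists>\<gamma>. \<gamma> < \<alpha>"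
  by (auto simp: acc_of_def limit_ord_def)

lemma acc_of_mono: "acc_of A \<alpha> \<Longrightarrow> A \<subseteq> B \<Longrightarrow> acc_of B \<alpha>"
  unfolding acc_of_def by blast

lemma acc_of_sequence:
  fixes e :: "nat \<Rightarrow> omega1"
  assumes "\<And>n. e n < e (Suc n)"
  shows "\<exists>\<alpha>. (\<forall>n. e n < \<alpha>) \<and> (\<forall>\<gamma><\<alpha>. \<exists>n. \<gamma> < e n)"
proof -
  have ex: "\<exists>\<delta>. \<forall>n. e n < \<delta>"
    using countable_bounded_omega1[of "range e"] by auto
  define \<alpha> where "\<alpha> = (LEAST \<delta>. \<forall>n. e n < \<delta>)"
  have 1: "\<forall>n. e n < \<alpha>"
    unfolding \<alpha>_def by (rule LeastI_ex[OF ex])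
  have "\<exists>n. \<gamma> < e n" if "\<gamma> < \<alpha>" for \<gamma>
  proof -
    have "\<not> (\<forall>n. e n < \<gamma>)"
      using that not_less_Least unfolding \<alpha>_def by blast
    then obtain n where "\<gamma> \<le> e n" by (auto simp: not_less)
    then have "\<gamma> < e (Suc n)" using assms[of n] by simp
    then show ?thesis ..
  qed
  with 1 show ?thesis by blast
qed

text \<open>Source of the clubs of closure points: \<open>S \<beta>\<close> is a countable set of
  parameters of level \<beta>, and \<open>h\<close> will be a Skolem function sending a parameter to
  the height of a witness. Iterating a bound for all values of \<open>h\<close> at levels up to
  \<beta> reaches a closed point.\<close>

lemma club_closure_points:
  fixes h :: "'a \<Rightarrow> omega1"
  assumes cnt: "\<And>\<beta>. countable (S \<beta>)"
  shows "club {\<alpha>. \<forall>\<beta><\<alpha>. \<forall>x\<in>S \<beta>. h x < \<alpha>}" (is "club ?E")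
  unfolding club_def
proof (intro conjI allI impI)
  fix \<beta>0
  have "\<exists>\<delta>. \<beta> < \<delta> \<and> (\<forall>\<gamma>\<le>\<beta>. \<forall>x\<in>S \<gamma>. h x < \<delta>)" for \<beta>
  proof -
    have "countable ({\<beta>} \<union> (\<Union>\<gamma>\<in>insert \<beta> {..<\<beta>}. h ` S \<gamma>))"
      by (intro countable_Un countable_UN) (auto simp: cnt countable_lessThan_omega1)
    from countable_bounded_omega1[OF this] obtain \<delta>
      where "\<forall>a\<in>{\<beta>} \<union> (\<Union>\<gamma>\<in>insert \<beta> {..<\<beta>}. h ` S \<gamma>). a < \<delta>" by blast
    then show ?thesis by (intro exI[of _ \<delta>]) (auto simp: le_less)
  qed
  then obtain g where g: "\<And>\<beta>. \<beta> < g \<beta>" "\<And>\<beta> \<gamma> x. \<gamma> \<le> \<beta> \<Longrightarrow> x \<in> S \<gamma> \<Longrightarrow> h x < g \<beta>"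
    by metis
  define e where "e n = (g ^^ n) \<beta>0" for n
  have e: "e (Suc n) = g (e n)" for n by (simp add: e_def)
  obtain \<alpha> where \<alpha>: "\<forall>n. e n < \<alpha>" "\<forall>\<gamma><\<alpha>. \<exists>n. \<gamma> < e n"
    using acc_of_sequence[of e] g(1) e by auto
  have "h x < \<alpha>" if x: "\<beta> < \<alpha>" "x \<in> S \<beta>" for \<beta> x
  proof -
    obtain n where "\<beta> < e n" using \<alpha> x by blast
    then have "h x < e (Suc n)" using g(2)[of \<beta> "e n" x] x e by simp
    also have "\<dots> < \<alpha>" using \<alpha> by blast
    finally show ?thesis .
  qed
  then have "\<alpha> \<in> ?E" by simp
  moreover have "\<beta>0 < \<alpha>" using \<alpha>(1)[rule_format, of 0] by (simp add: e_def)
  ultimately show "\<exists>\<gamma>\<in>?E. \<beta>0 < \<gamma>" ..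
next
  fix \<alpha> assume "acc_of ?E \<alpha>"
  then have *: "\<exists>\<delta>\<in>?E. \<gamma> < \<delta> \<and> \<delta> < \<alpha>" if "\<gamma> < \<alpha>" for \<gamma>
    using that by (auto simp: acc_of_def)
  have "h x < \<alpha>" if x: "\<beta> < \<alpha>" "x \<in> S \<beta>" for \<beta> x
  proof -
    obtain \<delta> where "\<delta> \<in> ?E" "\<beta> < \<delta>" "\<delta> < \<alpha>" using *[OF x(1)] by blast
    then have "h x < \<delta>" using x(2) by blast
    with \<open>\<delta> < \<alpha>\<close> show ?thesis by simp
  qed
  then show "\<alpha> \<in> ?E" by simp
qed

lemma club_Int:
  assumes "club D" "club E"
  shows "club (D \<inter> E)"
  unfolding club_def
proof (intro conjI allI impI)
  fix \<beta>0
  have "\<forall>\<beta>. \<exists>\<delta>. \<beta> < \<delta> \<and> \<delta> \<in> D" "\<forall>\<beta>. \<exists>\<delta>. \<beta> < \<delta> \<and> \<delta> \<in> E"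
    using assms by (auto simp: club_def)
  then obtain d e where d: "\<And>\<beta>. \<beta> < d \<beta>" "\<And>\<beta>. d \<beta> \<in> D" and e: "\<And>\<beta>. \<beta> < e \<beta>" "\<And>\<beta>. e \<beta> \<in> E"
    by metis
  define s where "s n = ((\<lambda>\<beta>. e (d \<beta>)) ^^ n) \<beta>0" for n
  have s: "s (Suc n) = e (d (s n))" for n by (simp add: s_def)
  have less: "s n < d (s n)" "d (s n) < s (Suc n)" for n using d e s by auto
  obtain \<alpha> where \<alpha>: "\<forall>n. s n < \<alpha>" "\<forall>\<gamma><\<alpha>. \<exists>n. \<gamma> < s n"
    using acc_of_sequence[of s] less less_trans by blast
  have ne: "{..<\<alpha>} \<noteq> {}" using \<alpha>(1) by auto
  have "acc_of D \<alpha>" unfolding acc_of_def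
  proof (intro conjI ne allI impI)
    fix \<gamma> assume "\<gamma> < \<alpha>"
    then obtain n where "\<gamma> < s n" using \<alpha> by blast
    then have "\<gamma> < d (s n)" "d (s n) < \<alpha>"
      using less[of n] \<alpha>(1)[rule_format, of "Suc n"] by auto
    then show "\<exists>\<delta>\<in>D. \<gamma> < \<delta> \<and> \<delta> < \<alpha>" using d(2) by blast
  qed
  moreover have "acc_of E \<alpha>" unfolding acc_of_def
  proof (intro conjI ne allI impI)
    fix \<gamma> assume "\<gamma> < \<alpha>"
    then obtain n where "\<gamma> < s n" using \<alpha> by blast
    then have "\<gamma> < s (Suc n)" "s (Suc n) < \<alpha>"
      using less[of n] \<alpha>(1)[rule_format, of "Suc n"] by auto
    moreover have "s (Suc n) \<in> E" using e(2) s by simp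
    ultimately show "\<exists>\<delta>\<in>E. \<gamma> < \<delta> \<and> \<delta> < \<alpha>" by blast
  qed
  ultimately have "\<alpha> \<in> D \<inter> E" using assms by (auto simp: club_def)
  moreover have "\<beta>0 < \<alpha>" using \<alpha>(1)[rule_format, of 0] by (simp add: s_def)
  ultimately show "\<exists>\<gamma>\<in>D \<inter> E. \<beta>0 < \<gamma>" by blast
next
  fix \<alpha> assume "acc_of (D \<inter> E) \<alpha>"
  then have "acc_of D \<alpha>" "acc_of E \<alpha>" by (auto intro: acc_of_mono)
  then show "\<alpha> \<in> D \<inter> E" using assms by (auto simp: club_def)
qed

lemma club_greaterThan: "club {\<delta><..}"
  unfolding club_def
proof (intro conjI allI impI)
  fix \<beta>
  obtain \<gamma> where "max \<delta> \<beta> < \<gamma>" using exists_greater_omega1 by blast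
  then show "\<exists>\<gamma>\<in>{\<delta><..}. \<beta> < \<gamma>" by auto
next
  fix \<alpha> assume "acc_of {\<delta><..} \<alpha>"
  then show "\<alpha> \<in> {\<delta><..}" by (fastforce simp: acc_of_def)
qed

lemma stationary_mono: "stationary S \<Longrightarrow> S \<subseteq> S' \<Longrightarrow> stationary S'"
  unfolding stationary_def by (metis disjoint_iff subsetD)

lemma stationary_Int_club: "stationary S \<Longrightarrow> club E \<Longrightarrow> stationary (S \<inter> E)"
  unfolding stationary_def using club_Int[of E] by (simp add: Int_assoc)

lemma stationary_uncountable:
  assumes "stationary S"
  shows "uncountable S"
proof
  assume "countable S"
  then obtain \<delta> where "\<forall>a\<in>S. a < \<delta>" using countable_bounded_omega1 by blast
  moreover obtain a where "a \<in> S" "\<delta> < a"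
    using assms club_greaterThan[of \<delta>] by (auto simp: stationary_def)
  ultimately show False using less_asym by blast
qed

lemma club_uncountable: "club E \<Longrightarrow> uncountable E"
proof
  assume "club E" "countable E"
  then obtain \<delta> where \<delta>: "\<forall>a\<in>E. a < \<delta>" using countable_bounded_omega1 by blast
  moreover obtain a where "a \<in> E" "\<delta> < a"
    using \<open>club E\<close> unfolding club_def by blast
  ultimately show False using less_asym by blast
qed

text \<open>With the least ordinal in the club, every ordinal off the club has a club element below
  it; this is needed for cutting the tree into pieces between consecutive club elements.\<close>

lemma club_insert_least:
  assumes "club E" "{..<\<zeta>} = {}"
  shows "club (insert \<zeta> E)"
  unfolding club_def
proof (intro conjI allI impI)
  fix \<beta>
  show "\<exists>\<gamma>\<in>insert \<zeta> E. \<beta> < \<gamma>" using assms(1) unfolding club_def by simp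
next
  fix \<alpha> assume *: "acc_of (insert \<zeta> E) \<alpha>"
  have "\<not> \<gamma> < \<zeta>" for \<gamma> using assms(2) by auto
  then have "acc_of E \<alpha>" using * by (simp add: acc_of_def)
  then show "\<alpha> \<in> insert \<zeta> E" using assms(1) by (simp add: club_def)
qed

text \<open>Nodes will be named by their level and a natural number, so subsets of
  \<open>omega1 \<times> nat\<close> have to be predicted. An injection into \<open>omega1\<close>
  transports the diamond; the transported predictions are correct at ordinals closed under the
  injection.\<close>

lemma diamond_product:
  assumes "diamond_omega1"
  shows "\<exists>\<Omega> :: omega1 \<Rightarrow> (omega1 \<times> nat) set.
    \<forall>B. stationary {\<alpha>. B \<inter> ({..<\<alpha>} \<times> UNIV) = \<Omega> \<alpha>}"
proof -
  obtain A where A: "\<And>\<alpha>. A \<alpha> \<subseteq> {..<\<alpha>}" "\<And>B. stationary {\<alpha>. B \<inter> {..<\<alpha>} = A \<alpha>}"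
    using assms unfolding diamond_omega1_def by blast
  obtain code :: "omega1 \<times> nat \<Rightarrow> omega1" where code: "inj code"
  proof -
    include cardinal_syntax
    have inf: "infinite (UNIV :: omega1 set)"
      using uncountable_omega1 countable_finite by blast
    then have "|UNIV :: nat set| \<le>o |UNIV :: omega1 set|"
      by (simp add: infinite_iff_card_of_nat)
    then have "|UNIV \<times> UNIV :: (omega1 \<times> nat) set| =o |UNIV :: omega1 set|"
      using card_of_Times_infinite[OF inf, of "UNIV :: nat set"] by blast
    then have "|UNIV \<times> UNIV :: (omega1 \<times> nat) set| \<le>o |UNIV :: omega1 set|"
      using ordIso_iff_ordLeq by blast
    then obtain f :: "omega1 \<times> nat \<Rightarrow> omega1" where "inj_on f (UNIV \<times> UNIV)"
      unfolding card_of_ordLeq[symmetric] by blast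
    then show ?thesis using that by simp
  qed
  define E where "E = {\<alpha>. \<forall>\<beta><\<alpha>. \<forall>x\<in>{\<beta>} \<times> UNIV. code x < \<alpha>}"
  have E: "club E" unfolding E_def by (rule club_closure_points) simp
  define \<Omega> where "\<Omega> \<alpha> = {x \<in> {..<\<alpha>} \<times> UNIV. code x \<in> A \<alpha>}" for \<alpha>
  have "stationary {\<alpha>. B \<inter> ({..<\<alpha>} \<times> UNIV) = \<Omega> \<alpha>}" for B
  proof -
    have "stationary ({\<alpha>. code ` B \<inter> {..<\<alpha>} = A \<alpha>} \<inter> E)"
      using A(2) E by (rule stationary_Int_club)
    moreover have "{\<alpha>. code ` B \<inter> {..<\<alpha>} = A \<alpha>} \<inter> E \<subseteq> {\<alpha>. B \<inter> ({..<\<alpha>} \<times> UNIV) = \<Omega> \<alpha>}"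
    proof
      fix \<alpha> assume "\<alpha> \<in> {\<alpha>. code ` B \<inter> {..<\<alpha>} = A \<alpha>} \<inter> E"
      then have A\<alpha>: "A \<alpha> = code ` B \<inter> {..<\<alpha>}" and \<alpha>: "\<alpha> \<in> E" by simp_all
      have "x \<in> B \<longleftrightarrow> code x \<in> A \<alpha>" if "x \<in> {..<\<alpha>} \<times> UNIV" for x
        using \<alpha> that by (auto simp: A\<alpha> E_def inj_image_mem_iff[OF code])
      then show "\<alpha> \<in> {\<alpha>. B \<inter> ({..<\<alpha>} \<times> UNIV) = \<Omega> \<alpha>}"
        by (auto simp: \<Omega>_def)
    qed
    ultimately show ?thesis by (rule stationary_mono)
  qed
  then show ?thesis by blast
qed

text \<open>The climb starts at an arbitrary level \<open>\<beta>0\<close> but skips no ladder point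
  beyond it: the last clause guarantees that the prediction attached to each such point is treated
  on the way.\<close>

lemma ladder_enumeration:
  fixes C :: "omega1 set"
  assumes "C \<subseteq> {..<\<alpha>}" "acc_of C \<alpha>" "order_type_omega C" "\<beta>0 < \<alpha>"
  shows "\<exists>e :: nat \<Rightarrow> omega1. e 0 = \<beta>0 \<and> strict_mono e \<and> (\<forall>n. e (Suc n) \<in> C) \<and> (\<forall>n. e n < \<alpha>) \<and>
    (\<forall>\<gamma><\<alpha>. \<exists>n. \<gamma> < e n) \<and> (\<forall>\<beta>\<in>C. \<beta>0 < \<beta> \<longrightarrow> (\<exists>n. \<beta> = e (Suc n)))"
proof -
  obtain f :: "nat \<Rightarrow> omega1" where f: "strict_mono f" "range f = C"
    using assms by (auto simp: order_type_omega_def)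
  have cof: "\<exists>n. \<gamma> < f n" if "\<gamma> < \<alpha>" for \<gamma>
    using that assms(2) f(2) by (auto simp: acc_of_def)
  define k where "k = (LEAST n. \<beta>0 < f n)"
  have k: "\<beta>0 < f k" unfolding k_def by (rule LeastI_ex) (rule cof[OF assms(4)])
  define e where "e n = (case n of 0 \<Rightarrow> \<beta>0 | Suc m \<Rightarrow> f (k + m))" for n
  have "strict_mono e"
    unfolding strict_mono_Suc_iff
  proof
    fix n show "e n < e (Suc n)"
      using k f(1) by (cases n) (auto simp: e_def strict_mono_less)
  qed
  moreover have "\<exists>n. \<gamma> < e n" if \<gamma>: "\<gamma> < \<alpha>" for \<gamma>
  proof -
    obtain n where "\<gamma> < f n" using cof[OF \<gamma>] by blast
    also have "f n \<le> f (k + n)" using f(1) by (simp add: strict_mono_less_eq)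
    finally have "\<gamma> < e (Suc n)" by (simp add: e_def)
    then show ?thesis ..
  qed
  moreover have "\<exists>n. \<beta> = e (Suc n)" if \<beta>: "\<beta> \<in> C" "\<beta>0 < \<beta>" for \<beta>
  proof -
    obtain m where m: "\<beta> = f m" using f(2) \<beta> by blast
    then have "k \<le> m" using \<beta> unfolding k_def by (auto intro: Least_le)
    then have "\<beta> = e (Suc (m - k))" using m by (simp add: e_def)
    then show ?thesis ..
  qed
  moreover have "e (Suc n) \<in> C" for n using f(2) by (auto simp: e_def)
  moreover have "e n < \<alpha>" for n using assms f(2) by (cases n) (auto simp: e_def)
  ultimately show ?thesis by (intro exI[of _ e]) (auto simp: e_def)
qed

subsection \<open>Increasing sequences of labelled rationals\<close>

type_synonym node = "omega1 \<rightharpoonup> nat"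

text \<open>A natural number codes a rational in the open unit interval together with a label bit.  A pair
  of nodes can enter the antichain in the square only if labels occur simultaneously in both
  coordinates cofinally often; extending a node without labels therefore never crosses it.\<close>

definition rv :: "nat \<Rightarrow> real" where
  "rv k = (let r = real_of_rat (fst (from_nat k :: rat \<times> bool)) in if 0 < r \<and> r < 1 then r else 1/2)"

definition bt :: "nat \<Rightarrow> bool" where
  "bt k = snd (from_nat k :: rat \<times> bool)"

lemma rv_bounds: "0 < rv k" "rv k < 1"
  by (auto simp: rv_def Let_def)

lemma rv_bt_dense:
  assumes "0 \<le> x" "x < y" "y \<le> 1"
  shows "\<exists>k. x < rv k \<and> rv k < y \<and> bt k = b"
proof -
  obtain r :: rat where r: "x < of_rat r" "of_rat r < y"
    using of_rat_dense[OF assms(2)] by blast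
  show ?thesis
  proof (intro exI conjI)
    have "0 < real_of_rat r" "real_of_rat r < 1" using r assms by linarith+
    then have "rv (to_nat (r, b)) = real_of_rat r" by (simp add: rv_def)
    then show "x < rv (to_nat (r, b))" "rv (to_nat (r, b)) < y" using r by simp_all
    show "bt (to_nat (r, b)) = b" by (simp add: bt_def)
  qed
qed

text \<open>The inserted \<open>0\<close> is the value of the empty node, which has no
  entries.\<close>

definition fv :: "node \<Rightarrow> real" where
  "fv t = Sup (insert 0 ((\<lambda>\<gamma>. rv (the (t \<gamma>))) ` dom t))"

definition bts :: "node \<Rightarrow> omega1 set" where
  "bts t = {\<gamma> \<in> dom t. bt (the (t \<gamma>))}"

abbreviation ini :: "node \<Rightarrow> omega1 \<Rightarrow> node" where
  "ini t \<gamma> \<equiv> t |` {..<\<gamma>}"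

lemma fv_bdd: "bdd_above (insert 0 ((\<lambda>\<gamma>. rv (the (t \<gamma>))) ` dom t))"
  by (rule bdd_aboveI[of _ 1]) (auto intro: less_imp_le rv_bounds)

lemma fv_nonneg: "0 \<le> fv t"
  unfolding fv_def by (rule cSup_upper[OF _ fv_bdd]) simp

lemma fv_upper: "\<gamma> \<in> dom t \<Longrightarrow> rv (the (t \<gamma>)) \<le> fv t"
  unfolding fv_def by (rule cSup_upper[OF _ fv_bdd]) simp

lemma fv_least: "0 \<le> q \<Longrightarrow> (\<And>\<gamma>. \<gamma> \<in> dom t \<Longrightarrow> rv (the (t \<gamma>)) \<le> q) \<Longrightarrow> fv t \<le> q"
  unfolding fv_def by (rule cSup_least) auto

lemma fv_empty [simp]: "fv Map.empty = 0"
  by (simp add: fv_def)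

lemma fv_mono: "s \<subseteq>\<^sub>m t \<Longrightarrow> fv s \<le> fv t"
  by (rule fv_least[OF fv_nonneg]) (metis fv_upper map_le_def map_le_implies_dom_le subsetD)

section \<open>Heights and initial segments\<close>

lemma ht_eq: "dom t = {..<\<alpha>} \<Longrightarrow> ht t = \<alpha>"
  unfolding ht_def by (rule the_equality) auto

lemma dom_ini: "dom t = {..<\<alpha>} \<Longrightarrow> \<gamma> \<le> \<alpha> \<Longrightarrow> dom (ini t \<gamma>) = {..<\<gamma>}"
  by auto

lemma ini_ini_le: "\<delta> \<le> \<gamma> \<Longrightarrow> ini (ini t \<gamma>) \<delta> = ini t \<delta>"
  by (rule ext) (auto simp: restrict_map_def)

lemma ini_id: "dom t = {..<\<alpha>} \<Longrightarrow> \<alpha> \<le> \<gamma> \<Longrightarrow> ini t \<gamma> = t"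
proof
  fix \<delta> show "ini t \<gamma> \<delta> = t \<delta>" if "dom t = {..<\<alpha>}" "\<alpha> \<le> \<gamma>"
  proof (cases "\<delta> < \<alpha>")
    case False
    then have "\<delta> \<notin> dom t" using that by simp
    then show ?thesis by (auto simp: restrict_map_def)
  qed (use that in simp)
qed

lemma ini_apply [simp]: "\<delta> < \<gamma> \<Longrightarrow> ini t \<gamma> \<delta> = t \<delta>"
  by simp

lemma ini_le: "ini t \<gamma> \<subseteq>\<^sub>m t"
  by (simp add: map_le_def)

lemma map_le_iff_ini:
  assumes "dom x = {..<\<beta>}"
  shows "x \<subseteq>\<^sub>m y \<longleftrightarrow> ini y \<beta> = x"
proof
  assume "x \<subseteq>\<^sub>m y"
  show "ini y \<beta> = x"
  proof
    fix \<gamma>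
    show "ini y \<beta> \<gamma> = x \<gamma>"
    proof (cases "\<gamma> < \<beta>")
      case True
      then have "\<gamma> \<in> dom x" using assms by simp
      then show ?thesis using \<open>x \<subseteq>\<^sub>m y\<close> True by (simp add: map_le_def)
    next
      case False
      then have "\<gamma> \<notin> dom x" using assms by simp
      then have "x \<gamma> = None" by blast
      then show ?thesis using False by simp
    qed
  qed
qed (use ini_le in auto)

lemma ini_mono: "\<gamma> \<le> \<delta> \<Longrightarrow> ini t \<gamma> \<subseteq>\<^sub>m ini t \<delta>"
  by (metis ini_ini_le ini_le)

lemma map_le_dom_le:
  assumes "x \<subseteq>\<^sub>m y" "dom x = {..<\<beta>}" "dom y = {..<\<gamma>}"
  shows "\<beta> \<le> (\<gamma>::omega1)"
  using map_le_implies_dom_le[OF assms(1)] assms(2,3) by simp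

lemma map_le_comparable:
  fixes x y t :: node
  assumes "x \<subseteq>\<^sub>m t" "y \<subseteq>\<^sub>m t" "dom x = {..<\<beta>}" "dom y = {..<\<gamma>}" "\<beta> \<le> (\<gamma>::omega1)"
  shows "x \<subseteq>\<^sub>m y"
proof -
  have "x = ini t \<beta>" "y = ini t \<gamma>" using assms by (simp_all add: map_le_iff_ini)
  then show ?thesis using ini_mono[OF assms(5)] by simp
qed

lemma map_le_same_dom: "x \<subseteq>\<^sub>m y \<Longrightarrow> dom x = dom y \<Longrightarrow> x = y"
  by (rule map_le_antisym) (simp_all add: map_le_def)

lemma fv_ini_le: "fv (ini t \<gamma>) \<le> fv t"
  by (rule fv_mono) (rule ini_le)

text \<open>Continuity of \<open>fv\<close> at limits: every entry already occurs in an initial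
  segment whose value is at most \<open>q\<close>. This lets branches keep promises and makes
  sublevel sets of \<open>fv\<close> closed.\<close>

lemma fv_limit_le:
  assumes "dom t = {..<\<alpha>}" "\<And>\<gamma>. \<gamma> < \<alpha> \<Longrightarrow> \<exists>\<delta>>\<gamma>. fv (ini t \<delta>) \<le> q" "0 \<le> q"
  shows "fv t \<le> q"
proof (rule fv_least[OF assms(3)])
  fix \<gamma> assume "\<gamma> \<in> dom t"
  then obtain \<delta> where \<delta>: "\<gamma> < \<delta>" "fv (ini t \<delta>) \<le> q" using assms by auto
  then have "rv (the (ini t \<delta> \<gamma>)) \<le> fv (ini t \<delta>)" using \<open>\<gamma> \<in> dom t\<close> by (intro fv_upper) auto
  then show "rv (the (t \<gamma>)) \<le> q" using \<delta> by simp
qed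

lemma bts_ini: "bts (ini t \<gamma>) = bts t \<inter> {..<\<gamma>}"
  by (auto simp: bts_def)

text \<open>The bound \<open>1\<close> is not automatic at limits; it leaves room for a further
  rational above the supremum.\<close>

definition increasing :: "node \<Rightarrow> bool" where
  "increasing t \<longleftrightarrow> fv t < 1 \<and> (\<forall>\<gamma>\<in>dom t. fv (ini t \<gamma>) < rv (the (t \<gamma>)))"

lemma increasing_strict:
  assumes "increasing y" "x \<subseteq>\<^sub>m y" "dom x = {..<\<beta>}" "dom y = {..<\<gamma>}" "\<beta> < \<gamma>"
  shows "fv x < fv y"
proof -
  have "x = ini y \<beta>" using assms map_le_iff_ini by metis
  then have "fv x < rv (the (y \<beta>))" using assms by (auto simp: increasing_def)
  also have "\<dots> \<le> fv y" by (rule fv_upper) (simp add: assms)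
  finally show ?thesis .
qed

lemma chain_limit:
  fixes s :: "nat \<Rightarrow> node" and e :: "nat \<Rightarrow> omega1"
  assumes dom: "\<And>n. dom (s n) = {..<e n}" and le: "\<And>n. s n \<subseteq>\<^sub>m s (Suc n)"
    and less: "\<And>n. e n < \<alpha>" and cof: "\<And>\<gamma>. \<gamma> < \<alpha> \<Longrightarrow> \<exists>n. \<gamma> < e n"
  shows "\<exists>b. dom b = {..<\<alpha>} \<and> (\<forall>n. ini b (e n) = s n)"
proof -
  define b where "b \<gamma> = (if \<gamma> < \<alpha> then s (LEAST n. \<gamma> < e n) \<gamma> else None)" for \<gamma>
  have mono: "s m \<subseteq>\<^sub>m s n" if "m \<le> n" for m n
    using that
  proof (induction rule: dec_induct)
    case (step n) then show ?case using map_le_trans[OF step.IH le] by simp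
  qed simp
  have b: "b \<gamma> = s n \<gamma>" if \<gamma>: "\<gamma> < e n" for \<gamma> n
  proof -
    define m where "m = (LEAST n. \<gamma> < e n)"
    have "\<gamma> < e m" unfolding m_def using \<gamma> by (rule LeastI)
    have "m \<le> n" unfolding m_def using \<gamma> by (rule Least_le)
    moreover have "\<gamma> \<in> dom (s m)" unfolding dom using \<open>\<gamma> < e m\<close> by simp
    ultimately have "s m \<gamma> = s n \<gamma>" using mono[of m n] unfolding map_le_def by blast
    moreover have "\<gamma> < \<alpha>" using \<gamma> less[of n] by (rule less_trans)
    ultimately show ?thesis by (simp add: b_def m_def)
  qed
  have "\<gamma> \<in> dom b \<longleftrightarrow> \<gamma> < \<alpha>" for \<gamma>
  proof
    assume "\<gamma> < \<alpha>"
    then obtain n where "\<gamma> < e n" using cof by blast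
    have "\<gamma> \<in> dom (s n)" unfolding dom using \<open>\<gamma> < e n\<close> by simp
    then show "\<gamma> \<in> dom b" using b[OF \<open>\<gamma> < e n\<close>] by (simp add: domIff)
  qed (simp add: b_def dom_def split: if_splits)
  then have 1: "dom b = {..<\<alpha>}" by blast
  have "s n \<subseteq>\<^sub>m b" for n
    unfolding map_le_def dom using b by simp
  then have "ini b (e n) = s n" for n using map_le_iff_ini[OF dom] by blast
  with 1 show ?thesis by blast
qed

subsection \<open>Branches through a countable limit stage\<close>

abbreviation branch :: "omega1 \<Rightarrow> node set \<Rightarrow> node \<Rightarrow> bool" where
  "branch \<alpha> TT b \<equiv> dom b = {..<\<alpha>} \<and> (\<forall>\<gamma><\<alpha>. ini b \<gamma> \<in> TT) \<and> increasing b"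

text \<open>In every use \<beta> is the height of \<open>x\<close>, so \<open>y\<close> carries no
  new label or exactly one, at its first new entry. The single label serves to mark pairs, the
  absence of labels to pass by the antichain.\<close>

abbreviation labelled :: "omega1 \<Rightarrow> bool \<Rightarrow> node \<Rightarrow> real \<Rightarrow> node \<Rightarrow> bool" where
  "labelled \<beta> lab x q y \<equiv>
     x \<subseteq>\<^sub>m y \<and> fv y < q \<and> bts y \<inter> {\<beta>..} = (if lab then {\<beta>} else {})"

text \<open>The last clause is the inductive strength: every node reaches every later level with an
  arbitrarily small increase of \<open>fv\<close> and full control of the labels, so that promises
  survive infinitely many steps.\<close>

definition pretree :: "omega1 \<Rightarrow> node set \<Rightarrow> bool" where
  "pretree \<alpha> TT \<longleftrightarrow> countable TT \<and> Map.empty \<in> TT \<and>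
     (\<forall>t\<in>TT. increasing t \<and> (\<exists>\<beta><\<alpha>. dom t = {..<\<beta>}) \<and> (\<forall>\<gamma>. ini t \<gamma> \<in> TT)) \<and>
     (\<forall>\<beta> \<beta>' x q b. \<beta> < \<beta>' \<longrightarrow> \<beta>' < \<alpha> \<longrightarrow> x \<in> level TT \<beta> \<longrightarrow> fv x < q \<longrightarrow>
        (\<exists>y\<in>level TT \<beta>'. labelled \<beta> b x q y))"

text \<open>Not relative to a tree: the same cone is tested against a prediction and against the set
  that it predicts.\<close>

definition cone :: "omega1 \<Rightarrow> node \<Rightarrow> real \<Rightarrow> bool \<Rightarrow> node set" where
  "cone \<eta> y q Z = {y'. y \<subseteq>\<^sub>m y' \<and> fv y' < q \<and> (Z \<longrightarrow> bts y' \<inter> {\<eta>..} = {})}"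

text \<open>Either the prediction \<open>B\<close> is met on the way from level \<open>\<eta>\<close> to level \<open>\<beta>\<close>, or it cannot be
  met above the node of level \<open>\<eta>\<close> as long as the promise encoded by \<open>q\<close> and \<open>Z\<close> is kept.\<close>

abbreviation sealed_at :: "node set \<Rightarrow> omega1 \<Rightarrow> omega1 \<Rightarrow> node \<Rightarrow> bool" where
  "sealed_at B \<gamma> \<beta> b \<equiv> \<exists>\<eta> q Z. \<gamma> \<le> \<eta> \<and> \<eta> < \<beta> \<and> fv b < q \<and> q \<in> \<rat> \<and>
     (Z \<longrightarrow> bts b \<inter> {\<eta>..} = {}) \<and>
     ((\<exists>\<epsilon>. \<eta> \<le> \<epsilon> \<and> \<epsilon> < \<beta> \<and> ini b \<epsilon> \<in> B) \<or> cone \<eta> (ini b \<eta>) q Z \<inter> B = {})"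

text \<open>The bound \<gamma> pushes the meeting points up towards \<alpha>. If the predictions at
  cofinally many ladder points are correct, the branch is a limit of the predicted set or keeps a
  promise that excludes this set.\<close>

definition sealed :: "omega1 \<Rightarrow> omega1 set \<Rightarrow> (omega1 \<Rightarrow> node set) \<Rightarrow> node \<Rightarrow> bool" where
  "sealed \<alpha> C BB b \<longleftrightarrow> (\<forall>\<gamma><\<alpha>. \<exists>\<delta><\<alpha>. \<forall>\<beta>\<in>C. \<delta> < \<beta> \<longrightarrow>
     sealed_at (BB \<beta>) \<gamma> \<beta> b)"

definition notabove :: "(node \<times> node) set \<Rightarrow> node \<Rightarrow> node \<Rightarrow> bool" where
  "notabove AA s t \<longleftrightarrow> (\<forall>a b. (a, b) \<in> AA \<longrightarrow> \<not> (a \<subseteq>\<^sub>m s \<and> b \<subseteq>\<^sub>m t))"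

definition signalled :: "(node \<times> node) set \<Rightarrow> bool" where
  "signalled AA \<longleftrightarrow> (\<forall>a b. (a, b) \<in> AA \<longrightarrow>
     (\<exists>\<gamma>. dom a = {..<\<gamma>} \<and> dom b = {..<\<gamma>} \<and> acc_of (bts a \<inter> bts b) \<gamma>))"

text \<open>A forcing condition for a pair of branches: two nodes of one height with a promised
  bound for both. Longer nodes and smaller \<open>q\<close> give stronger conditions.\<close>

definition cnd :: "node set \<Rightarrow> (node \<times> node) set \<Rightarrow> omega1 \<Rightarrow> node \<Rightarrow> node \<Rightarrow> real \<Rightarrow> bool" where
  "cnd TT AA \<beta> s t q \<longleftrightarrow> s \<in> level TT \<beta> \<and> t \<in> level TT \<beta> \<and> fv s < q \<and> fv t < q \<and> q \<in> \<rat> \<and>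
     notabove AA s t"

definition reach :: "node set \<Rightarrow> (node \<times> node) set \<Rightarrow> node \<Rightarrow> node \<Rightarrow> real \<Rightarrow> (node \<times> node) set" where
  "reach TT AA s t q = {(s', t'). s' \<in> TT \<and> t' \<in> TT \<and> dom s' = dom t' \<and> s \<subseteq>\<^sub>m s' \<and> t \<subseteq>\<^sub>m t' \<and>
     fv s' < q \<and> fv t' < q \<and> notabove AA s' t'}"

text \<open>Density of all \<open>\<Psi> k\<close> below the condition \<open>(s0, t0, q0)\<close>,
  relativized to heights below \<beta>, so that a climb to \<beta> can meet a requirement before it
  arrives.\<close>

definition ready :: "node set \<Rightarrow> (node \<times> node) set \<Rightarrow> (nat \<Rightarrow> node \<Rightarrow> node \<Rightarrow> real \<Rightarrow> bool) \<Rightarrow>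
    node \<Rightarrow> node \<Rightarrow> real \<Rightarrow> omega1 \<Rightarrow> bool" where
  "ready TT AA \<Psi> s0 t0 q0 \<beta> \<longleftrightarrow> (\<forall>k. \<forall>\<gamma><\<beta>. \<forall>s t q.
     cnd TT AA \<gamma> s t q \<and> s0 \<subseteq>\<^sub>m s \<and> t0 \<subseteq>\<^sub>m t \<and> q \<le> q0 \<longrightarrow>
     (\<exists>\<gamma>'<\<beta>. \<exists>s' t' q'. cnd TT AA \<gamma>' s' t' q' \<and> s \<subseteq>\<^sub>m s' \<and> t \<subseteq>\<^sub>m t' \<and> q' \<le> q \<and> \<Psi> k s' t' q'))"

text \<open>Density is demanded at cofinally many ladder points rather than at \<alpha>, because a
  pair of branches has to return to the ladder after each requirement.\<close>

definition dense :: "node set \<Rightarrow> (node \<times> node) set \<Rightarrow> omega1 set \<Rightarrow> omega1 \<Rightarrow>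
    (nat \<Rightarrow> node \<Rightarrow> node \<Rightarrow> real \<Rightarrow> bool) \<Rightarrow> bool" where
  "dense TT AA C \<alpha> \<Psi> \<longleftrightarrow> (\<exists>\<beta>0 s0 t0 q0. \<beta>0 < \<alpha> \<and> cnd TT AA \<beta>0 s0 t0 q0 \<and>
     (\<forall>\<gamma><\<alpha>. \<exists>\<beta>\<in>C. \<gamma> < \<beta> \<and> ready TT AA \<Psi> s0 t0 q0 \<beta>))"

abbreviation passes :: "node set \<Rightarrow> (node \<times> node) set \<Rightarrow> omega1 \<Rightarrow>
    (nat \<Rightarrow> node \<Rightarrow> node \<Rightarrow> real \<Rightarrow> bool) \<Rightarrow> node \<Rightarrow> node \<Rightarrow> nat \<Rightarrow> omega1 \<Rightarrow> bool" where
  "passes TT AA \<alpha> \<Psi> b c k \<gamma> \<equiv> \<exists>\<epsilon> r. \<gamma> \<le> \<epsilon> \<and> \<epsilon> < \<alpha> \<and> fv b < r \<and> fv c < r \<and>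
     cnd TT AA \<epsilon> (ini b \<epsilon>) (ini c \<epsilon>) r \<and> \<Psi> k (ini b \<epsilon>) (ini c \<epsilon>) r"

section \<open>Labels of extensions and the antichain below a pair\<close>

lemma levelD: "x \<in> level TT \<beta> \<Longrightarrow> x \<in> TT" "x \<in> level TT \<beta> \<Longrightarrow> dom x = {..<\<beta>}"
  by (simp_all add: level_def)

lemma levelI: "x \<in> TT \<Longrightarrow> dom x = {..<\<beta>} \<Longrightarrow> x \<in> level TT \<beta>"
  by (simp add: level_def)

lemma bts_outside: "dom x = {..<\<beta>} \<Longrightarrow> \<beta> \<le> \<gamma> \<Longrightarrow> bts x \<inter> {\<gamma>..} = {}"
  by (auto simp: bts_def dom_def set_eq_iff)

lemma bts_mono: "x \<subseteq>\<^sub>m y \<Longrightarrow> bts x \<subseteq> bts y"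
proof
  fix \<gamma> assume "x \<subseteq>\<^sub>m y" "\<gamma> \<in> bts x"
  moreover then have "x \<gamma> = y \<gamma>" by (simp add: bts_def map_le_def)
  ultimately show "\<gamma> \<in> bts y" by (simp add: bts_def domIff)
qed

lemma bts_extend:
  assumes "x \<subseteq>\<^sub>m y" "dom x = {..<\<beta>}"
  shows "bts y \<inter> {\<eta>..} \<subseteq> (bts x \<inter> {\<eta>..}) \<union> (bts y \<inter> {\<beta>..})"
proof -
  have "x = ini y \<beta>" using assms by (simp add: map_le_iff_ini)
  then have "bts x = bts y \<inter> {..<\<beta>}" using bts_ini by simp
  then show ?thesis using not_less by fastforce
qed

lemma notabove_converse: "notabove (AA\<inverse>) t s \<longleftrightarrow> notabove AA s t"
  unfolding notabove_def converse_iff by metis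

lemma signalled_converse: "signalled AA \<Longrightarrow> signalled (AA\<inverse>)"
  unfolding signalled_def by (metis Int_commute converseD)

lemma cnd_converse: "cnd TT (AA\<inverse>) \<beta> t s q \<longleftrightarrow> cnd TT AA \<beta> s t q"
  unfolding cnd_def notabove_converse by metis

text \<open>A member of \<open>AA\<close> of height beyond \<eta> has common labels cofinal in its
  height, hence one strictly above \<eta>; a member of height at most \<eta> would already lie below
  \<open>(s, t)\<close>. A common label at \<eta> itself does no harm.\<close>

lemma notabove_extend:
  assumes sig: "signalled AA" and dom: "dom s = {..<\<eta>}" "dom t = {..<\<eta>}"
    and na: "notabove AA s t" and le: "s \<subseteq>\<^sub>m s'" "t \<subseteq>\<^sub>m t'"
    and plain: "bts s' \<inter> bts t' \<inter> {\<eta><..} = {}"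
  shows "notabove AA s' t'"
  unfolding notabove_def
proof (intro allI impI notI, elim conjE)
  fix a b assume ab: "(a, b) \<in> AA" "a \<subseteq>\<^sub>m s'" "b \<subseteq>\<^sub>m t'"
  then obtain \<gamma> where \<gamma>: "dom a = {..<\<gamma>}" "dom b = {..<\<gamma>}" "acc_of (bts a \<inter> bts b) \<gamma>"
    using sig unfolding signalled_def by blast
  show False
  proof (cases "\<gamma> \<le> \<eta>")
    case True
    then have "a \<subseteq>\<^sub>m s" "b \<subseteq>\<^sub>m t"
      using map_le_comparable[OF ab(2) le(1) \<gamma>(1) dom(1)]
        map_le_comparable[OF ab(3) le(2) \<gamma>(2) dom(2)] by auto
    then show False using na ab(1) unfolding notabove_def by blast
  next
    case False
    then obtain \<epsilon> where "\<epsilon> \<in> bts a \<inter> bts b" "\<eta> < \<epsilon>"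
      using \<gamma>(3) unfolding acc_of_def by (meson not_le)
    then have "\<epsilon> \<in> bts s' \<inter> bts t' \<inter> {\<eta><..}"
      using bts_mono[OF ab(2)] bts_mono[OF ab(3)] by auto
    then show False using plain by blast
  qed
qed

lemma map_le_iniI:
  assumes "x \<subseteq>\<^sub>m b" "dom x = {..<\<gamma>}" "\<gamma> \<le> \<delta>"
  shows "x \<subseteq>\<^sub>m ini b \<delta>"
proof -
  have "x = ini b \<gamma>" using assms by (simp add: map_le_iff_ini)
  then show ?thesis using ini_mono[OF assms(3)] by simp
qed

lemma pretree_rich:
  assumes "pretree \<alpha> TT" "\<beta> < \<beta>'" "\<beta>' < \<alpha>" "x \<in> level TT \<beta>" "fv x < q"
  shows "\<exists>y\<in>level TT \<beta>'. labelled \<beta> b x q y"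
  using assms unfolding pretree_def by blast

section \<open>Branches of limit length, alone and in pairs\<close>

locale limit_stage =
  fixes \<alpha> :: omega1 and TT :: "node set" and C :: "omega1 set" and BB :: "omega1 \<Rightarrow> node set"
  assumes pretree: "pretree \<alpha> TT" and limit: "limit_ord \<alpha>"
    and C: "C \<subseteq> {..<\<alpha>}" "acc_of C \<alpha>" "order_type_omega C"
    and BB: "\<And>\<beta>. \<beta> \<in> C \<Longrightarrow> BB \<beta> \<subseteq> {t \<in> TT. \<exists>\<gamma><\<beta>. dom t = {..<\<gamma>}}"
begin

lemma C_less: "\<beta> \<in> C \<Longrightarrow> \<beta> < \<alpha>"
  using C by auto

lemma TT_increasing: "t \<in> TT \<Longrightarrow> increasing t"
  using pretree by (simp add: pretree_def)

lemma TT_ini: "t \<in> TT \<Longrightarrow> ini t \<gamma> \<in> TT"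
  using pretree by (simp add: pretree_def)

lemma TT_lt1: "t \<in> TT \<Longrightarrow> fv t < 1"
  using TT_increasing by (simp add: increasing_def)

lemmas rich = pretree_rich[OF pretree _ _]

lemma extend_to:
  assumes x: "x \<in> level TT \<beta>" and le: "\<beta> \<le> \<beta>'" "\<beta>' < \<alpha>" "fv x < q"
  shows "\<exists>y\<in>level TT \<beta>'. x \<subseteq>\<^sub>m y \<and> fv y < q \<and> bts y \<inter> {\<beta>..} = {}"
proof (cases "\<beta> = \<beta>'")
  case True
  then show ?thesis
    using x le bts_outside[OF levelD(2)[OF x]] by (intro bexI[of _ x]) auto
next
  case False
  then show ?thesis using rich[OF _ le(2) x le(3), where b = False] le(1) by simp
qed

text \<open>A limit only inherits \<open>fv b \<le> q (Suc n)\<close>; the strictly decreasing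
  bounds turn this into \<open>fv b < q n\<close>.\<close>

lemma limit_branch:
  fixes s :: "nat \<Rightarrow> node" and d :: "nat \<Rightarrow> omega1" and q :: "nat \<Rightarrow> real"
  assumes s: "\<And>n. s n \<in> level TT (d n)" "\<And>n. s n \<subseteq>\<^sub>m s (Suc n)"
    and q: "\<And>n. fv (s n) < q n" "\<And>n. q (Suc n) < q n" "q 0 \<le> 1"
    and d: "\<And>n. d n < \<alpha>" "\<And>\<gamma>. \<gamma> < \<alpha> \<Longrightarrow> \<exists>n. \<gamma> < d n"
  shows "\<exists>b. dom b = {..<\<alpha>} \<and> (\<forall>n. ini b (d n) = s n) \<and> (\<forall>\<gamma><\<alpha>. ini b \<gamma> \<in> TT) \<and> increasing b \<and>
    (\<forall>n. fv b < q n)"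
proof -
  have dom: "dom (s n) = {..<d n}" for n using s(1) levelD by blast
  obtain b where b: "dom b = {..<\<alpha>}" "\<And>n. ini b (d n) = s n"
    using chain_limit[of s d \<alpha>, OF dom s(2) d] by blast
  have in_TT: "ini b \<gamma> \<in> TT" if \<gamma>: "\<gamma> < \<alpha>" for \<gamma>
  proof -
    obtain n where n: "\<gamma> < d n" using d(2) \<gamma> by blast
    have "ini b \<gamma> = ini (s n) \<gamma>" using ini_ini_le[of \<gamma> "d n" b] n b(2) by simp
    moreover have "s n \<in> TT" using s(1) levelD by blast
    ultimately show ?thesis using TT_ini by simp
  qed
  have qmono: "q n \<le> q m" if "m \<le> n" for m n
    using that by (induction rule: dec_induct) (use q(2) in \<open>auto intro: less_imp_le order_trans\<close>)
  have fv: "fv b < q n" for n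
  proof -
    have "fv b \<le> q (Suc n)"
    proof (rule fv_limit_le[OF b(1)])
      show "0 \<le> q (Suc n)" using q(1)[of "Suc n"] fv_nonneg[of "s (Suc n)"] by linarith
      fix \<gamma> assume "\<gamma> < \<alpha>"
      then obtain m where m: "\<gamma> < d m" using d(2) by blast
      have "ini b (d m) \<subseteq>\<^sub>m ini b (d (max m (Suc n)))"
      proof (cases "d m \<le> d (max m (Suc n))")
        case False
        then have "s (max m (Suc n)) \<subseteq>\<^sub>m s m"
          using ini_mono[of "d (max m (Suc n))" "d m" b] b(2) by simp
        moreover have "s m \<subseteq>\<^sub>m s k" if "m \<le> k" for k
          using that
        proof (induction rule: dec_induct)
          case (step n) then show ?case using map_le_trans[OF step.IH s(2)] by simp
        qed simp
        ultimately show ?thesis using b(2) by simp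
      qed (rule ini_mono)
      then have "fv (ini b (d m)) \<le> fv (s (max m (Suc n)))"
        using fv_mono b(2) by simp
      also have "\<dots> \<le> q (max m (Suc n))" using q(1) by (simp add: less_imp_le)
      also have "\<dots> \<le> q (Suc n)" by (rule qmono) simp
      finally show "\<exists>\<delta>>\<gamma>. fv (ini b \<delta>) \<le> q (Suc n)" using m by blast
    qed
    also have "\<dots> < q n" by (rule q(2))
    finally show ?thesis .
  qed
  have "increasing b"
    unfolding increasing_def
  proof (intro conjI ballI)
    show "fv b < 1" using fv[of 0] q(3) by linarith
    fix \<gamma> assume "\<gamma> \<in> dom b"
    then have "\<gamma> < \<alpha>" using b by simp
    then obtain n where n: "\<gamma> < d n" using d(2) by blast
    have "s n \<in> TT" using s(1) levelD by blast
    then have "increasing (s n)" by (rule TT_increasing)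
    moreover have "\<gamma> \<in> dom (s n)" using dom n by simp
    ultimately have "fv (ini (s n) \<gamma>) < rv (the (s n \<gamma>))" unfolding increasing_def by blast
    moreover have "ini (s n) \<gamma> = ini b \<gamma>" using ini_ini_le[of \<gamma> "d n" b] n b(2) by simp
    moreover have "s n \<gamma> = b \<gamma>" using b(2)[of n] n by (metis ini_apply)
    ultimately show "fv (ini b \<gamma>) < rv (the (b \<gamma>))" by simp
  qed
  with b fv in_TT show ?thesis by blast
qed

text \<open>The contribution of one climb from \<beta> to the ladder point \<open>\<beta>'\<close>.
  It speaks only about initial segments of \<open>s\<close> below \<open>\<beta>'\<close>, so it
  passes on to every branch through \<open>s\<close>.\<close>

definition seal_step :: "bool \<Rightarrow> omega1 \<Rightarrow> omega1 \<Rightarrow> real \<Rightarrow> node \<Rightarrow> bool" where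
  "seal_step Z \<beta> \<beta>' q s \<longleftrightarrow> (\<exists>\<eta>. \<beta> \<le> \<eta> \<and> \<eta> < \<beta>' \<and>
     ((\<exists>\<epsilon>. \<eta> \<le> \<epsilon> \<and> \<epsilon> < \<beta>' \<and> ini s \<epsilon> \<in> BB \<beta>') \<or> cone \<eta> (ini s \<eta>) q Z \<inter> BB \<beta>' = {}))"

lemma seal_stepI:
  assumes "dom x = {..<\<eta>}" "x \<subseteq>\<^sub>m s" "\<beta> \<le> \<eta>" "\<eta> < \<beta>'"
    "x \<in> BB \<beta>' \<or> cone \<eta> x q Z \<inter> BB \<beta>' = {}"
  shows "seal_step Z \<beta> \<beta>' q s"
proof -
  have "ini s \<eta> = x" using assms by (simp add: map_le_iff_ini)
  then show ?thesis unfolding seal_step_def using assms by (intro exI[of _ \<eta>]) auto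
qed

text \<open>Every ladder point beyond \<open>e k\<close> is some \<open>e (Suc n)\<close> with
  \<open>n \<ge> k\<close>, and the climb that ends there provides its seal. The offset
  \<open>k\<close> leaves out initial climbs spent on another task.\<close>

lemma sealedI:
  fixes e :: "nat \<Rightarrow> omega1"
  assumes e: "strict_mono e" "\<And>n. e n < \<alpha>" "\<And>\<gamma>. \<gamma> < \<alpha> \<Longrightarrow> \<exists>n. \<gamma> < e n"
      "\<And>\<beta>. \<beta> \<in> C \<Longrightarrow> e 0 < \<beta> \<Longrightarrow> \<exists>n. \<beta> = e (Suc n)"
    and b: "\<And>n. k \<le> n \<Longrightarrow> fv b < q n" "\<And>n. k \<le> n \<Longrightarrow> q n \<in> \<rat>"
      "\<And>n. k \<le> n \<Longrightarrow> Z \<Longrightarrow> bts b \<inter> {e n..} = {}"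
      "\<And>n. k \<le> n \<Longrightarrow> seal_step Z (e n) (e (Suc n)) (q n) (ini b (e (Suc n)))"
  shows "sealed \<alpha> C BB b"
  unfolding sealed_def
proof (intro allI impI)
  fix \<gamma> assume "\<gamma> < \<alpha>"
  then obtain m where m: "\<gamma> < e m" using e(3) by blast
  show "\<exists>\<delta><\<alpha>. \<forall>\<beta>\<in>C. \<delta> < \<beta> \<longrightarrow> sealed_at (BB \<beta>) \<gamma> \<beta> b"
  proof (rule exI[of _ "e (max m k)"], intro conjI ballI impI e(2))
    fix \<beta> assume \<beta>: "\<beta> \<in> C" "e (max m k) < \<beta>"
    have "e 0 \<le> e (max m k)" using e(1) by (metis strict_mono_less_eq zero_le)
    then have "e 0 < \<beta>" using \<beta>(2) by simp
    then obtain n where n: "\<beta> = e (Suc n)" using e(4)[OF \<beta>(1)] by blast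
    then have mk: "m \<le> n" "k \<le> n" using \<beta>(2) e(1) by (simp_all add: strict_mono_less)
    then have "e m \<le> e n" using e(1) by (simp add: strict_mono_less_eq)
    obtain \<eta> where \<eta>: "e n \<le> \<eta>" "\<eta> < \<beta>"
      "(\<exists>\<epsilon>. \<eta> \<le> \<epsilon> \<and> \<epsilon> < \<beta> \<and> ini (ini b \<beta>) \<epsilon> \<in> BB \<beta>) \<or> cone \<eta> (ini (ini b \<beta>) \<eta>) (q n) Z \<inter> BB \<beta> = {}"
      using b(4)[OF mk(2)] unfolding seal_step_def n by blast
    have "ini (ini b \<beta>) \<epsilon> = ini b \<epsilon>" if "\<epsilon> < \<beta>" for \<epsilon>
      using ini_ini_le[of \<epsilon> \<beta> b] that by simp
    then have "(\<exists>\<epsilon>. \<eta> \<le> \<epsilon> \<and> \<epsilon> < \<beta> \<and> ini b \<epsilon> \<in> BB \<beta>) \<or> cone \<eta> (ini b \<eta>) (q n) Z \<inter> BB \<beta> = {}"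
      using \<eta>(2,3) by metis
    moreover have "Z \<longrightarrow> bts b \<inter> {\<eta>..} = {}" using b(3)[OF mk(2)] \<eta>(1) by fastforce
    moreover have "\<gamma> \<le> \<eta>" using m \<open>e m \<le> e n\<close> \<eta>(1) by simp
    ultimately show "sealed_at (BB \<beta>) \<gamma> \<beta> b"
      using \<eta>(2) b(1,2)[OF mk(2)]
      by (intro exI[of _ \<eta>] exI[of _ "q n"] exI[of _ Z]) blast
  qed
qed

text \<open>The usual step of a Souslin-type construction: if the cone meets the prediction, climb
  through a common member, otherwise climb anyhow. The promise includes that no further label
  occurs, hence the flag \<open>True\<close>.\<close>

lemma single_step:
  assumes x: "x \<in> level TT \<beta>" and \<beta>': "\<beta> < \<beta>'" "\<beta>' \<in> C" and q: "fv x < q"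
  shows "\<exists>x'\<in>level TT \<beta>'. \<exists>q'\<in>\<rat>. x \<subseteq>\<^sub>m x' \<and> fv x' < q' \<and> q' < q \<and> bts x' \<inter> {\<beta>..} = {} \<and>
    seal_step True \<beta> \<beta>' q x'"
proof (cases "cone \<beta> x q True \<inter> BB \<beta>' = {}")
  case True
  obtain x' where x': "x' \<in> level TT \<beta>'" "x \<subseteq>\<^sub>m x'" "fv x' < q" "bts x' \<inter> {\<beta>..} = {}"
    using extend_to[OF x less_imp_le[OF \<beta>'(1)] C_less[OF \<beta>'(2)] q] by blast
  obtain q' where q': "q' \<in> \<rat>" "fv x' < q'" "q' < q" using Rats_dense_in_real[OF x'(3)] by blast
  show ?thesis
    using seal_stepI[OF levelD(2)[OF x] x'(2) order_refl \<beta>'(1)] True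
    by (intro bexI[OF _ x'(1)] bexI[OF _ q'(1)]) (use x' q' in simp)
next
  case False
  then obtain y where y: "x \<subseteq>\<^sub>m y" "fv y < q" "bts y \<inter> {\<beta>..} = {}" "y \<in> BB \<beta>'"
    by (auto simp: cone_def)
  then obtain \<gamma> where \<gamma>: "y \<in> TT" "\<gamma> < \<beta>'" "dom y = {..<\<gamma>}" using BB[OF \<beta>'(2)] by blast
  have "\<beta> \<le> \<gamma>" by (rule map_le_dom_le[OF y(1) levelD(2)[OF x] \<gamma>(3)])
  obtain x' where x': "x' \<in> level TT \<beta>'" "y \<subseteq>\<^sub>m x'" "fv x' < q" "bts x' \<inter> {\<gamma>..} = {}"
    using extend_to[OF levelI[OF \<gamma>(1,3)] less_imp_le[OF \<gamma>(2)] C_less[OF \<beta>'(2)] y(2)] by blast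
  obtain q' where q': "q' \<in> \<rat>" "fv x' < q'" "q' < q" using Rats_dense_in_real[OF x'(3)] by blast
  have "bts x' \<inter> {\<beta>..} = {}" using bts_extend[OF x'(2) \<gamma>(3), of \<beta>] y(3) x'(4) by blast
  moreover have "seal_step True \<beta> \<beta>' q x'" using seal_stepI[OF \<gamma>(3) x'(2) \<open>\<beta> \<le> \<gamma>\<close> \<gamma>(2)] y(4) by blast
  moreover have "x \<subseteq>\<^sub>m x'" using y(1) x'(2) by (rule map_le_trans)
  ultimately show ?thesis
    by (intro bexI[OF _ x'(1)] bexI[OF _ q'(1)]) (use q' in blast)
qed

text \<open>A label, if wanted, is placed on the way to the first ladder point beyond
  \<open>\<beta>0\<close>. From there on the branch carries no labels, and sealing begins.\<close>

lemma single_limit: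
  assumes x: "x \<in> level TT \<beta>0" and \<beta>0: "\<beta>0 < \<alpha>" and q: "fv x < q"
  shows "\<exists>b. branch \<alpha> TT b \<and> x \<subseteq>\<^sub>m b \<and> fv b < q \<and>
    bts b \<inter> {\<beta>0..} = (if lab then {\<beta>0} else {}) \<and> sealed \<alpha> C BB b"
proof -
  define S where "S = (if lab then {\<beta>0} else {})"
  obtain e where e: "e 0 = \<beta>0" "strict_mono e" "\<And>n. e (Suc n) \<in> C" "\<And>n. e n < \<alpha>"
    "\<And>\<gamma>. \<gamma> < \<alpha> \<Longrightarrow> \<exists>n. \<gamma> < e n" "\<And>\<beta>. \<beta> \<in> C \<Longrightarrow> \<beta>0 < \<beta> \<Longrightarrow> \<exists>n. \<beta> = e (Suc n)"
    using ladder_enumeration[OF C \<beta>0] by metis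
  have e_less: "e m < e n \<longleftrightarrow> m < n" for m n using e(2) by (simp add: strict_mono_less)
  \<comment> \<open>The cap at \<open>1\<close> makes the limit satisfy
    \<open>increasing\<close>.\<close>
  have "fv x < min q 1" using q TT_lt1 levelD(1)[OF x] by simp
  then obtain q1 where q1: "q1 \<in> \<rat>" "fv x < q1" "q1 < min q 1" using Rats_dense_in_real by blast
  define P where "P n p \<longleftrightarrow> fst p \<in> level TT (e (Suc n)) \<and> fv (fst p) < snd p \<and> snd p \<in> \<rat> \<and>
    snd p \<le> q1 \<and> x \<subseteq>\<^sub>m fst p \<and> bts (fst p) \<inter> {\<beta>0..} = S" for n and p :: "node \<times> real"
  define R where "R n p p' \<longleftrightarrow> fst p \<subseteq>\<^sub>m fst p' \<and> snd p' < snd p \<and>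
    seal_step True (e (Suc n)) (e (Suc (Suc n))) (snd p) (fst p')"
    for n and p p' :: "node \<times> real"
  have "\<exists>p. P 0 p"
  proof -
    have "\<beta>0 < e (Suc 0)" using e_less[of 0 "Suc 0"] e(1) by simp
    then obtain y where "y \<in> level TT (e (Suc 0))" "x \<subseteq>\<^sub>m y" "fv y < q1" "bts y \<inter> {\<beta>0..} = S"
      using rich[OF _ e(4) x q1(2), where b = lab] unfolding S_def by blast
    then have "P 0 (y, q1)" using q1 by (simp add: P_def)
    then show ?thesis ..
  qed
  moreover have "\<exists>p'. P (Suc n) p' \<and> R n p p'" if p: "P n p" for n p
  proof -
    obtain y r where yr: "p = (y, r)" by (cases p)
    have y: "y \<in> level TT (e (Suc n))" "fv y < r" "r \<le> q1" "x \<subseteq>\<^sub>m y" "bts y \<inter> {\<beta>0..} = S"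
      using p by (simp_all add: P_def yr)
    have "e (Suc n) < e (Suc (Suc n))" by (simp add: e_less)
    from single_step[OF y(1) this e(3) y(2)] obtain y' r' where
      y': "y' \<in> level TT (e (Suc (Suc n)))" "r' \<in> \<rat>" "y \<subseteq>\<^sub>m y'" "fv y' < r'" "r' < r"
      "bts y' \<inter> {e (Suc n)..} = {}"
      "seal_step True (e (Suc n)) (e (Suc (Suc n))) r y'" by blast
    have "bts y' \<inter> {\<beta>0..} \<subseteq> bts y \<inter> {\<beta>0..}"
      using bts_extend[OF y'(3) levelD(2)[OF y(1)], of \<beta>0] y'(6) by blast
    then have "bts y' \<inter> {\<beta>0..} = S" using bts_mono[OF y'(3)] y(5) by blast
    moreover have "x \<subseteq>\<^sub>m y'" using y(4) y'(3) by (rule map_le_trans)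
    ultimately have "P (Suc n) (y', r')" using y y' by (simp add: P_def)
    moreover have "R n p (y', r')" using y'(3,5,7) by (simp add: R_def yr)
    ultimately show ?thesis by blast
  qed
  ultimately have "\<exists>p. \<forall>n. P n (p n) \<and> R n (p n) (p (Suc n))"
    by (rule dependent_nat_choice)
  then obtain p where p: "\<And>n. P n (p n)" "\<And>n. R n (p n) (p (Suc n))" by blast
  have "\<exists>b. dom b = {..<\<alpha>} \<and> (\<forall>n. ini b (e (Suc n)) = fst (p n)) \<and> (\<forall>\<gamma><\<alpha>. ini b \<gamma> \<in> TT) \<and>
    increasing b \<and> (\<forall>n. fv b < snd (p n))"
  proof (rule limit_branch)
    show "fst (p n) \<in> level TT (e (Suc n))" "fv (fst (p n)) < snd (p n)" for n
      using p(1)[of n] by (simp_all add: P_def)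
    show "fst (p n) \<subseteq>\<^sub>m fst (p (Suc n))" "snd (p (Suc n)) < snd (p n)" for n
      using p(2)[of n] by (simp_all add: R_def)
    show "snd (p 0) \<le> 1" using p(1)[of 0] q1 by (simp add: P_def)
    show "e (Suc n) < \<alpha>" for n by (rule e(4))
    fix \<gamma> assume "\<gamma> < \<alpha>"
    then obtain n where "\<gamma> < e n" using e(5) by blast
    moreover have "e n < e (Suc n)" by (simp add: e_less)
    ultimately show "\<exists>n. \<gamma> < e (Suc n)" using less_trans by blast
  qed
  then obtain b where b: "dom b = {..<\<alpha>}" "\<And>n. ini b (e (Suc n)) = fst (p n)"
    "\<And>\<gamma>. \<gamma> < \<alpha> \<Longrightarrow> ini b \<gamma> \<in> TT" "increasing b" "\<And>n. fv b < snd (p n)" by blast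
  have xb: "x \<subseteq>\<^sub>m b"
    using p(1)[of 0] map_le_trans[OF _ ini_le[of b "e (Suc 0)"]] b(2)[of 0] by (simp add: P_def)
  have S: "bts b \<inter> {\<beta>0..} = S"
  proof
    show "bts b \<inter> {\<beta>0..} \<subseteq> S"
    proof
      fix \<gamma> assume \<gamma>: "\<gamma> \<in> bts b \<inter> {\<beta>0..}"
      then have "\<gamma> < \<alpha>" using b(1) by (auto simp: bts_def)
      then obtain n where "\<gamma> < e n" using e(5) by blast
      moreover have "e n < e (Suc n)" by (simp add: e_less)
      ultimately have "\<gamma> < e (Suc n)" by simp
      then have "\<gamma> \<in> bts (ini b (e (Suc n))) \<inter> {\<beta>0..}" using \<gamma> by (simp add: bts_ini)
      moreover have "bts (fst (p n)) \<inter> {\<beta>0..} = S" using p(1)[of n] by (simp add: P_def)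
      ultimately show "\<gamma> \<in> S" unfolding b(2) by blast
    qed
    have "bts (fst (p 0)) \<subseteq> bts b" using bts_mono[OF ini_le] b(2)[of 0] by metis
    then show "S \<subseteq> bts b \<inter> {\<beta>0..}" using p(1)[of 0] by (auto simp: P_def)
  qed
  have "sealed \<alpha> C BB b"
  \<comment> \<open>The climb to \<open>e 1\<close> was spent on the label and is left out. The
    bound in force at \<open>e n\<close> belongs to \<open>p (n - 1)\<close>, since \<open>p\<close>
    starts at \<open>e 1\<close>.\<close>
  proof (rule sealedI[OF e(2,4,5), where k = 1 and q = "\<lambda>n. snd (p (n - 1))" and Z = True])
    show "\<exists>n. \<beta> = e (Suc n)" if "\<beta> \<in> C" "e 0 < \<beta>" for \<beta> using e(1,6) that by blast
    fix n :: nat assume "1 \<le> n"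
    then obtain m where m: "n = Suc m" by (cases n) auto
    show "fv b < snd (p (n - 1))" "snd (p (n - 1)) \<in> \<rat>"
      using b(5) p(1)[of m] by (simp_all add: m P_def)
    show "seal_step True (e n) (e (Suc n)) (snd (p (n - 1))) (ini b (e (Suc n)))"
      using p(2)[of m] by (simp add: m R_def b(2))
    have "\<beta>0 < e n" using e_less[of 0 n] e(1) m by simp
    then have "bts b \<inter> {e n..} \<subseteq> S \<inter> {e n..}" using S by auto
    also have "\<dots> = {}" using \<open>\<beta>0 < e n\<close> by (auto simp: S_def)
    finally show "bts b \<inter> {e n..} = {}" by blast
  qed
  moreover have "fv b < q" using b(5)[of 0] p(1)[of 0] q1 by (simp add: P_def)
  ultimately show ?thesis using b xb S unfolding S_def by blast
qed

text \<open>Meeting the prediction with the first coordinate; the second coordinate follows without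
  carrying labels, so that no pair in \<open>AA\<close> is crossed.\<close>

lemma pair_seal:
  assumes sig: "signalled AA" and p: "cnd TT AA \<beta> s t q" and \<beta>': "\<beta> < \<beta>'" "\<beta>' \<in> C"
  shows "\<exists>\<gamma> s' t'. \<beta> \<le> \<gamma> \<and> \<gamma> < \<beta>' \<and> cnd TT AA \<gamma> s' t' q \<and> s \<subseteq>\<^sub>m s' \<and> t \<subseteq>\<^sub>m t' \<and>
    (s' \<in> BB \<beta>' \<or> \<gamma> = \<beta> \<and> s' = s \<and> cone \<beta> s q False \<inter> BB \<beta>' = {})"
proof (cases "cone \<beta> s q False \<inter> BB \<beta>' = {}")
  case True
  then show ?thesis using p \<beta>' by (intro exI[of _ \<beta>] exI[of _ s] exI[of _ t]) simp
next
  case False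
  have st: "s \<in> level TT \<beta>" "t \<in> level TT \<beta>" "fv t < q" "q \<in> \<rat>" "notabove AA s t"
    using p by (simp_all add: cnd_def)
  obtain y where y: "s \<subseteq>\<^sub>m y" "fv y < q" "y \<in> BB \<beta>'"
    using False by (auto simp: cone_def)
  then obtain \<gamma> where \<gamma>: "y \<in> TT" "\<gamma> < \<beta>'" "dom y = {..<\<gamma>}" using BB[OF \<beta>'(2)] by blast
  have le: "\<beta> \<le> \<gamma>" by (rule map_le_dom_le[OF y(1) levelD(2)[OF st(1)] \<gamma>(3)])
  have "\<gamma> < \<alpha>" using \<gamma>(2) C_less[OF \<beta>'(2)] by simp
  then obtain t' where t': "t' \<in> level TT \<gamma>" "t \<subseteq>\<^sub>m t'" "fv t' < q" "bts t' \<inter> {\<beta>..} = {}"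
    using extend_to[OF st(2) le _ st(3)] by blast
  have "bts y \<inter> bts t' \<inter> {\<beta><..} = {}" using t'(4) by fastforce
  then have "notabove AA y t'"
    by (rule notabove_extend[OF sig levelD(2)[OF st(1)] levelD(2)[OF st(2)] st(5) y(1) t'(2)])
  then have "cnd TT AA \<gamma> y t' q" using levelI[OF \<gamma>(1,3)] t' st y by (simp add: cnd_def)
  then show ?thesis using le \<gamma> y t' by blast
qed

text \<open>One common label exactly at the starting height is tolerated by
  \<open>notabove_extend\<close>. Repeated along the ladder, it provides the cofinal common labels
  with which the limit pair may join the antichain.\<close>

lemma pair_signal:
  assumes sig: "signalled AA" and p: "cnd TT AA \<beta> s t q" and \<beta>': "\<beta> < \<beta>'" "\<beta>' \<in> C"
  shows "\<exists>s' t' q'. cnd TT AA \<beta>' s' t' q' \<and> s \<subseteq>\<^sub>m s' \<and> t \<subseteq>\<^sub>m t' \<and> q' < q \<and> \<beta> \<in> bts s' \<inter> bts t'"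
proof -
  have st: "s \<in> level TT \<beta>" "t \<in> level TT \<beta>" "fv s < q" "fv t < q" "notabove AA s t"
    using p by (simp_all add: cnd_def)
  obtain s' where s': "s' \<in> level TT \<beta>'" "s \<subseteq>\<^sub>m s'" "fv s' < q" "bts s' \<inter> {\<beta>..} = {\<beta>}"
    using rich[OF \<beta>'(1) C_less[OF \<beta>'(2)] st(1,3), where b = True] by auto
  obtain t' where t': "t' \<in> level TT \<beta>'" "t \<subseteq>\<^sub>m t'" "fv t' < q" "bts t' \<inter> {\<beta>..} = {\<beta>}"
    using rich[OF \<beta>'(1) C_less[OF \<beta>'(2)] st(2,4), where b = True] by auto
  have "max (fv s') (fv t') < q" using s' t' by simp
  then obtain q' where q': "q' \<in> \<rat>" "max (fv s') (fv t') < q'" "q' < q"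
    using Rats_dense_in_real by blast
  have "bts s' \<inter> bts t' \<inter> {\<beta><..} = {}" using s'(4) by fastforce
  then have "notabove AA s' t'"
    by (rule notabove_extend[OF sig levelD(2)[OF st(1)] levelD(2)[OF st(2)] st(5) s'(2) t'(2)])
  then have "cnd TT AA \<beta>' s' t' q'" using s' t' q' by (simp add: cnd_def)
  moreover have "\<beta> \<in> bts s' \<inter> bts t'" using s'(4) t'(4) by blast
  ultimately show ?thesis using s'(2) t'(2) q'(3) by blast
qed

text \<open>Four tasks in one climb: the first coordinate is sealed, then the second, then
  \<open>\<Psi> k\<close> is met if \<open>\<beta>'\<close> is ready, and last a common label is
  set. Each task only prolongs the nodes, so the earlier achievements persist.\<close>

lemma pair_step:
  assumes sig: "signalled AA" and p: "cnd TT AA \<beta> s t q" and \<beta>': "\<beta> < \<beta>'" "\<beta>' \<in> C"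
    and p0: "s0 \<subseteq>\<^sub>m s" "t0 \<subseteq>\<^sub>m t" "q \<le> q0"
  shows "\<exists>s' t' q'. cnd TT AA \<beta>' s' t' q' \<and> s \<subseteq>\<^sub>m s' \<and> t \<subseteq>\<^sub>m t' \<and> q' < q \<and>
    (\<exists>\<eta>\<ge>\<beta>. \<eta> \<in> bts s' \<inter> bts t') \<and> seal_step False \<beta> \<beta>' q s' \<and> seal_step False \<beta> \<beta>' q t' \<and>
    (ready TT AA \<Psi> s0 t0 q0 \<beta>' \<longrightarrow>
      (\<exists>\<epsilon> r. \<beta> \<le> \<epsilon> \<and> \<epsilon> < \<beta>' \<and> q' < r \<and> cnd TT AA \<epsilon> (ini s' \<epsilon>) (ini t' \<epsilon>) r \<and>
         \<Psi> k (ini s' \<epsilon>) (ini t' \<epsilon>) r))"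
proof -
  obtain \<gamma>1 s1 t1 where 1: "\<beta> \<le> \<gamma>1" "\<gamma>1 < \<beta>'" "cnd TT AA \<gamma>1 s1 t1 q" "s \<subseteq>\<^sub>m s1" "t \<subseteq>\<^sub>m t1"
    "s1 \<in> BB \<beta>' \<or> \<gamma>1 = \<beta> \<and> s1 = s \<and> cone \<beta> s q False \<inter> BB \<beta>' = {}"
    using pair_seal[OF sig p \<beta>'] by blast
  \<comment> \<open>Passing to the converse relation exchanges the coordinates, so the second one is
    sealed by the same lemma.\<close>
  have "cnd TT (AA\<inverse>) \<gamma>1 t1 s1 q" using 1(3) cnd_converse by blast
  from pair_seal[OF signalled_converse[OF sig] this 1(2) \<beta>'(2)]
  obtain \<gamma>2 s2 t2 where 2: "\<gamma>1 \<le> \<gamma>2" "\<gamma>2 < \<beta>'" "cnd TT (AA\<inverse>) \<gamma>2 t2 s2 q" "t1 \<subseteq>\<^sub>m t2" "s1 \<subseteq>\<^sub>m s2"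
    "t2 \<in> BB \<beta>' \<or> \<gamma>2 = \<gamma>1 \<and> t2 = t1 \<and> cone \<gamma>1 t1 q False \<inter> BB \<beta>' = {}"
    by blast
  have c2: "cnd TT AA \<gamma>2 s2 t2 q" using 2(3) cnd_converse by blast
  have s02: "s0 \<subseteq>\<^sub>m s2" "t0 \<subseteq>\<^sub>m t2" using p0 1 2 map_le_trans by metis+
  have "\<exists>\<gamma>3 s3 t3 q3. \<gamma>2 \<le> \<gamma>3 \<and> \<gamma>3 < \<beta>' \<and> cnd TT AA \<gamma>3 s3 t3 q3 \<and> s2 \<subseteq>\<^sub>m s3 \<and> t2 \<subseteq>\<^sub>m t3 \<and> q3 \<le> q \<and>
    (ready TT AA \<Psi> s0 t0 q0 \<beta>' \<longrightarrow> \<Psi> k s3 t3 q3)"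
  proof (cases "ready TT AA \<Psi> s0 t0 q0 \<beta>'")
    case True
    then obtain \<gamma>3 s3 t3 q3 where 3: "\<gamma>3 < \<beta>'" "cnd TT AA \<gamma>3 s3 t3 q3" "s2 \<subseteq>\<^sub>m s3" "t2 \<subseteq>\<^sub>m t3" "q3 \<le> q"
      "\<Psi> k s3 t3 q3"
      using 2(2) c2 s02 p0(3) unfolding ready_def by meson
    have "\<gamma>2 \<le> \<gamma>3"
      using map_le_dom_le[OF 3(3)] c2 3(2) unfolding cnd_def by (meson levelD(2))
    then show ?thesis using 3 by blast
  next
    case False
    then show ?thesis using 2(2) c2
      by (intro exI[of _ \<gamma>2] exI[of _ s2] exI[of _ t2] exI[of _ q]) simp
  qed
  then obtain \<gamma>3 s3 t3 q3 where 3: "\<gamma>2 \<le> \<gamma>3" "\<gamma>3 < \<beta>'" "cnd TT AA \<gamma>3 s3 t3 q3" "s2 \<subseteq>\<^sub>m s3"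
    "t2 \<subseteq>\<^sub>m t3" "q3 \<le> q" "ready TT AA \<Psi> s0 t0 q0 \<beta>' \<longrightarrow> \<Psi> k s3 t3 q3" by blast
  obtain s' t' q' where 4: "cnd TT AA \<beta>' s' t' q'" "s3 \<subseteq>\<^sub>m s'" "t3 \<subseteq>\<^sub>m t'" "q' < q3"
    "\<gamma>3 \<in> bts s' \<inter> bts t'"
    using pair_signal[OF sig 3(3,2) \<beta>'(2)] by blast
  have dom1: "dom s1 = {..<\<gamma>1}" "dom t1 = {..<\<gamma>1}" using 1(3) levelD(2) unfolding cnd_def by blast+
  have dom2: "dom t2 = {..<\<gamma>2}" using c2 levelD(2) unfolding cnd_def by blast
  have dom3: "dom s3 = {..<\<gamma>3}" "dom t3 = {..<\<gamma>3}" using 3(3) levelD(2) unfolding cnd_def by blast+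
  have les: "s1 \<subseteq>\<^sub>m s'" "t1 \<subseteq>\<^sub>m t'" "t2 \<subseteq>\<^sub>m t'" "s \<subseteq>\<^sub>m s'" "t \<subseteq>\<^sub>m t'"
    using 1(4,5) 2(4,5) 3(4,5) 4(2,3) map_le_trans by metis+
  have \<beta>3: "\<beta> \<le> \<gamma>3" using 1 2 3 by simp
  have "seal_step False \<beta> \<beta>' q s'"
    using seal_stepI[OF dom1(1) les(1) 1(1,2)] 1(6) by blast
  moreover have "seal_step False \<beta> \<beta>' q t'"
  \<comment> \<open>If the second coordinate found nothing to meet, the cone that misses the
    prediction is rooted at \<open>t1\<close>, and this node carries the seal.\<close>
  proof (cases "t2 \<in> BB \<beta>'")
    case True
    then show ?thesis
      using seal_stepI[OF dom2 les(3) order_trans[OF 1(1) 2(1)] 2(2)] by blast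
  next
    case False
    then show ?thesis
      using seal_stepI[OF dom1(2) les(2) 1(1,2)] 2(6) by blast
  qed
  moreover have "\<exists>\<eta>\<ge>\<beta>. \<eta> \<in> bts s' \<inter> bts t'" using 4(5) \<beta>3 by blast
  moreover have "ini s' \<gamma>3 = s3" "ini t' \<gamma>3 = t3"
    using dom3 4 by (simp_all add: map_le_iff_ini)
  then have "ready TT AA \<Psi> s0 t0 q0 \<beta>' \<longrightarrow>
      (\<exists>\<epsilon> r. \<beta> \<le> \<epsilon> \<and> \<epsilon> < \<beta>' \<and> q' < r \<and> cnd TT AA \<epsilon> (ini s' \<epsilon>) (ini t' \<epsilon>) r \<and>
         \<Psi> k (ini s' \<epsilon>) (ini t' \<epsilon>) r)"
    using 3(2,3,7) 4(4) \<beta>3 by metis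
  moreover have "q' < q" using 4(4) 3(6) by simp
  ultimately show ?thesis using 4(1) les(4,5) by blast
qed

text \<open>Step \<open>n\<close> meets \<open>\<Psi> n\<close>, but only if the ladder point
  reached there is ready, which happens cofinally often and not always. Therefore the requirements
  must get stronger with the index: meeting \<open>\<Psi> n\<close> for some
  \<open>n \<ge> k\<close> also settles \<open>\<Psi> k\<close>.\<close>

lemma pair_limit:
  assumes sig: "signalled AA" and sub: "AA \<subseteq> TT \<times> TT" and dense: "dense TT AA C \<alpha> \<Psi>"
    and anti: "\<And>k s t q. \<Psi> (Suc k) s t q \<Longrightarrow> \<Psi> k s t q"
  obtains b c where "\<forall>x\<in>{b, c}. branch \<alpha> TT x \<and> sealed \<alpha> C BB x" "notabove AA b c"
    "acc_of (bts b \<inter> bts c) \<alpha>" "\<And>k \<gamma>. \<gamma> < \<alpha> \<Longrightarrow> passes TT AA \<alpha> \<Psi> b c k \<gamma>"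
proof -
  obtain \<beta>0 s0 t0 q0 where \<beta>0: "\<beta>0 < \<alpha>" and p0: "cnd TT AA \<beta>0 s0 t0 q0"
    and rdy: "\<And>\<gamma>. \<gamma> < \<alpha> \<Longrightarrow> \<exists>\<beta>\<in>C. \<gamma> < \<beta> \<and> ready TT AA \<Psi> s0 t0 q0 \<beta>"
    using dense unfolding dense_def by blast
  obtain e where e: "e 0 = \<beta>0" "strict_mono e" "\<And>n. e (Suc n) \<in> C" "\<And>n. e n < \<alpha>"
    "\<And>\<gamma>. \<gamma> < \<alpha> \<Longrightarrow> \<exists>n. \<gamma> < e n" "\<And>\<beta>. \<beta> \<in> C \<Longrightarrow> \<beta>0 < \<beta> \<Longrightarrow> \<exists>n. \<beta> = e (Suc n)"
    using ladder_enumeration[OF C \<beta>0] by metis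
  have e_less: "e m < e n \<longleftrightarrow> m < n" for m n using e(2) by (simp add: strict_mono_less)
  have st0: "s0 \<in> TT" "t0 \<in> TT" using p0 levelD(1) unfolding cnd_def by blast+
  \<comment> \<open>Staying below \<open>q0\<close> keeps all later conditions in the region where
    density is known; staying below \<open>1\<close> keeps the limits
    \<open>increasing\<close>.\<close>
  have "max (fv s0) (fv t0) < min q0 1"
    using p0 st0[THEN TT_lt1] unfolding cnd_def by simp
  then obtain q1 where q1: "q1 \<in> \<rat>" "max (fv s0) (fv t0) < q1" "q1 < min q0 1"
    using Rats_dense_in_real by blast
  define P where "P n p \<longleftrightarrow> cnd TT AA (e n) (fst p) (fst (snd p)) (snd (snd p)) \<and>
    s0 \<subseteq>\<^sub>m fst p \<and> t0 \<subseteq>\<^sub>m fst (snd p) \<and> snd (snd p) \<le> q1" for n and p :: "node \<times> node \<times> real"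
  define R where "R n p p' \<longleftrightarrow> fst p \<subseteq>\<^sub>m fst p' \<and> fst (snd p) \<subseteq>\<^sub>m fst (snd p') \<and>
    snd (snd p') < snd (snd p) \<and> (\<exists>\<eta>\<ge>e n. \<eta> \<in> bts (fst p') \<inter> bts (fst (snd p'))) \<and>
    seal_step False (e n) (e (Suc n)) (snd (snd p)) (fst p') \<and>
    seal_step False (e n) (e (Suc n)) (snd (snd p)) (fst (snd p')) \<and>
    (ready TT AA \<Psi> s0 t0 q0 (e (Suc n)) \<longrightarrow>
      (\<exists>\<epsilon> r. e n \<le> \<epsilon> \<and> \<epsilon> < e (Suc n) \<and> snd (snd p') < r \<and>
         cnd TT AA \<epsilon> (ini (fst p') \<epsilon>) (ini (fst (snd p')) \<epsilon>) r \<and>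
         \<Psi> n (ini (fst p') \<epsilon>) (ini (fst (snd p')) \<epsilon>) r))"
    for n and p p' :: "node \<times> node \<times> real"
  have "P 0 (s0, t0, q1)" using p0 q1 e(1) by (simp add: P_def cnd_def)
  then have "\<exists>p. P 0 p" ..
  moreover have "\<exists>p'. P (Suc n) p' \<and> R n p p'" if p: "P n p" for n p
  proof -
    obtain s t q where [simp]: "p = (s, t, q)" by (cases p)
    have st: "cnd TT AA (e n) s t q" "s0 \<subseteq>\<^sub>m s" "t0 \<subseteq>\<^sub>m t" "q \<le> q1"
      using p by (simp_all add: P_def)
    have "q \<le> q0" using st(4) q1 by simp
    have "e n < e (Suc n)" by (simp add: e_less)
    from pair_step[OF sig st(1) this e(3) st(2,3) \<open>q \<le> q0\<close>, of \<Psi> n]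
    have "\<exists>s' t' q'. cnd TT AA (e (Suc n)) s' t' q' \<and> R n p (s', t', q')"
      by (simp add: R_def)
    then obtain s' t' q' where *: "cnd TT AA (e (Suc n)) s' t' q'" "R n p (s', t', q')"
      by blast
    have "s0 \<subseteq>\<^sub>m s'" "t0 \<subseteq>\<^sub>m t'"
      using map_le_trans[OF st(2)] map_le_trans[OF st(3)] *(2) by (simp_all add: R_def)
    moreover have "q' < q" using *(2) by (simp add: R_def)
    ultimately have "P (Suc n) (s', t', q')" using *(1) st(4) by (simp add: P_def)
    with *(2) show ?thesis by blast
  qed
  ultimately have "\<exists>p. \<forall>n. P n (p n) \<and> R n (p n) (p (Suc n))"
    by (rule dependent_nat_choice)
  then obtain p where p: "\<And>n. P n (p n)" "\<And>n. R n (p n) (p (Suc n))" by blast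
  define s t q where "s n = fst (p n)" and "t n = fst (snd (p n))" and "q n = snd (snd (p n))" for n
  have cn: "cnd TT AA (e n) (s n) (t n) (q n)" for n
    using p(1)[of n] by (simp add: P_def s_def t_def q_def)
  have q_dec: "q (Suc n) < q n" for n using p(2)[of n] by (simp add: R_def q_def)
  have q0: "q 0 \<le> 1" using p(1)[of 0] q1 by (simp add: P_def q_def)
  have lev: "s n \<in> level TT (e n)" "t n \<in> level TT (e n)" "fv (s n) < q n" "fv (t n) < q n" "q n \<in> \<rat>"
    for n using cn[of n] by (simp_all add: cnd_def)
  have step: "s n \<subseteq>\<^sub>m s (Suc n)" "t n \<subseteq>\<^sub>m t (Suc n)"
    "\<exists>\<eta>\<ge>e n. \<eta> \<in> bts (s (Suc n)) \<inter> bts (t (Suc n))"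
    "seal_step False (e n) (e (Suc n)) (q n) (s (Suc n))" "seal_step False (e n) (e (Suc n)) (q n) (t (Suc n))"
    "ready TT AA \<Psi> s0 t0 q0 (e (Suc n)) \<Longrightarrow>
      (\<exists>\<epsilon> r. e n \<le> \<epsilon> \<and> \<epsilon> < e (Suc n) \<and> q (Suc n) < r \<and>
         cnd TT AA \<epsilon> (ini (s (Suc n)) \<epsilon>) (ini (t (Suc n)) \<epsilon>) r \<and>
         \<Psi> n (ini (s (Suc n)) \<epsilon>) (ini (t (Suc n)) \<epsilon>) r)" for n
    using p(2)[of n] unfolding R_def s_def t_def q_def by blast+
  obtain b where b: "dom b = {..<\<alpha>}" "\<And>n. ini b (e n) = s n" "\<And>\<gamma>. \<gamma> < \<alpha> \<Longrightarrow> ini b \<gamma> \<in> TT"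
    "increasing b" "\<And>n. fv b < q n"
    using limit_branch[OF lev(1) step(1) lev(3) q_dec q0 e(4,5)] by blast
  obtain c where c: "dom c = {..<\<alpha>}" "\<And>n. ini c (e n) = t n" "\<And>\<gamma>. \<gamma> < \<alpha> \<Longrightarrow> ini c \<gamma> \<in> TT"
    "increasing c" "\<And>n. fv c < q n"
    using limit_branch[OF lev(2) step(2) lev(4) q_dec q0 e(4,5)] by blast
  have step': "seal_step False (e n) (e (Suc n)) (q n) (ini b (e (Suc n)))"
    "seal_step False (e n) (e (Suc n)) (q n) (ini c (e (Suc n)))" for n
    using step(4,5) by (simp_all add: b(2) c(2))
  note sealed = sealedI[OF e(2,4,5) e(6)[folded e(1)], where k = 0 and q = q and Z = False]
  have "sealed \<alpha> C BB b" by (rule sealed) (simp_all add: b(5) lev step')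
  moreover have "sealed \<alpha> C BB c" by (rule sealed) (simp_all add: c(5) lev step')
  moreover have "notabove AA b c"
    unfolding notabove_def
  proof (intro allI impI notI, elim conjE)
    fix x y assume xy: "(x, y) \<in> AA" "x \<subseteq>\<^sub>m b" "y \<subseteq>\<^sub>m c"
    then obtain \<gamma> where \<gamma>: "dom x = {..<\<gamma>}" "dom y = {..<\<gamma>}"
      using sig unfolding signalled_def by blast
    have "x \<in> TT" using xy(1) sub by blast
    then have "\<gamma> < \<alpha>" using pretree \<gamma>(1) unfolding pretree_def by (metis lessThan_eq_iff)
    then obtain n where n: "\<gamma> < e n" using e(5) by blast
    have "x \<subseteq>\<^sub>m s n"
      using map_le_iniI[OF xy(2) \<gamma>(1) less_imp_le[OF n]] b(2)[of n] by simp
    moreover have "y \<subseteq>\<^sub>m t n"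
      using map_le_iniI[OF xy(3) \<gamma>(2) less_imp_le[OF n]] c(2)[of n] by simp
    ultimately show False using cn[of n] xy(1) unfolding cnd_def notabove_def by blast
  qed
  moreover have "acc_of (bts b \<inter> bts c) \<alpha>"
    unfolding acc_of_def
  proof (intro conjI allI impI)
    show "{..<\<alpha>} \<noteq> {}" using \<beta>0 by auto
    fix \<gamma> assume "\<gamma> < \<alpha>"
    then obtain n where n: "\<gamma> < e n" using e(5) by blast
    obtain \<eta> where \<eta>: "e n \<le> \<eta>" "\<eta> \<in> bts (s (Suc n)) \<inter> bts (t (Suc n))" using step(3) by blast
    have "\<eta> \<in> bts (ini b (e (Suc n))) \<inter> bts (ini c (e (Suc n)))" using \<eta>(2) b(2) c(2) by simp
    then have "\<eta> \<in> bts b \<inter> bts c" "\<eta> < e (Suc n)" unfolding bts_ini by blast+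
    moreover have "\<gamma> < \<eta>" using n \<eta>(1) by simp
    moreover have "\<eta> < \<alpha>" using \<open>\<eta> < e (Suc n)\<close> e(4)[of "Suc n"] by simp
    ultimately show "\<exists>\<delta>\<in>bts b \<inter> bts c. \<gamma> < \<delta> \<and> \<delta> < \<alpha>" by blast
  qed
  moreover have "passes TT AA \<alpha> \<Psi> b c k \<gamma>" if \<gamma>: "\<gamma> < \<alpha>" for k \<gamma>
  proof -
    obtain m where m: "\<gamma> < e m" using e(5) \<gamma> by blast
    \<comment> \<open>A ready ladder point late enough twice over: beyond \<open>e m\<close> for the
      height, beyond \<open>e k\<close> for the index of the requirement.\<close>
    obtain \<beta> where \<beta>: "\<beta> \<in> C" "e (max m k) < \<beta>" "ready TT AA \<Psi> s0 t0 q0 \<beta>"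
      using rdy[OF e(4)] by blast
    have "\<beta>0 \<le> e (max m k)" using e(1,2) by (metis strict_mono_less_eq zero_le)
    then have "\<beta>0 < \<beta>" using \<beta>(2) by simp
    then obtain n where n: "\<beta> = e (Suc n)" using e(6)[OF \<beta>(1)] by blast
    then have mk: "m \<le> n" "k \<le> n" using \<beta>(2) by (simp_all add: e_less)
    obtain \<epsilon> r where \<epsilon>: "e n \<le> \<epsilon>" "\<epsilon> < e (Suc n)" "q (Suc n) < r"
      "cnd TT AA \<epsilon> (ini (s (Suc n)) \<epsilon>) (ini (t (Suc n)) \<epsilon>) r"
      "\<Psi> n (ini (s (Suc n)) \<epsilon>) (ini (t (Suc n)) \<epsilon>) r"
      using step(6)[of n] \<beta>(3) n by blast
    have eq: "ini (s (Suc n)) \<epsilon> = ini b \<epsilon>" "ini (t (Suc n)) \<epsilon> = ini c \<epsilon>"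
      using ini_ini_le[OF less_imp_le[OF \<epsilon>(2)]] b(2)[of "Suc n"] c(2)[of "Suc n"] by metis+
    have "\<Psi> k x y z" if "\<Psi> n x y z" for x y z
      using mk(2) that by (induction rule: inc_induct) (blast intro: anti)+
    then have "\<Psi> k (ini b \<epsilon>) (ini c \<epsilon>) r" using \<epsilon>(5) eq by simp
    moreover have "e m \<le> e n" using mk(1) e(2) by (simp add: strict_mono_less_eq)
    moreover have "\<epsilon> < \<alpha>" using \<epsilon>(2) e(4)[of "Suc n"] by simp
    moreover have "fv b < r" "fv c < r" using b(5)[of "Suc n"] c(5)[of "Suc n"] \<epsilon>(3) by simp_all
    moreover have "\<gamma> \<le> \<epsilon>" using m \<open>e m \<le> e n\<close> \<epsilon>(1) by simp
    ultimately show ?thesis using \<epsilon>(4) eq by metis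
  qed
  ultimately show ?thesis using b(1,3,4) c(1,3,4) by (intro that) simp_all
qed

end

subsection \<open>One level of the recursion\<close>

definition avoids :: "(node \<times> node) set \<Rightarrow> nat \<Rightarrow> node \<Rightarrow> node \<Rightarrow> real \<Rightarrow> bool" where
  "avoids U k s t q \<longleftrightarrow> (s, t) \<notin> U"

text \<open>All indices up to \<open>k\<close> are included so that the requirement gets stronger
  with \<open>k\<close>, as \<open>pair_limit\<close> demands. A condition with this property
  decides membership for every pair of nodes below the current level that extends it and keeps its
  promise.\<close>

definition enters :: "node set \<Rightarrow> (node \<times> node) set \<Rightarrow> (nat \<Rightarrow> (node \<times> node) set) \<Rightarrow>
    nat \<Rightarrow> node \<Rightarrow> node \<Rightarrow> real \<Rightarrow> bool" where
  "enters TT AA UU k s t q \<longleftrightarrow> (\<forall>j\<le>k. reach TT AA s t q \<subseteq> UU j)"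

text \<open>\<open>TT\<close> and \<open>AA\<close> are the tree and the antichain in its square below level \<open>\<alpha>\<close>; \<open>N\<close>
  enumerates level \<open>\<alpha>\<close>.  The pair \<open>(N 0, N 1)\<close> joins the antichain, with colour \<open>k\<close>, if
  \<open>m = Some k\<close>.  In that case it is a limit of points outside the predicted \<open>UU k\<close>; otherwise it
  lies, if possible, in all the sets for which \<open>UU\<close> is a prediction.\<close>

definition stage :: "omega1 \<Rightarrow> node set \<Rightarrow> (node \<times> node) set \<Rightarrow> omega1 set \<Rightarrow> (omega1 \<Rightarrow> node set) \<Rightarrow>
    (nat \<Rightarrow> (node \<times> node) set) \<Rightarrow> (nat \<Rightarrow> node) \<Rightarrow> nat option \<Rightarrow> bool" where
  "stage \<alpha> TT AA C BB UU N m \<longleftrightarrow>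
     (\<forall>i. branch \<alpha> TT (N i)) \<and>
     (\<forall>\<beta> x q b. \<beta> < \<alpha> \<longrightarrow> x \<in> level TT \<beta> \<longrightarrow> fv x < q \<longrightarrow>
        (\<exists>i. labelled \<beta> b x q (N i))) \<and>
     (limit_ord \<alpha> \<longrightarrow> (\<forall>i. sealed \<alpha> C BB (N i))) \<and>
     (m \<noteq> None \<longrightarrow> notabove AA (N 0) (N 1) \<and> acc_of (bts (N 0) \<inter> bts (N 1)) \<alpha>) \<and>
     (limit_ord \<alpha> \<longrightarrow>
       (if \<exists>k. dense TT AA C \<alpha> (avoids (UU k))
        then \<exists>k. m = Some k \<and> (\<forall>\<gamma><\<alpha>. \<exists>\<epsilon>. \<gamma> \<le> \<epsilon> \<and> \<epsilon> < \<alpha> \<and> (ini (N 0) \<epsilon>, ini (N 1) \<epsilon>) \<notin> UU k)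
        else m = None \<and> (dense TT AA C \<alpha> (enters TT AA UU) \<longrightarrow> notabove AA (N 0) (N 1) \<and>
          (\<forall>k. \<exists>\<epsilon> r. \<epsilon> < \<alpha> \<and> fv (N 0) < r \<and> fv (N 1) < r \<and>
             cnd TT AA \<epsilon> (ini (N 0) \<epsilon>) (ini (N 1) \<epsilon>) r \<and>
             reach TT AA (ini (N 0) \<epsilon>) (ini (N 1) \<epsilon>) r \<subseteq> UU k))))"

section \<open>Existence of a level: zero, successor and limit\<close>

lemma increasing_empty: "increasing Map.empty"
  by (simp add: increasing_def)

lemma stage_zero:
  assumes "{..<\<alpha>} = {}"
  shows "stage \<alpha> TT AA C BB UU (\<lambda>_. Map.empty) None"
proof -
  have "\<not> \<beta> < \<alpha>" for \<beta> using assms by auto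
  moreover have "\<not> limit_ord \<alpha>" using assms by (simp add: limit_ord_def acc_of_def)
  ultimately show ?thesis using assms by (simp add: stage_def increasing_empty)
qed

lemma node_append:
  assumes y: "dom y = {..<\<beta>}" "increasing y" and k: "fv y < rv k" and \<alpha>: "{..<\<alpha>} = {..\<beta>}"
  shows "dom (y(\<beta> \<mapsto> k)) = {..<\<alpha>}" "increasing (y(\<beta> \<mapsto> k))" "fv (y(\<beta> \<mapsto> k)) = rv k"
    "y \<subseteq>\<^sub>m y(\<beta> \<mapsto> k)" "\<And>\<gamma>. \<gamma> \<le> \<beta> \<Longrightarrow> ini (y(\<beta> \<mapsto> k)) \<gamma> = ini y \<gamma>"
    "bts (y(\<beta> \<mapsto> k)) = bts y \<union> (if bt k then {\<beta>} else {})"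
proof -
  have \<beta>: "\<beta> \<notin> dom y" using y by simp
  show dom: "dom (y(\<beta> \<mapsto> k)) = {..<\<alpha>}" using y(1) \<alpha> by (auto simp: le_less)
  show ini: "ini (y(\<beta> \<mapsto> k)) \<gamma> = ini y \<gamma>" if "\<gamma> \<le> \<beta>" for \<gamma>
    using that by (intro ext) (auto simp: restrict_map_def)
  show le: "y \<subseteq>\<^sub>m y(\<beta> \<mapsto> k)" using \<beta> by (auto simp: map_le_def)
  show fv: "fv (y(\<beta> \<mapsto> k)) = rv k"
  proof (rule antisym)
    show "fv (y(\<beta> \<mapsto> k)) \<le> rv k"
    proof (rule fv_least)
      show "0 \<le> rv k" using rv_bounds[of k] by simp
      fix \<gamma> assume "\<gamma> \<in> dom (y(\<beta> \<mapsto> k))"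
      then show "rv (the ((y(\<beta> \<mapsto> k)) \<gamma>)) \<le> rv k"
        using fv_upper[of \<gamma> y] k by (cases "\<gamma> = \<beta>") auto
    qed
    show "rv k \<le> fv (y(\<beta> \<mapsto> k))" using fv_upper[of \<beta> "y(\<beta> \<mapsto> k)"] by simp
  qed
  show "increasing (y(\<beta> \<mapsto> k))"
    unfolding increasing_def
  proof (intro conjI ballI)
    show "fv (y(\<beta> \<mapsto> k)) < 1" using fv rv_bounds by simp
    fix \<gamma> assume \<gamma>: "\<gamma> \<in> dom (y(\<beta> \<mapsto> k))"
    then have le: "\<gamma> \<le> \<beta>" using y(1) by (auto simp: le_less)
    show "fv (ini (y(\<beta> \<mapsto> k)) \<gamma>) < rv (the ((y(\<beta> \<mapsto> k)) \<gamma>))"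
    proof (cases "\<gamma> = \<beta>")
      case True
      then show ?thesis using ini[OF le] ini_id[OF y(1), of \<beta>] k by simp
    next
      case False
      then show ?thesis using ini[OF le] y(2) \<gamma> unfolding increasing_def by simp
    qed
  qed
  show "bts (y(\<beta> \<mapsto> k)) = bts y \<union> (if bt k then {\<beta>} else {})"
    using \<beta> by (auto simp: bts_def)
qed

lemma pretree_root:
  assumes "pretree \<alpha> TT" "\<gamma> < \<alpha>"
  shows "\<exists>\<zeta><\<alpha>. Map.empty \<in> level TT \<zeta>"
proof -
  obtain \<zeta> :: omega1 where \<zeta>: "{..<\<zeta>} = {}" "\<forall>\<gamma>. \<zeta> \<le> \<gamma>" using least_omega1 by blast
  then have "Map.empty \<in> level TT \<zeta>" using assms(1) by (simp add: pretree_def level_def)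
  moreover have "\<zeta> < \<alpha>" using \<zeta>(2) assms(2) le_less_trans by blast
  ultimately show ?thesis by blast
qed

lemma stage_successor:
  assumes \<alpha>: "{..<\<alpha>} = {..\<beta>}" and pre: "pretree \<alpha> TT"
  shows "\<exists>N. stage \<alpha> TT AA C BB UU N None"
proof -
  define L where "L = {y(\<beta> \<mapsto> k) | y k. y \<in> level TT \<beta> \<and> fv y < rv k}"
  have less: "\<gamma> < \<alpha> \<longleftrightarrow> \<gamma> \<le> \<beta>" for \<gamma> using \<alpha> by auto
  have not_limit: "\<not> limit_ord \<alpha>"
  proof
    assume "limit_ord \<alpha>"
    then obtain \<delta> where "\<beta> < \<delta>" "\<delta> < \<alpha>" using limit_ord_between less by blast
    then show False using less[of \<delta>] by simp
  qed
  have TT: "increasing t" "ini t \<gamma> \<in> TT" if "t \<in> TT" for t \<gamma>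
    using pre that by (simp_all add: pretree_def)
  have ext: "\<exists>y\<in>L. labelled \<gamma> b x q y"
    if \<gamma>: "\<gamma> < \<alpha>" and x: "x \<in> level TT \<gamma>" "fv x < q" for \<gamma> x q b
  proof -
    \<comment> \<open>A wanted label belongs at position \<gamma>. If
      \<open>\<gamma> = \<beta>\<close> the entry to be appended must carry it; otherwise
      \<open>y\<close> has it already and the appended entry is plain.\<close>
    have "\<exists>y\<in>level TT \<beta>. \<exists>c. x \<subseteq>\<^sub>m y \<and> fv y < q \<and>
        (bts y \<inter> {\<gamma>..}) \<union> (if c then {\<beta>} else {}) = (if b then {\<gamma>} else {})"
    proof (cases "\<gamma> = \<beta>")
      case True
      then show ?thesis using x bts_outside[OF levelD(2)[OF x(1)], of \<gamma>]
        by (intro bexI[of _ x] exI[of _ b]) auto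
    next
      case False
      then have "\<gamma> < \<beta>" "\<beta> < \<alpha>" using \<gamma> less by (auto simp: le_less)
      then obtain y where "y \<in> level TT \<beta>" "x \<subseteq>\<^sub>m y" "fv y < q"
          "bts y \<inter> {\<gamma>..} = (if b then {\<gamma>} else {})"
        using pretree_rich[OF pre _ _ x, of \<beta> b] by blast
      then show ?thesis by (intro bexI[of _ y] exI[of _ False]) simp_all
    qed
    then obtain y c where y: "y \<in> level TT \<beta>" "x \<subseteq>\<^sub>m y" "fv y < q"
      "(bts y \<inter> {\<gamma>..}) \<union> (if c then {\<beta>} else {}) = (if b then {\<gamma>} else {})" by blast
    have inc: "increasing y" using TT levelD(1)[OF y(1)] by blast
    then have "fv y < min q 1" using y(3) by (simp add: increasing_def)
    then obtain k where k: "fv y < rv k" "rv k < min q 1" "bt k = c"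
      using rv_bt_dense[OF fv_nonneg, of y "min q 1" c] by auto
    note app = node_append[OF levelD(2)[OF y(1)] inc k(1) \<alpha>]
    have "\<gamma> \<le> \<beta>" using \<gamma> less by simp
    then have "bts (y(\<beta> \<mapsto> k)) \<inter> {\<gamma>..} = (bts y \<inter> {\<gamma>..}) \<union> (if c then {\<beta>} else {})"
      using k(3) by (simp add: app(6) Int_Un_distrib2)
    then have "bts (y(\<beta> \<mapsto> k)) \<inter> {\<gamma>..} = (if b then {\<gamma>} else {})"
      using y(4) by (rule trans)
    moreover have "y(\<beta> \<mapsto> k) \<in> L" using y(1) k(1) by (auto simp: L_def)
    moreover have "x \<subseteq>\<^sub>m y(\<beta> \<mapsto> k)" using y(2) app(4) by (rule map_le_trans)
    ultimately show ?thesis using app(3) k(2) by (intro bexI[of _ "y(\<beta> \<mapsto> k)"]) simp_all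
  qed
  have in_L: "branch \<alpha> TT z" if z: "z \<in> L" for z
  proof -
    obtain y k where y: "z = y(\<beta> \<mapsto> k)" "y \<in> level TT \<beta>" "fv y < rv k"
      using z unfolding L_def by blast
    note app = node_append[OF levelD(2)[OF y(2)] TT(1)[OF levelD(1)[OF y(2)]] y(3) \<alpha>]
    show ?thesis using app(1,2,5) TT(2)[OF levelD(1)[OF y(2)]] unfolding y(1) less by simp
  qed
  have "countable (level TT \<beta>)"
    using pre unfolding pretree_def level_def by (auto intro: countable_subset)
  then have "countable (level TT \<beta> \<times> (UNIV :: nat set))" by simp
  moreover have "L \<subseteq> (\<lambda>(y, k). y(\<beta> \<mapsto> k)) ` (level TT \<beta> \<times> UNIV)" by (auto simp: L_def)
  ultimately have "countable L" using countable_subset countable_image by metis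
  moreover have "L \<noteq> {}"
  proof -
    obtain \<zeta> where "\<zeta> < \<alpha>" "Map.empty \<in> level TT \<zeta>"
      using pretree_root[OF pre, of \<beta>] less by blast
    then show ?thesis using ext[of \<zeta> Map.empty 1] by auto
  qed
  ultimately have range: "range (from_nat_into L) = L" by simp
  show ?thesis
  proof (intro exI[of _ "from_nat_into L"], unfold stage_def, intro conjI allI impI)
    fix i
    have "from_nat_into L i \<in> L" using range by blast
    then show "dom (from_nat_into L i) = {..<\<alpha>}" "increasing (from_nat_into L i)"
      "\<And>\<gamma>. \<gamma> < \<alpha> \<Longrightarrow> ini (from_nat_into L i) \<gamma> \<in> TT" using in_L by simp_all
  next
    fix \<gamma> x q b assume "\<gamma> < \<alpha>" "x \<in> level TT \<gamma>" "fv x < q"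
    from ext[OF this, of b] show "\<exists>i. labelled \<gamma> b x q (from_nat_into L i)"
      using range by (metis rangeE)
  qed (use not_limit in simp_all)
qed

context limit_stage
begin

definition enumerates :: "(nat \<Rightarrow> node) \<Rightarrow> bool" where
  "enumerates N \<longleftrightarrow>
    (\<forall>i. branch \<alpha> TT (N i)) \<and>
    (\<forall>\<beta> x q b. \<beta> < \<alpha> \<longrightarrow> x \<in> level TT \<beta> \<longrightarrow> fv x < q \<longrightarrow>
        (\<exists>i. labelled \<beta> b x q (N i))) \<and>
    (\<forall>i. sealed \<alpha> C BB (N i))"

text \<open>Countably many branches suffice, because a requirement with a real bound follows from
  one with a smaller rational bound. The given pair occupies the indices from which the antichain is
  read off.\<close>

lemma level_enumeration:
  assumes bc: "\<forall>x\<in>{b, c}. branch \<alpha> TT x \<and> sealed \<alpha> C BB x"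
  shows "\<exists>N :: nat \<Rightarrow> node. N 0 = b \<and> N 1 = c \<and> enumerates N"
proof -
  define ok where "ok z \<longleftrightarrow> branch \<alpha> TT z \<and> sealed \<alpha> C BB z" for z
  define good where "good i z \<longleftrightarrow> (case i of (x, \<beta>, q, lab :: bool) \<Rightarrow>
    labelled \<beta> lab x q z)" for i z
  define g where "g i = (SOME z. ok z \<and> good i z)" for i
  define I where "I = {(x, \<beta>, q, lab :: bool). x \<in> level TT \<beta> \<and> \<beta> < \<alpha> \<and> fv x < q \<and> q \<in> \<rat>}"
  have g: "ok (g i) \<and> good i (g i)" if "i \<in> I" for i
  proof -
    obtain x \<beta> q lab where i: "i = (x, \<beta>, q, lab)" by (cases i)
    then have x: "x \<in> level TT \<beta>" "\<beta> < \<alpha>" "fv x < q" using that by (simp_all add: I_def)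
    have "\<exists>z. ok z \<and> good i z"
      using single_limit[OF x, of lab] unfolding ok_def good_def i prod.case by metis
    then show ?thesis unfolding g_def by (rule someI_ex)
  qed
  define L where "L = insert b (insert c (g ` I))"
  have "countable I"
  proof -
    have "countable (TT \<times> {..<\<alpha>} \<times> \<rat> \<times> (UNIV :: bool set))"
      using pretree countable_lessThan_omega1 countable_rat
      by (intro countable_SIGMA) (auto simp: pretree_def)
    moreover have "I \<subseteq> TT \<times> {..<\<alpha>} \<times> \<rat> \<times> (UNIV :: bool set)" using levelD(1) by (auto simp: I_def)
    ultimately show ?thesis using countable_subset by blast
  qed
  then have "countable L" by (simp add: L_def)
  then have range: "range (from_nat_into L) = L" by (simp add: L_def)
  have "ok b" "ok c" using bc by (simp_all add: ok_def)
  then have ok_L: "ok z" if "z \<in> L" for z using that g by (auto simp: L_def)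
  define N where "N i = (case i of 0 \<Rightarrow> b | Suc 0 \<Rightarrow> c | Suc (Suc j) \<Rightarrow> from_nat_into L j)" for i
  have N_L: "N i \<in> L" for i using range by (auto simp: N_def L_def split: nat.split)
  have "\<exists>i. N i = z" if "z \<in> L" for z
  proof -
    obtain j where "from_nat_into L j = z" using \<open>z \<in> L\<close> range by (metis rangeE)
    then have "N (Suc (Suc j)) = z" by (simp add: N_def)
    then show ?thesis ..
  qed
  moreover have "\<exists>z\<in>L. labelled \<beta> lab x q z"
    if x: "\<beta> < \<alpha>" "x \<in> level TT \<beta>" "fv x < q" for \<beta> x q lab
  proof -
    obtain r where r: "r \<in> \<rat>" "fv x < r" "r < q" using Rats_dense_in_real[OF x(3)] by blast
    then have "(x, \<beta>, r, lab) \<in> I" using x by (simp add: I_def)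
    then have "good (x, \<beta>, r, lab) (g (x, \<beta>, r, lab))" "g (x, \<beta>, r, lab) \<in> L"
      using g by (auto simp: L_def)
    then show ?thesis using r(3) by (intro bexI[of _ "g (x, \<beta>, r, lab)"]) (auto simp: good_def)
  qed
  ultimately have rich_N: "\<exists>i. labelled \<beta> lab x q (N i)"
    if "\<beta> < \<alpha>" "x \<in> level TT \<beta>" "fv x < q" for \<beta> x q lab
    using that by metis
  have ok_N: "ok (N i)" for i by (rule ok_L[OF N_L])
  have "N 0 = b" "N 1 = c" by (simp_all add: N_def)
  moreover have "\<forall>i. branch \<alpha> TT (N i)"
    "\<forall>i. sealed \<alpha> C BB (N i)"
    using ok_N by (simp_all add: ok_def)
  ultimately show ?thesis using rich_N unfolding enumerates_def by metis
qed

lemma stage_limit: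
  assumes sig: "signalled AA" and sub: "AA \<subseteq> TT \<times> TT"
  shows "\<exists>N m. stage \<alpha> TT AA C BB UU N m"
proof (cases "\<exists>k. dense TT AA C \<alpha> (avoids (UU k))")
  case True
  then obtain k where k: "dense TT AA C \<alpha> (avoids (UU k))" ..
  obtain b c where bc: "\<forall>x\<in>{b, c}. branch \<alpha> TT x \<and> sealed \<alpha> C BB x" "notabove AA b c"
    "acc_of (bts b \<inter> bts c) \<alpha>"
    and J: "\<And>j \<gamma>. \<gamma> < \<alpha> \<Longrightarrow> passes TT AA \<alpha> (avoids (UU k)) b c j \<gamma>"
    by (rule pair_limit[OF sig sub k]) (simp add: avoids_def, rule that)
  have lim: "\<forall>\<gamma><\<alpha>. \<exists>\<epsilon>. \<gamma> \<le> \<epsilon> \<and> \<epsilon> < \<alpha> \<and> (ini b \<epsilon>, ini c \<epsilon>) \<notin> UU k"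
    using J[of _ 0] unfolding avoids_def by blast
  obtain N where "N 0 = b" "N 1 = c" "enumerates N"
    using level_enumeration[OF bc(1)] by blast
  then have "stage \<alpha> TT AA C BB UU N (Some k)"
    unfolding stage_def enumerates_def using True bc(2,3) lim by simp
  then show ?thesis by blast
next
  case not_avoids: False
  show ?thesis
  proof (cases "dense TT AA C \<alpha> (enters TT AA UU)")
    case True
    obtain b c where bc: "\<forall>x\<in>{b, c}. branch \<alpha> TT x \<and> sealed \<alpha> C BB x" "notabove AA b c"
      and J: "\<And>j \<gamma>. \<gamma> < \<alpha> \<Longrightarrow> passes TT AA \<alpha> (enters TT AA UU) b c j \<gamma>"
      by (rule pair_limit[OF sig sub True]) (simp add: enters_def, rule that)
    obtain \<gamma>0 where \<gamma>0: "\<gamma>0 < \<alpha>" using limit_ord_nonempty[OF limit] by blast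
    have lim: "\<exists>\<epsilon> r. \<epsilon> < \<alpha> \<and> fv b < r \<and> fv c < r \<and> cnd TT AA \<epsilon> (ini b \<epsilon>) (ini c \<epsilon>) r \<and>
         reach TT AA (ini b \<epsilon>) (ini c \<epsilon>) r \<subseteq> UU k" for k
      using J[OF \<gamma>0, of k] unfolding enters_def by blast
    obtain N where "N 0 = b" "N 1 = c" "enumerates N"
      using level_enumeration[OF bc(1)] by blast
    then have "stage \<alpha> TT AA C BB UU N None"
      unfolding stage_def enumerates_def using not_avoids bc(2) lim by simp
    then show ?thesis by blast
  next
    case False
    obtain \<zeta> where \<zeta>: "\<zeta> < \<alpha>" "Map.empty \<in> level TT \<zeta>"
      using pretree_root[OF pretree] limit_ord_nonempty[OF limit] by blast
    \<comment> \<open>Neither requirement is dense, so nothing is prescribed for the pair; one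
      sealed branch above the root serves for both coordinates.\<close>
    have "fv Map.empty < 1" by simp
    from single_limit[OF \<zeta>(2,1) this, of False]
    obtain b where "branch \<alpha> TT b \<and> sealed \<alpha> C BB b"
      by blast
    then obtain N where "enumerates N"
      using level_enumeration[of b b] by auto
    then have "stage \<alpha> TT AA C BB UU N None"
      unfolding stage_def enumerates_def using not_avoids False by simp
    then show ?thesis by blast
  qed
qed

end

lemma stage_exists:
  assumes pre: "{..<\<alpha>} \<noteq> {} \<Longrightarrow> pretree \<alpha> TT"
    and sig: "signalled AA" and sub: "AA \<subseteq> TT \<times> TT"
    and C: "limit_ord \<alpha> \<Longrightarrow> C \<subseteq> {..<\<alpha>} \<and> acc_of C \<alpha> \<and> order_type_omega C"
    and BB: "\<And>\<beta>. \<beta> < \<alpha> \<Longrightarrow> BB \<beta> \<subseteq> {t \<in> TT. \<exists>\<gamma><\<beta>. dom t = {..<\<gamma>}}"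
  shows "\<exists>N m. stage \<alpha> TT AA C BB UU N m"
proof (cases \<alpha> rule: omega1_cases)
  case 1
  then show ?thesis using stage_zero by blast
next
  case (2 \<beta>)
  then have "{..<\<alpha>} \<noteq> {}" by auto
  then show ?thesis using stage_successor[OF 2 pre] by blast
next
  case 3
  have "{..<\<alpha>} \<noteq> {}" using limit_ord_nonempty[OF 3] by blast
  then have "limit_stage \<alpha> TT C BB"
    using pre 3 C[OF 3] BB by unfold_locales auto
  then show ?thesis using limit_stage.stage_limit[OF _ sig sub] by blast
qed

subsection \<open>The recursion\<close>

type_synonym level_data = "(nat \<Rightarrow> node) \<times> nat option"

definition tree_upto :: "(omega1 \<Rightarrow> level_data) \<Rightarrow> omega1 \<Rightarrow> node set" where
  "tree_upto G \<alpha> = (\<Union>\<beta>\<in>{..<\<alpha>}. range (fst (G \<beta>)))"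

definition pairs_upto :: "(omega1 \<Rightarrow> level_data) \<Rightarrow> omega1 \<Rightarrow> (node \<times> node) set" where
  "pairs_upto G \<alpha> = (\<lambda>\<beta>. (fst (G \<beta>) 0, fst (G \<beta>) 1)) ` {\<beta>. \<beta> < \<alpha> \<and> snd (G \<beta>) \<noteq> None}"

definition guess_nodes :: "(omega1 \<Rightarrow> (omega1 \<times> nat) set) \<Rightarrow> (omega1 \<Rightarrow> level_data) \<Rightarrow> omega1 \<Rightarrow> node set" where
  "guess_nodes \<Omega> G \<alpha> = {fst (G \<beta>) i | \<beta> i. \<beta> < \<alpha> \<and> (\<beta>, i) \<in> \<Omega> \<alpha>}"

text \<open>One predicted set codes a whole sequence of sets: the natural number attached to \<beta>
  carries the index \<open>k\<close> and the positions of both nodes in level \<beta>. Only pairs of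
  equal height are predicted.\<close>

definition guess_pairs :: "(omega1 \<Rightarrow> (omega1 \<times> nat) set) \<Rightarrow> (omega1 \<Rightarrow> level_data) \<Rightarrow> omega1 \<Rightarrow>
    nat \<Rightarrow> (node \<times> node) set" where
  "guess_pairs \<Omega> G \<alpha> k = {(fst (G \<beta>) i, fst (G \<beta>) j) | \<beta> i j. \<beta> < \<alpha> \<and> (\<beta>, to_nat (k, i, j)) \<in> \<Omega> \<alpha>}"

text \<open>The guard \<open>\<beta> < \<alpha>\<close> makes the requirement depend only on the
  levels below \<alpha>, as the recursion needs.\<close>

definition stage_rec :: "(omega1 \<Rightarrow> omega1 set) \<Rightarrow> (omega1 \<Rightarrow> (omega1 \<times> nat) set) \<Rightarrow>
    (omega1 \<Rightarrow> level_data) \<Rightarrow> omega1 \<Rightarrow> level_data \<Rightarrow> bool" where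
  "stage_rec C \<Omega> G \<alpha> v \<longleftrightarrow> stage \<alpha> (tree_upto G \<alpha>) (pairs_upto G \<alpha>) (C \<alpha>)
     (\<lambda>\<beta>. if \<beta> < \<alpha> then guess_nodes \<Omega> G \<beta> else {}) (guess_pairs \<Omega> G \<alpha>) (fst v) (snd v)"

lemma stage_rec_cong:
  assumes "\<And>\<beta>. \<beta> < \<alpha> \<Longrightarrow> G \<beta> = H \<beta>"
  shows "stage_rec C \<Omega> G \<alpha> v = stage_rec C \<Omega> H \<alpha> v"
proof -
  have "tree_upto G \<alpha> = tree_upto H \<alpha>" using assms by (simp add: tree_upto_def)
  moreover have "pairs_upto G \<alpha> = pairs_upto H \<alpha>"
    unfolding pairs_upto_def by (rule image_cong) (auto simp: assms)
  moreover have "guess_nodes \<Omega> G \<beta> = guess_nodes \<Omega> H \<beta>" if "\<beta> < \<alpha>" for \<beta>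
  proof -
    have "G \<gamma> = H \<gamma>" if "\<gamma> < \<beta>" for \<gamma> using that \<open>\<beta> < \<alpha>\<close> assms by simp
    then show ?thesis unfolding guess_nodes_def by (intro Collect_cong) metis
  qed
  moreover have "guess_pairs \<Omega> G \<alpha> = guess_pairs \<Omega> H \<alpha>"
    unfolding guess_pairs_def by (intro ext Collect_cong) (metis assms)
  ultimately show ?thesis by (simp add: stage_rec_def cong: if_cong)
qed

section \<open>Invariants preserved by the recursion\<close>

lemma stageD:
  assumes "stage \<alpha> TT AA C BB UU N m"
  shows "dom (N i) = {..<\<alpha>}" "\<gamma> < \<alpha> \<Longrightarrow> ini (N i) \<gamma> \<in> TT" "increasing (N i)"
    "\<beta> < \<alpha> \<Longrightarrow> x \<in> level TT \<beta> \<Longrightarrow> fv x < q \<Longrightarrow>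
      \<exists>i. labelled \<beta> b x q (N i)"
    "limit_ord \<alpha> \<Longrightarrow> sealed \<alpha> C BB (N i)"
    "m \<noteq> None \<Longrightarrow> notabove AA (N 0) (N 1) \<and> acc_of (bts (N 0) \<inter> bts (N 1)) \<alpha>"
  using assms unfolding stage_def by simp_all

lemma level_tree_upto:
  assumes G: "\<And>\<beta> i. \<beta> < \<alpha> \<Longrightarrow> dom (fst (G \<beta>) i) = {..<\<beta>}" and "\<beta> < \<alpha>"
  shows "level (tree_upto G \<alpha>) \<beta> = range (fst (G \<beta>))"
proof
  show "level (tree_upto G \<alpha>) \<beta> \<subseteq> range (fst (G \<beta>))"
  proof
    fix x assume "x \<in> level (tree_upto G \<alpha>) \<beta>"
    then obtain \<gamma> i where \<gamma>: "\<gamma> < \<alpha>" "x = fst (G \<gamma>) i" "dom x = {..<\<beta>}"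
      by (auto simp: level_def tree_upto_def)
    then have "\<gamma> = \<beta>" using G[OF \<gamma>(1), of i] by simp
    then show "x \<in> range (fst (G \<beta>))" using \<gamma> by simp
  qed
  show "range (fst (G \<beta>)) \<subseteq> level (tree_upto G \<alpha>) \<beta>"
    using assms by (auto simp: level_def tree_upto_def)
qed

lemma
  assumes G: "\<And>\<beta>. \<beta> < \<alpha> \<Longrightarrow> stage_rec C \<Omega> G \<beta> (G \<beta>)"
  shows pretree_upto: "{..<\<alpha>} \<noteq> {} \<Longrightarrow> pretree \<alpha> (tree_upto G \<alpha>)"
    and signalled_upto: "signalled (pairs_upto G \<alpha>)"
    and pairs_upto_subset: "pairs_upto G \<alpha> \<subseteq> tree_upto G \<alpha> \<times> tree_upto G \<alpha>"
proof -
  note st = stageD[OF G[unfolded stage_rec_def]]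
  show "pairs_upto G \<alpha> \<subseteq> tree_upto G \<alpha> \<times> tree_upto G \<alpha>"
    by (auto simp: pairs_upto_def tree_upto_def)
  show "signalled (pairs_upto G \<alpha>)"
    unfolding signalled_def
  proof (intro allI impI)
    fix a b assume "(a, b) \<in> pairs_upto G \<alpha>"
    then obtain \<beta> where \<beta>: "\<beta> < \<alpha>" "snd (G \<beta>) \<noteq> None" "a = fst (G \<beta>) 0" "b = fst (G \<beta>) 1"
      unfolding pairs_upto_def by blast
    then show "\<exists>\<gamma>. dom a = {..<\<gamma>} \<and> dom b = {..<\<gamma>} \<and> acc_of (bts a \<inter> bts b) \<gamma>"
      using st(1)[OF \<beta>(1)] st(6)[OF \<beta>(1,2)] by (intro exI[of _ \<beta>]) simp
  qed
  assume ne: "{..<\<alpha>} \<noteq> {}"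
  have sub: "tree_upto G \<beta> \<subseteq> tree_upto G \<alpha>" if "\<beta> < \<alpha>" for \<beta>
    using that unfolding tree_upto_def by (intro UN_mono) auto
  show "pretree \<alpha> (tree_upto G \<alpha>)"
    unfolding pretree_def
  proof (intro conjI ballI allI impI)
    show "countable (tree_upto G \<alpha>)"
      unfolding tree_upto_def using countable_lessThan_omega1 by simp
    obtain \<zeta> :: omega1 where \<zeta>: "{..<\<zeta>} = {}" "\<And>\<gamma>. \<zeta> \<le> \<gamma>" using least_omega1 by blast
    then have "\<zeta> < \<alpha>" using ne by (metis le_less)
    then have "fst (G \<zeta>) 0 \<in> tree_upto G \<alpha>" unfolding tree_upto_def by blast
    moreover have "dom (fst (G \<zeta>) 0) = {}" using st(1)[OF \<open>\<zeta> < \<alpha>\<close>] \<zeta>(1) by metis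
    ultimately show "Map.empty \<in> tree_upto G \<alpha>" by simp
  next
    fix t assume "t \<in> tree_upto G \<alpha>"
    then obtain \<beta> i where \<beta>: "\<beta> < \<alpha>" "t = fst (G \<beta>) i" by (auto simp: tree_upto_def)
    show "increasing t" using st(3)[OF \<beta>(1)] \<beta>(2) by simp
    show "\<exists>\<beta><\<alpha>. dom t = {..<\<beta>}" using st(1)[OF \<beta>(1)] \<beta> by blast
    fix \<gamma>
    show "ini t \<gamma> \<in> tree_upto G \<alpha>"
    proof (cases "\<gamma> < \<beta>")
      case True
      then show ?thesis using st(2)[OF \<beta>(1) True] \<beta>(2) sub[OF \<beta>(1)] by blast
    next
      case False
      then have "ini t \<gamma> = t" using ini_id[of t \<beta> \<gamma>] st(1)[OF \<beta>(1)] \<beta>(2) by (simp add: not_less)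
      then show ?thesis using \<open>t \<in> tree_upto G \<alpha>\<close> by simp
    qed
  next
    fix \<beta> \<beta>' x q b
    assume *: "\<beta> < \<beta>'" "\<beta>' < \<alpha>" "x \<in> level (tree_upto G \<alpha>) \<beta>" "fv x < q"
    have "x \<in> level (tree_upto G \<beta>') \<beta>"
      using * level_tree_upto[of \<alpha> G \<beta>] level_tree_upto[of \<beta>' G \<beta>] st(1) by simp
    then obtain i where "x \<subseteq>\<^sub>m fst (G \<beta>') i" "fv (fst (G \<beta>') i) < q"
      "bts (fst (G \<beta>') i) \<inter> {\<beta>..} = (if b then {\<beta>} else {})"
      using st(4)[OF *(2,1) _ *(4), of b] by blast
    moreover have "fst (G \<beta>') i \<in> level (tree_upto G \<alpha>) \<beta>'"
      using level_tree_upto[of \<alpha> G \<beta>'] st(1) *(2) by simp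
    ultimately show "\<exists>y\<in>level (tree_upto G \<alpha>) \<beta>'. labelled \<beta> b x q y" by blast
  qed
qed

text \<open>A level exists by \<open>stage_exists\<close> but is not determined by the earlier ones,
  so the recursion is a well-founded dependent choice.\<close>

lemma stage_rec_exists:
  assumes C: "ladder_system C"
  shows "\<exists>G. \<forall>\<alpha>. stage_rec C \<Omega> G \<alpha> (G \<alpha>)"
proof (rule dependent_wf_choice[where R = "{(\<beta>, \<alpha>). \<beta> < \<alpha>}"])
  show "wf {(\<beta>, \<alpha>). \<beta> < (\<alpha> :: omega1)}" by (rule wf)
  show "stage_rec C \<Omega> f x r = stage_rec C \<Omega> g x r" if "\<And>z. (z, x) \<in> {(\<beta>, \<alpha>). \<beta> < \<alpha>} \<Longrightarrow> f z = g z"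
    for f g x r
    using that by (intro stage_rec_cong) simp
  fix \<alpha> G assume "\<And>\<beta>. (\<beta>, \<alpha>) \<in> {(\<beta>, \<alpha>). \<beta> < \<alpha>} \<Longrightarrow> stage_rec C \<Omega> G \<beta> (G \<beta>)"
  then have G: "stage_rec C \<Omega> G \<beta> (G \<beta>)" if "\<beta> < \<alpha>" for \<beta> using that by simp
  have "\<exists>N m. stage \<alpha> (tree_upto G \<alpha>) (pairs_upto G \<alpha>) (C \<alpha>)
     (\<lambda>\<beta>. if \<beta> < \<alpha> then guess_nodes \<Omega> G \<beta> else {}) (guess_pairs \<Omega> G \<alpha>) N m"
  proof (rule stage_exists[OF pretree_upto signalled_upto pairs_upto_subset])
    show "limit_ord \<alpha> \<Longrightarrow> C \<alpha> \<subseteq> {..<\<alpha>} \<and> acc_of (C \<alpha>) \<alpha> \<and> order_type_omega (C \<alpha>)"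
      using C unfolding ladder_system_def by blast
    fix \<beta> assume "\<beta> < \<alpha>"
    have "fst (G \<gamma>) i \<in> tree_upto G \<alpha> \<and> (\<exists>\<gamma>'<\<beta>. dom (fst (G \<gamma>) i) = {..<\<gamma>'})" if "\<gamma> < \<beta>" for \<gamma> i
    proof -
      have "\<gamma> < \<alpha>" using that \<open>\<beta> < \<alpha>\<close> by simp
      moreover from this have "dom (fst (G \<gamma>) i) = {..<\<gamma>}"
        using stageD(1)[OF G[unfolded stage_rec_def]] by blast
      ultimately show ?thesis using that unfolding tree_upto_def by blast
    qed
    then show "(if \<beta> < \<alpha> then guess_nodes \<Omega> G \<beta> else {}) \<subseteq>
        {t \<in> tree_upto G \<alpha>. \<exists>\<gamma><\<beta>. dom t = {..<\<gamma>}}"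
      unfolding guess_nodes_def by auto
  qed (use G in auto)
  then obtain N m where "stage_rec C \<Omega> G \<alpha> (N, m)" unfolding stage_rec_def by auto
  then show "\<exists>r. stage_rec C \<Omega> G \<alpha> r" ..
qed

subsection \<open>The tree\<close>

locale constructed_tree =
  fixes C :: "omega1 \<Rightarrow> omega1 set" and \<Omega> :: "omega1 \<Rightarrow> (omega1 \<times> nat) set" and G :: "omega1 \<Rightarrow> level_data"
  assumes ladder: "ladder_system C"
    and hit: "\<And>B. uncountable B \<Longrightarrow> \<exists>E. club E \<and> (\<forall>\<alpha>\<in>E. acc_of (C \<alpha> \<inter> B) \<alpha>)"
    and predict: "\<And>B. stationary {\<alpha>. B \<inter> ({..<\<alpha>} \<times> UNIV) = \<Omega> \<alpha>}"
    and G: "\<And>\<alpha>. stage_rec C \<Omega> G \<alpha> (G \<alpha>)"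
begin

definition N :: "omega1 \<Rightarrow> nat \<Rightarrow> node" where "N \<alpha> = fst (G \<alpha>)"

definition T :: "node set" where "T = (\<Union>\<alpha>. range (N \<alpha>))"

lemmas stage_N = stageD[OF G[unfolded stage_rec_def], folded N_def]

lemma N_in_T: "N \<alpha> i \<in> T"
  by (auto simp: T_def)

lemma T_cases:
  assumes "t \<in> T"
  obtains \<alpha> i where "t = N \<alpha> i"
  using assms by (auto simp: T_def)

lemma ht_N [simp]: "ht (N \<alpha> i) = \<alpha>"
  by (rule ht_eq) (rule stage_N(1))

lemma T_dom: "t \<in> T \<Longrightarrow> dom t = {..<ht t}"
  by (metis T_cases ht_N stage_N(1))

lemma level_T: "level T \<alpha> = range (N \<alpha>)"
proof
  show "level T \<alpha> \<subseteq> range (N \<alpha>)"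
  proof
    fix x assume x: "x \<in> level T \<alpha>"
    then obtain \<beta> i where \<beta>: "x = N \<beta> i" using T_cases levelD(1) by blast
    then have "\<beta> = \<alpha>" using levelD(2)[OF x] stage_N(1)[of \<beta> i] by simp
    then show "x \<in> range (N \<alpha>)" using \<beta> by simp
  qed
  show "range (N \<alpha>) \<subseteq> level T \<alpha>" using stage_N(1) N_in_T by (auto simp: level_def)
qed

lemma T_level: "t \<in> T \<Longrightarrow> t \<in> level T (ht t)"
  by (rule levelI[OF _ T_dom])

lemma tree_upto_T: "tree_upto G \<alpha> = {t \<in> T. ht t < \<alpha>}"
  unfolding tree_upto_def N_def[symmetric] T_def by auto

lemma T_increasing: "t \<in> T \<Longrightarrow> increasing t"
  by (metis T_cases stage_N(3))

lemma T_ini: "t \<in> T \<Longrightarrow> ini t \<gamma> \<in> T"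
proof (cases "\<gamma> < ht t")
  case True
  assume "t \<in> T"
  then obtain \<alpha> i where t: "t = N \<alpha> i" by (rule T_cases)
  then have "\<gamma> < \<alpha>" using True by simp
  then show ?thesis using stage_N(2)[of \<gamma> \<alpha> i] tree_upto_T t by simp
next
  case False
  assume "t \<in> T"
  then show ?thesis using ini_id[OF T_dom] False by (simp add: not_less)
qed

lemma ht_ini: "t \<in> T \<Longrightarrow> \<gamma> \<le> ht t \<Longrightarrow> ht (ini t \<gamma>) = \<gamma>"
  by (rule ht_eq) (rule dom_ini[OF T_dom])

lemma T_strict:
  assumes "x \<in> T" "y \<in> T" "map_less x y"
  shows "ht x < ht y" "fv x < fv y"
proof -
  have le: "x \<subseteq>\<^sub>m y" "x \<noteq> y" using assms(3) by (simp_all add: map_less_def)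
  have "ht x \<le> ht y" by (rule map_le_dom_le[OF le(1) T_dom[OF assms(1)] T_dom[OF assms(2)]])
  moreover have "ht x \<noteq> ht y" using map_le_same_dom[OF le(1)] le(2) T_dom assms(1,2) by metis
  ultimately show "ht x < ht y" by simp
  then show "fv x < fv y"
    by (rule increasing_strict[OF T_increasing[OF assms(2)] le(1) T_dom[OF assms(1)] T_dom[OF assms(2)]])
qed

lemma map_less_iff:
  assumes "x \<in> T" "y \<in> T"
  shows "map_less x y \<longleftrightarrow> ht x < ht y \<and> ini y (ht x) = x"
proof
  assume *: "map_less x y"
  then have "ini y (ht x) = x" using map_le_iff_ini[OF T_dom[OF assms(1)]] by (simp add: map_less_def)
  then show "ht x < ht y \<and> ini y (ht x) = x" using T_strict[OF assms *] by simp
next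
  assume *: "ht x < ht y \<and> ini y (ht x) = x"
  then have "x \<subseteq>\<^sub>m y" using map_le_iff_ini[OF T_dom[OF assms(1)]] by simp
  then show "map_less x y" using * by (auto simp: map_less_def)
qed

lemma aleph1_tree_T: "aleph1_tree T"
proof -
  have "T \<subseteq> nodes UNIV" using T_dom by (auto simp: nodes_def)
  then have "is_tree T" unfolding is_tree_def using T_ini by blast
  then show ?thesis unfolding aleph1_tree_def level_T by simp
qed

lemma real_embeddable_T: "real_embeddable T"
  unfolding real_embeddable_def using T_strict(2) by blast

section \<open>Sealing at club many levels\<close>

lemma guess_nodes_correct:
  assumes "{(\<beta>, i). N \<beta> i \<in> B} \<inter> ({..<\<alpha>} \<times> UNIV) = \<Omega> \<alpha>" "B \<subseteq> T"
  shows "guess_nodes \<Omega> G \<alpha> = {t \<in> B. ht t < \<alpha>}"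
proof -
  have "(\<beta>, i) \<in> \<Omega> \<alpha> \<longleftrightarrow> N \<beta> i \<in> B" if "\<beta> < \<alpha>" for \<beta> i
    unfolding assms(1)[symmetric] using that by simp
  then have "guess_nodes \<Omega> G \<alpha> = {N \<beta> i | \<beta> i. \<beta> < \<alpha> \<and> N \<beta> i \<in> B}"
    unfolding guess_nodes_def N_def[symmetric] by blast
  also have "\<dots> = {t \<in> B. ht t < \<alpha>}"
  proof
    show "{t \<in> B. ht t < \<alpha>} \<subseteq> {N \<beta> i | \<beta> i. \<beta> < \<alpha> \<and> N \<beta> i \<in> B}"
    proof
      fix t assume t: "t \<in> {t \<in> B. ht t < \<alpha>}"
      then obtain \<beta> i where "t = N \<beta> i" using T_cases assms(2) by blast
      with t show "t \<in> {N \<beta> i | \<beta> i. \<beta> < \<alpha> \<and> N \<beta> i \<in> B}" by auto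
    qed
  qed auto
  finally show ?thesis .
qed

abbreviation limit_or_free :: "omega1 \<Rightarrow> node set \<Rightarrow> node \<Rightarrow> bool" where
  "limit_or_free \<alpha> B x \<equiv> (\<forall>\<gamma><\<alpha>. \<exists>\<epsilon>. \<gamma> \<le> \<epsilon> \<and> \<epsilon> < \<alpha> \<and> ini x \<epsilon> \<in> B) \<or>
    (\<exists>\<eta> q Z. \<eta> < \<alpha> \<and> q \<in> \<rat> \<and> fv x < q \<and> (Z \<longrightarrow> bts x \<inter> {\<eta>..} = {}) \<and>
       cone \<eta> (ini x \<eta>) q Z \<inter> B = {})"

text \<open>This one property yields both almost-Souslinity and perfect normality.\<close>

lemma sealing:
  assumes B: "B \<subseteq> T"
  shows "\<exists>E. club E \<and> (\<forall>\<alpha>\<in>E. limit_ord \<alpha> \<and> (\<forall>x\<in>level T \<alpha>.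
    limit_or_free \<alpha> B x))"
proof -
  define h where "h = (\<lambda>(y, q, Z). ht (SOME y'. y' \<in> cone (ht y) y q Z \<inter> B))"
  define K where "K = {\<beta>. \<forall>\<gamma><\<beta>. \<forall>p\<in>range (N \<gamma>) \<times> \<rat> \<times> (UNIV :: bool set). h p < \<beta>}"
  have "club K" unfolding K_def
    by (rule club_closure_points) (simp add: countable_rat)
  \<comment> \<open>Closure points at which \<open>\<Omega>\<close> predicts \<open>B\<close>
    correctly. This set is merely stationary, but uncountability is all that \<open>hit\<close> asks
    for.\<close>
  define W where "W = {\<alpha>. {(\<beta>, i). N \<beta> i \<in> B} \<inter> ({..<\<alpha>} \<times> UNIV) = \<Omega> \<alpha>} \<inter> K"
  have W: "uncountable W" unfolding W_def
    by (intro stationary_uncountable stationary_Int_club predict \<open>club K\<close>)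
  obtain E where E: "club E" "\<forall>\<alpha>\<in>E. acc_of (C \<alpha> \<inter> W) \<alpha>"
    using hit[OF W] by (elim exE conjE) (rule that)
  \<comment> \<open>Passes from missing the prediction to missing \<open>B\<close>: by closure of
    \<beta>, a cone with root below \<beta> and rational bound that meets \<open>B\<close> at all
    meets it below \<beta>.\<close>
  have closed: "cone \<eta> y q Z \<inter> B = {}"
    if \<beta>: "\<beta> \<in> K" and y: "y \<in> range (N \<eta>)" "\<eta> < \<beta>" and q: "q \<in> \<rat>"
      and empty: "cone \<eta> y q Z \<inter> {t \<in> B. ht t < \<beta>} = {}" for \<beta> y \<eta> q Z
  proof (rule ccontr)
    assume "cone \<eta> y q Z \<inter> B \<noteq> {}"
    moreover have "ht y = \<eta>" using y(1) by auto
    ultimately have "\<exists>y'. y' \<in> cone (ht y) y q Z \<inter> B" by blast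
    then have y': "(SOME y'. y' \<in> cone (ht y) y q Z \<inter> B) \<in> cone (ht y) y q Z \<inter> B" by (rule someI_ex)
    have "(y, q, Z) \<in> range (N \<eta>) \<times> \<rat> \<times> UNIV" using y q by blast
    then have "h (y, q, Z) < \<beta>" using \<beta> y(2) unfolding K_def by blast
    then show False using empty y' \<open>ht y = \<eta>\<close> by (auto simp: h_def)
  qed
  have "limit_ord \<alpha> \<and> (\<forall>x\<in>level T \<alpha>. limit_or_free \<alpha> B x)" if "\<alpha> \<in> E" for \<alpha>
  proof (intro conjI ballI disjCI allI impI)
    show lim: "limit_ord \<alpha>" by (rule acc_of_limit[OF E(2)[rule_format, OF that]])
    fix x \<gamma>
    assume x: "x \<in> level T \<alpha>" and no: "\<not> (\<exists>\<eta> q Z. \<eta> < \<alpha> \<and> q \<in> \<rat> \<and> fv x < q \<and>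
      (Z \<longrightarrow> bts x \<inter> {\<eta>..} = {}) \<and> cone \<eta> (ini x \<eta>) q Z \<inter> B = {})" and \<gamma>: "\<gamma> < \<alpha>"
    obtain i where i: "x = N \<alpha> i" using x level_T by auto
    have "sealed \<alpha> (C \<alpha>) (\<lambda>\<beta>. if \<beta> < \<alpha> then guess_nodes \<Omega> G \<beta> else {}) x"
      unfolding i by (rule stage_N(5)[OF lim])
    from this[unfolded sealed_def, rule_format, OF \<gamma>] obtain \<delta> where \<delta>: "\<delta> < \<alpha>"
      "\<And>\<beta>. \<beta> \<in> C \<alpha> \<Longrightarrow> \<delta> < \<beta> \<Longrightarrow> sealed_at (if \<beta> < \<alpha> then guess_nodes \<Omega> G \<beta> else {}) \<gamma> \<beta> x" by blast
    obtain \<beta> where \<beta>: "\<beta> \<in> C \<alpha>" "\<beta> \<in> W" "\<delta> < \<beta>" "\<beta> < \<alpha>"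
      using E(2)[rule_format, OF \<open>\<alpha> \<in> E\<close>] \<delta>(1) unfolding acc_of_def by blast
    have gn: "guess_nodes \<Omega> G \<beta> = {t \<in> B. ht t < \<beta>}"
      using guess_nodes_correct[OF _ B] \<beta>(2) unfolding W_def by blast
    obtain \<eta> q Z where \<eta>: "\<gamma> \<le> \<eta>" "\<eta> < \<beta>" "fv x < q" "q \<in> \<rat>" "Z \<longrightarrow> bts x \<inter> {\<eta>..} = {}"
      "(\<exists>\<epsilon>. \<eta> \<le> \<epsilon> \<and> \<epsilon> < \<beta> \<and> ini x \<epsilon> \<in> {t \<in> B. ht t < \<beta>}) \<or>
        cone \<eta> (ini x \<eta>) q Z \<inter> {t \<in> B. ht t < \<beta>} = {}"
      using \<delta>(2)[OF \<beta>(1,3)] \<beta>(4) unfolding gn by (simp only: if_True) blast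
    have "\<eta> < \<alpha>" using \<eta>(2) \<beta>(4) by simp
    have "x \<in> T" using x levelD by blast
    then have "ini x \<eta> \<in> level T \<eta>"
      using T_ini dom_ini[OF levelD(2)[OF x] less_imp_le[OF \<open>\<eta> < \<alpha>\<close>]] levelI by blast
    then have "ini x \<eta> \<in> range (N \<eta>)" using level_T by simp
    then have "cone \<eta> (ini x \<eta>) q Z \<inter> {t \<in> B. ht t < \<beta>} \<noteq> {}"
      using closed[of \<beta> "ini x \<eta>" \<eta> q Z] \<eta>(2,3,4,5) no \<open>\<eta> < \<alpha>\<close> \<beta>(2) unfolding W_def by blast
    then obtain \<epsilon> where "\<eta> \<le> \<epsilon>" "\<epsilon> < \<beta>" "ini x \<epsilon> \<in> B" using \<eta>(6) by blast
    then show "\<exists>\<epsilon>. \<gamma> \<le> \<epsilon> \<and> \<epsilon> < \<alpha> \<and> ini x \<epsilon> \<in> B"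
      using \<eta>(1) \<beta>(4) by (intro exI[of _ \<epsilon>]) auto
  qed
  then show ?thesis using E(1) by blast
qed

text \<open>At a level of the club a member of the antichain would have a proper initial segment in
  the antichain, or lie in a cone that misses the antichain; for every node lies in its own
  cones.\<close>

lemma almost_Souslin_T: "almost_Souslin T"
  unfolding almost_Souslin_def
proof (intro allI impI notI)
  fix A assume A: "A \<subseteq> T" "tree_antichain A" "stationary (ht ` A)"
  obtain E where E: "club E" "\<And>\<alpha> x. \<alpha> \<in> E \<Longrightarrow> x \<in> level T \<alpha> \<Longrightarrow> limit_ord \<alpha> \<and>
    (limit_or_free \<alpha> A x)"
    using sealing[OF A(1)] by blast
  obtain x where x: "x \<in> A" "ht x \<in> E" using A(3) E(1) unfolding stationary_def by blast
  have "x \<in> T" using x A(1) by blast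
  note alt = E(2)[OF x(2) T_level[OF this]]
  from alt show False
  proof (elim conjE disjE exE)
    assume lim: "limit_ord (ht x)" and *: "\<forall>\<gamma><ht x. \<exists>\<epsilon>. \<gamma> \<le> \<epsilon> \<and> \<epsilon> < ht x \<and> ini x \<epsilon> \<in> A"
    obtain \<epsilon> where \<epsilon>: "\<epsilon> < ht x" "ini x \<epsilon> \<in> A" using * limit_ord_nonempty[OF lim] by blast
    have "ini x \<epsilon> = x" using A(2) \<epsilon>(2) x(1) ini_le unfolding tree_antichain_def by blast
    then show False using ht_ini[OF \<open>x \<in> T\<close> less_imp_le[OF \<epsilon>(1)]] \<epsilon>(1) by simp
  next
    fix \<eta> q Z
    assume "fv x < q" "Z \<longrightarrow> bts x \<inter> {\<eta>..} = {}" "cone \<eta> (ini x \<eta>) q Z \<inter> A = {}"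
    moreover from this have "x \<in> cone \<eta> (ini x \<eta>) q Z" using ini_le by (simp add: cone_def)
    ultimately show False using x(1) by blast
  qed
qed

end

subsection \<open>Perfect normality\<close>

text \<open>Countably many open sets, each inside a closed set that misses \<open>F\<close>, cover
  the complement of \<open>F\<close>. The closed sets exhibit \<open>F\<close> as a countable
  intersection of open sets, and successive subtraction separates two disjoint closed sets.\<close>

lemma perfectly_normal_spaceI:
  assumes t1: "t1_space X"
    and ref: "\<And>F. closedin X F \<Longrightarrow> \<exists>\<W>. countable \<W> \<and> topspace X - F \<subseteq> (\<Union>p\<in>\<W>. fst p) \<and>
      (\<forall>p\<in>\<W>. openin X (fst p) \<and> closedin X (snd p) \<and> fst p \<subseteq> snd p \<and> snd p \<inter> F = {})"
  shows "perfectly_normal_space X"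
proof -
  have seq: "\<exists>W K :: nat \<Rightarrow> 'a set. topspace X - F \<subseteq> (\<Union>n. W n) \<and>
      (\<forall>n. openin X (W n) \<and> closedin X (K n) \<and> W n \<subseteq> K n \<and> K n \<inter> F = {})"
    if F: "closedin X F" for F
  proof -
    obtain \<W> where \<W>: "countable \<W>" "topspace X - F \<subseteq> (\<Union>p\<in>\<W>. fst p)"
      "\<forall>p\<in>\<W>. openin X (fst p) \<and> closedin X (snd p) \<and> fst p \<subseteq> snd p \<and> snd p \<inter> F = {}"
      using ref[OF F] by (elim exE conjE) (rule that)
    \<comment> \<open>The empty pair is added so that there is a nonempty set to enumerate.\<close>
    define p where "p = from_nat_into (insert ({}, {}) \<W>)"
    have range: "range p = insert ({}, {}) \<W>" using \<W>(1) unfolding p_def by simp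
    have "openin X (fst (p n)) \<and> closedin X (snd (p n)) \<and> fst (p n) \<subseteq> snd (p n) \<and> snd (p n) \<inter> F = {}" for n
    proof -
      have "p n = ({}, {}) \<or> p n \<in> \<W>" using range by blast
      then show ?thesis
      proof
        assume "p n \<in> \<W>" then show ?thesis using \<W>(3) by blast
      qed simp
    qed
    moreover have "topspace X - F \<subseteq> (\<Union>n. fst (p n))"
    proof
      fix x assume "x \<in> topspace X - F"
      then obtain v where v: "v \<in> \<W>" "x \<in> fst v" using \<W>(2) by blast
      then have "v \<in> range p" using range by simp
      then show "x \<in> (\<Union>n. fst (p n))" using v(2) by blast
    qed
    ultimately show ?thesis
      by (intro exI[of _ "\<lambda>n. fst (p n)"] exI[of _ "\<lambda>n. snd (p n)"]) simp
  qed
  have "gdelta_in X F" if F: "closedin X F" for F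
  proof -
    obtain W K where WK: "topspace X - F \<subseteq> (\<Union>n::nat. W n)"
      "\<And>n. openin X (W n)" "\<And>n. closedin X (K n)" "\<And>n. W n \<subseteq> K n" "\<And>n. K n \<inter> F = {}"
      using seq[OF F] by metis
    have "F = \<Inter> (range (\<lambda>n. topspace X - K n))"
    proof (intro equalityI subsetI)
      fix x assume "x \<in> F"
      then show "x \<in> \<Inter> (range (\<lambda>n. topspace X - K n))"
        using closedin_subset[OF F] WK(5) by auto
    next
      fix x assume x: "x \<in> \<Inter> (range (\<lambda>n. topspace X - K n))"
      have "x \<notin> W n" for n using x WK(4)[of n] by auto
      then show "x \<in> F" using x WK(1) by auto
    qed
    moreover have "gdelta_in X (\<Inter> (range (\<lambda>n. topspace X - K n)))"
      by (rule gdelta_in_Inter) (use WK(3) in \<open>auto intro: open_imp_gdelta_in\<close>)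
    ultimately show ?thesis by simp
  qed
  moreover have "normal_space X"
    unfolding normal_space_def
  proof (intro allI impI, elim conjE)
    fix H K assume H: "closedin X H" and K: "closedin X K" and disj: "disjnt H K"
    obtain W P where W: "topspace X - H \<subseteq> (\<Union>n::nat. W n)"
      "\<And>n. openin X (W n)" "\<And>n. closedin X (P n)" "\<And>n. W n \<subseteq> P n" "\<And>n. P n \<inter> H = {}"
      using seq[OF H] by metis
    obtain V Q where V: "topspace X - K \<subseteq> (\<Union>n::nat. V n)"
      "\<And>n. openin X (V n)" "\<And>n. closedin X (Q n)" "\<And>n. V n \<subseteq> Q n" "\<And>n. Q n \<inter> K = {}"
      using seq[OF K] by metis
    \<comment> \<open>Whichever of \<open>A m\<close> and \<open>B n\<close> has the larger index
      (\<open>B n\<close> in case of equality) has lost the closed set around the open set from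
      which the other one arises.\<close>
    define A where "A n = V n - (\<Union>j\<in>{..n}. P j)" for n
    define B where "B n = W n - (\<Union>j\<in>{..n}. Q j)" for n
    have "openin X (\<Union>n. A n)" "openin X (\<Union>n. B n)"
      unfolding A_def B_def using V(2,3) W(2,3)
      by (auto intro!: openin_Union openin_diff closedin_Union)
    moreover have "H \<subseteq> (\<Union>n. A n)"
    proof
      fix x assume "x \<in> H"
      then have "x \<in> topspace X - K" using closedin_subset[OF H] disj by (auto simp: disjnt_def)
      then obtain n where "x \<in> V n" using V(1) by blast
      then show "x \<in> (\<Union>n. A n)" using \<open>x \<in> H\<close> W(5) unfolding A_def by blast
    qed
    moreover have "K \<subseteq> (\<Union>n. B n)"
    proof
      fix x assume "x \<in> K"
      then have "x \<in> topspace X - H" using closedin_subset[OF K] disj by (auto simp: disjnt_def)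
      then obtain n where "x \<in> W n" using W(1) by blast
      then show "x \<in> (\<Union>n. B n)" using \<open>x \<in> K\<close> V(5) unfolding B_def by blast
    qed
    moreover have "A m \<inter> B n = {}" for m n
    proof (cases "m \<le> n")
      case True
      then have "A m \<subseteq> Q m" "B n \<inter> Q m = {}" using V(4)[of m] unfolding A_def B_def by auto
      then show ?thesis by blast
    next
      case False
      then have "B n \<subseteq> P n" "A m \<inter> P n = {}" using W(4)[of n] unfolding A_def B_def by auto
      then show ?thesis by blast
    qed
    then have "disjnt (\<Union>n. A n) (\<Union>n. B n)" unfolding disjnt_def by blast
    ultimately show "\<exists>U V. openin X U \<and> openin X V \<and> H \<subseteq> U \<and> K \<subseteq> V \<and> disjnt U V" by blast
  qed
  ultimately show ?thesis using t1 unfolding perfectly_normal_space_def by blast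
qed

definition last_below :: "omega1 set \<Rightarrow> omega1 \<Rightarrow> omega1 \<Rightarrow> bool" where
  "last_below E \<alpha> \<eta> \<longleftrightarrow> \<eta> \<in> E \<and> \<eta> < \<alpha> \<and> (\<forall>\<beta>. \<eta> < \<beta> \<and> \<beta> \<le> \<alpha> \<longrightarrow> \<beta> \<notin> E)"

text \<open>The supremum of \<open>E\<close> below \<alpha> belongs to \<open>E\<close> because
  \<open>E\<close> is closed, and differs from \<alpha> because \<alpha> does not; the least ordinal
  \<zeta> ensures that there is something to take the supremum of.\<close>

lemma last_below_exists:
  assumes E: "club E" and \<zeta>: "\<zeta> \<in> E" "{..<\<zeta>} = {}" and \<alpha>: "\<alpha> \<notin> E"
  shows "\<exists>\<eta>. last_below E \<alpha> \<eta>"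
proof -
  define Q where "Q \<mu> \<longleftrightarrow> (\<forall>\<beta>\<in>E. \<beta> < \<alpha> \<longrightarrow> \<beta> \<le> \<mu>)" for \<mu>
  define \<mu> where "\<mu> = (LEAST \<mu>. Q \<mu>)"
  have "Q \<alpha>" by (simp add: Q_def less_imp_le)
  then have Q: "Q \<mu>" "\<mu> \<le> \<alpha>" unfolding \<mu>_def by (rule LeastI, rule Least_le)
  have min: "\<exists>\<beta>\<in>E. \<beta> < \<alpha> \<and> \<nu> < \<beta>" if "\<nu> < \<mu>" for \<nu>
  proof -
    have "\<not> Q \<nu>" using that not_less_Least unfolding \<mu>_def by blast
    then show ?thesis by (auto simp: Q_def not_le)
  qed
  have "\<mu> \<in> E"
  proof (rule ccontr)
    assume n: "\<mu> \<notin> E"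
    have "acc_of E \<mu>" unfolding acc_of_def
    proof (intro conjI allI impI)
      have "\<zeta> \<noteq> \<alpha>" using \<zeta>(1) \<alpha> by blast
      moreover have "\<not> \<alpha> < \<zeta>" using \<zeta>(2) by auto
      ultimately have "\<zeta> < \<alpha>" by simp
      then have "\<zeta> \<le> \<mu>" using Q(1) \<zeta>(1) unfolding Q_def by blast
      moreover have "\<zeta> \<noteq> \<mu>" using n \<zeta>(1) by blast
      ultimately have "\<zeta> < \<mu>" by simp
      then show "{..<\<mu>} \<noteq> {}" by blast
      fix \<nu> assume "\<nu> < \<mu>"
      then obtain \<beta> where \<beta>: "\<beta> \<in> E" "\<beta> < \<alpha>" "\<nu> < \<beta>" using min by blast
      then have "\<beta> \<le> \<mu>" "\<beta> \<noteq> \<mu>" using Q(1) n unfolding Q_def by blast+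
      then show "\<exists>\<delta>\<in>E. \<nu> < \<delta> \<and> \<delta> < \<mu>" using \<beta> by (intro bexI[of _ \<beta>]) auto
    qed
    then show False using E n unfolding club_def by blast
  qed
  moreover from this have "\<mu> < \<alpha>" using Q(2) \<alpha> by (metis le_less)
  moreover have "\<beta> \<notin> E" if "\<mu> < \<beta>" "\<beta> \<le> \<alpha>" for \<beta>
  proof
    assume "\<beta> \<in> E"
    then have "\<beta> < \<alpha>" using that(2) \<alpha> by (metis le_less)
    then show False using Q(1) \<open>\<beta> \<in> E\<close> that(1) unfolding Q_def by (meson leD)
  qed
  ultimately show ?thesis unfolding last_below_def by blast
qed

text \<open>The number \<rho> lies in the jump of \<open>fv\<close> caused by the entry at \<eta>.
  Jumps along one node are disjoint, so \<rho> names \<eta>; for rational \<rho> there are only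
  countably many names.\<close>

definition cross :: "real \<Rightarrow> node \<Rightarrow> omega1 \<Rightarrow> bool" where
  "cross \<rho> z \<eta> \<longleftrightarrow> \<eta> \<in> dom z \<and> fv (ini z \<eta>) < \<rho> \<and> \<rho> < rv (the (z \<eta>))"

lemma cross_unique:
  assumes "cross \<rho> z \<eta>" "cross \<rho> z \<eta>'"
  shows "\<eta> = \<eta>'"
proof -
  have False if "cross \<rho> z \<eta>" "cross \<rho> z \<eta>'" "\<eta> < \<eta>'" for \<eta> \<eta>'
  proof -
    have "\<eta> \<in> dom (ini z \<eta>')" using that by (auto simp: cross_def)
    from fv_upper[OF this] have "rv (the (z \<eta>)) \<le> fv (ini z \<eta>')" using that(3) by simp
    then show False using that(1,2) by (simp add: cross_def)
  qed
  then show ?thesis using assms by (metis less_linear)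
qed

lemma cross_ini: "\<eta> < \<delta> \<Longrightarrow> cross \<rho> (ini z \<delta>) \<eta> \<longleftrightarrow> cross \<rho> z \<eta>"
  unfolding cross_def using ini_ini_le[of \<eta> \<delta> z] by auto

lemma cross_exists:
  assumes "increasing z" "\<eta> \<in> dom z"
  shows "\<exists>\<rho>\<in>\<rat>. cross \<rho> z \<eta>"
proof -
  have "fv (ini z \<eta>) < rv (the (z \<eta>))" using assms by (simp add: increasing_def)
  from Rats_dense_in_real[OF this] show ?thesis using assms(2) unfolding cross_def by blast
qed

section \<open>The interval topology in terms of initial segments\<close>

context constructed_tree
begin

abbreviation X :: "node topology" where "X \<equiv> interval_topology T"

lemma Map_empty_in_T: "Map.empty \<in> T"
proof -
  obtain \<zeta> :: omega1 where "{..<\<zeta>} = {}" using least_omega1 by blast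
  then have "dom (N \<zeta> 0) = {}" using stage_N(1) by metis
  then show ?thesis using N_in_T[of \<zeta> 0] by simp
qed

lemma T_root: "z \<in> T \<Longrightarrow> {..<ht z} = {} \<Longrightarrow> z = Map.empty"
  using T_dom[of z] by simp

lemma le_T_eq: "w \<in> T \<Longrightarrow> w \<subseteq>\<^sub>m z \<Longrightarrow> w = ini z (ht w)"
  using map_le_iff_ini[OF T_dom] by metis

lemma ht_mono: "w \<in> T \<Longrightarrow> z \<in> T \<Longrightarrow> w \<subseteq>\<^sub>m z \<Longrightarrow> ht w \<le> ht z"
  using map_le_dom_le[OF _ T_dom T_dom] by blast

lemma ini_ht: "z \<in> T \<Longrightarrow> ini z (ht z) = z"
  by (rule ini_id[OF T_dom]) simp_all

text \<open>Initial segments with heights in \<open>(\<gamma>, ht z]\<close> form basic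
  neighbourhoods of a node of nonzero height. Topological arguments thereby become statements about
  heights.\<close>

lemma openin_interval_topology:
  "openin X U \<longleftrightarrow> U \<subseteq> T \<and>
     (\<forall>z\<in>U. {..<ht z} = {} \<or> (\<exists>\<gamma><ht z. \<forall>\<delta>. \<gamma> < \<delta> \<and> \<delta> \<le> ht z \<longrightarrow> ini z \<delta> \<in> U))"
  (is "_ \<longleftrightarrow> ?P U")
proof
  assume "openin X U"
  then have "generate_topology_on (insert {Map.empty} {tree_interval T x y | x y. x \<in> T \<and> y \<in> T}) U"
    unfolding interval_topology_def openin_topology_generated_by_iff .
  then show "?P U"
  proof induction
    case Empty
    then show ?case by simp
  next
    case (Int a b)
    show ?case
    proof (intro conjI ballI)
      show "a \<inter> b \<subseteq> T" using Int by blast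
      fix z assume z: "z \<in> a \<inter> b"
      show "{..<ht z} = {} \<or> (\<exists>\<gamma><ht z. \<forall>\<delta>. \<gamma> < \<delta> \<and> \<delta> \<le> ht z \<longrightarrow> ini z \<delta> \<in> a \<inter> b)"
      proof (cases "{..<ht z} = {}")
        case False
        have "z \<in> a" "z \<in> b" using z by simp_all
        obtain \<gamma> where \<gamma>: "\<gamma> < ht z" "\<forall>\<delta>. \<gamma> < \<delta> \<and> \<delta> \<le> ht z \<longrightarrow> ini z \<delta> \<in> a"
          using Int.IH(1)[THEN conjunct2, rule_format, OF \<open>z \<in> a\<close>] False by blast
        obtain \<gamma>' where \<gamma>': "\<gamma>' < ht z" "\<forall>\<delta>. \<gamma>' < \<delta> \<and> \<delta> \<le> ht z \<longrightarrow> ini z \<delta> \<in> b"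
          using Int.IH(2)[THEN conjunct2, rule_format, OF \<open>z \<in> b\<close>] False by blast
        from \<gamma> \<gamma>' have "\<exists>\<gamma><ht z. \<forall>\<delta>. \<gamma> < \<delta> \<and> \<delta> \<le> ht z \<longrightarrow> ini z \<delta> \<in> a \<inter> b"
          by (intro exI[of _ "max \<gamma> \<gamma>'"]) simp
        then show ?thesis ..
      qed simp
    qed
  next
    case (UN K)
    show ?case
    proof (intro conjI ballI)
      show "\<Union>K \<subseteq> T" using UN by blast
      fix z assume "z \<in> \<Union>K"
      then obtain k where k: "k \<in> K" "z \<in> k" by blast
      then have "{..<ht z} = {} \<or> (\<exists>\<gamma><ht z. \<forall>\<delta>. \<gamma> < \<delta> \<and> \<delta> \<le> ht z \<longrightarrow> ini z \<delta> \<in> k)"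
        using UN.IH[OF k(1), THEN conjunct2] by blast
      then show "{..<ht z} = {} \<or> (\<exists>\<gamma><ht z. \<forall>\<delta>. \<gamma> < \<delta> \<and> \<delta> \<le> ht z \<longrightarrow> ini z \<delta> \<in> \<Union>K)"
        using k(1) by blast
    qed
  next
    case (Basis s)
    then consider "s = {Map.empty}" | x y where "x \<in> T" "y \<in> T" "s = tree_interval T x y" by blast
    then show ?case
    proof cases
      case 1
      have "{..<ht (Map.empty :: node)} = {}" using T_dom[OF Map_empty_in_T, symmetric] by simp
      then show ?thesis using 1 Map_empty_in_T by simp
    next
      case 2
      show ?thesis
      proof (intro conjI ballI)
        show "s \<subseteq> T" using 2 by (auto simp: tree_interval_def)
        fix z assume "z \<in> s"
        then have z: "z \<in> T" "map_less x z" "z \<subseteq>\<^sub>m y" using 2 by (simp_all add: tree_interval_def)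
        then have x: "ht x < ht z" "ini z (ht x) = x" using map_less_iff 2(1) by simp_all
        have "ini z \<delta> \<in> s" if \<delta>: "ht x < \<delta>" "\<delta> \<le> ht z" for \<delta>
        proof -
          have "ini (ini z \<delta>) (ht x) = x" using ini_ini_le[of "ht x" \<delta> z] \<delta>(1) x(2) by simp
          then have "map_less x (ini z \<delta>)"
            using map_less_iff[OF 2(1) T_ini[OF z(1)]] ht_ini[OF z(1) \<delta>(2)] \<delta>(1) by simp
          moreover have "ini z \<delta> \<subseteq>\<^sub>m y" using ini_le z(3) by (rule map_le_trans)
          ultimately show ?thesis using 2(3) T_ini[OF z(1)] by (simp add: tree_interval_def)
        qed
        then show "{..<ht z} = {} \<or> (\<exists>\<gamma><ht z. \<forall>\<delta>. \<gamma> < \<delta> \<and> \<delta> \<le> ht z \<longrightarrow> ini z \<delta> \<in> s)"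
          using x(1) by blast
      qed
    qed
  qed
next
  assume U: "?P U"
  have basis: "openin X {Map.empty}"
    "\<And>x y. x \<in> T \<Longrightarrow> y \<in> T \<Longrightarrow> openin X (tree_interval T x y)"
    unfolding interval_topology_def by (rule topology_generated_by_Basis, blast)+
  have "\<exists>V. openin X V \<and> z \<in> V \<and> V \<subseteq> U" if z: "z \<in> U" for z
  proof (cases "{..<ht z} = {}")
    case True
    then have "z = Map.empty" using T_root z U by blast
    then show ?thesis using basis(1) z by blast
  next
    case False
    then obtain \<gamma> where \<gamma>: "\<gamma> < ht z" "\<And>\<delta>. \<gamma> < \<delta> \<Longrightarrow> \<delta> \<le> ht z \<Longrightarrow> ini z \<delta> \<in> U"
      using U[THEN conjunct2, rule_format, OF z] by blast
    have zT: "z \<in> T" using U z by blast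
    have hg: "ht (ini z \<gamma>) = \<gamma>" using ht_ini[OF zT] \<gamma>(1) by simp
    have "z \<in> tree_interval T (ini z \<gamma>) z"
      using map_less_iff[OF T_ini[OF zT] zT, of \<gamma>] hg \<gamma>(1) zT by (simp add: tree_interval_def)
    moreover have "tree_interval T (ini z \<gamma>) z \<subseteq> U"
    proof
      fix w assume "w \<in> tree_interval T (ini z \<gamma>) z"
      then have w: "w \<in> T" "map_less (ini z \<gamma>) w" "w \<subseteq>\<^sub>m z" by (simp_all add: tree_interval_def)
      then have "\<gamma> < ht w" using map_less_iff[OF T_ini[OF zT] w(1), of \<gamma>] hg by simp
      then have "ini z (ht w) \<in> U" using \<gamma>(2) ht_mono[OF w(1) zT w(3)] by blast
      then show "w \<in> U" using le_T_eq[OF w(1,3)] by simp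
    qed
    ultimately show ?thesis using basis(2)[OF T_ini[OF zT] zT] by blast
  qed
  then show "openin X U" by (subst openin_subopen) blast
qed

lemma topspace_T: "topspace X = T"
proof
  show "topspace X \<subseteq> T" unfolding topspace_def openin_interval_topology by blast
  have "openin X T"
    unfolding openin_interval_topology using T_ini by (auto dest: T_ini)
  then show "T \<subseteq> topspace X" by (rule openin_subset)
qed

lemma closedin_T_I:
  assumes "F \<subseteq> T"
    and "\<And>z. z \<in> T \<Longrightarrow> {..<ht z} \<noteq> {} \<Longrightarrow> (\<And>\<gamma>. \<gamma> < ht z \<Longrightarrow> \<exists>\<delta>. \<gamma> < \<delta> \<and> \<delta> < ht z \<and> ini z \<delta> \<in> F) \<Longrightarrow> z \<in> F"
  shows "closedin X F"
proof -
  have "openin X (T - F)"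
    unfolding openin_interval_topology
  proof (intro conjI ballI)
    fix z assume z: "z \<in> T - F"
    show "{..<ht z} = {} \<or> (\<exists>\<gamma><ht z. \<forall>\<delta>. \<gamma> < \<delta> \<and> \<delta> \<le> ht z \<longrightarrow> ini z \<delta> \<in> T - F)"
    proof (cases "{..<ht z} = {}")
      case False
      then obtain \<gamma> where \<gamma>: "\<gamma> < ht z" "\<And>\<delta>. \<gamma> < \<delta> \<Longrightarrow> \<delta> < ht z \<Longrightarrow> ini z \<delta> \<notin> F"
        using assms(2)[of z] z by blast
      have "ini z \<delta> \<in> T - F" if "\<gamma> < \<delta>" "\<delta> \<le> ht z" for \<delta>
        using that \<gamma>(2)[of \<delta>] z T_ini[of z \<delta>] ini_ht[of z] by (cases "\<delta> = ht z") auto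
      then show ?thesis using \<gamma>(1) by blast
    qed simp
  qed blast
  then show ?thesis using assms(1) by (simp add: closedin_def topspace_T)
qed

lemma closedin_T_D:
  assumes "closedin X F" "z \<in> T" "z \<notin> F" "{..<ht z} \<noteq> {}"
  shows "\<exists>\<gamma><ht z. \<forall>\<delta>. \<gamma> < \<delta> \<and> \<delta> \<le> ht z \<longrightarrow> ini z \<delta> \<notin> F"
proof -
  have "openin X (T - F)" using assms(1) by (simp add: closedin_def topspace_T)
  moreover have "z \<in> T - F" using assms(2,3) by blast
  ultimately obtain \<gamma> where "\<gamma> < ht z" "\<forall>\<delta>. \<gamma> < \<delta> \<and> \<delta> \<le> ht z \<longrightarrow> ini z \<delta> \<in> T - F"
    using assms(4) unfolding openin_interval_topology by blast
  then show ?thesis by (intro exI[of _ \<gamma>]) simp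
qed

lemma t1_space_T: "t1_space X"
  unfolding t1_space_closedin_singleton topspace_T
proof
  fix x assume x: "x \<in> T"
  show "closedin X {x}"
  proof (rule closedin_T_I)
    fix z assume z: "z \<in> T" "{..<ht z} \<noteq> {}"
      and cof: "\<And>\<gamma>. \<gamma> < ht z \<Longrightarrow> \<exists>\<delta>. \<gamma> < \<delta> \<and> \<delta> < ht z \<and> ini z \<delta> \<in> {x}"
    have "\<exists>\<gamma>. \<gamma> < ht z" using z(2) by blast
    then obtain \<delta> where \<delta>: "\<delta> < ht z" "ini z \<delta> = x" using cof by blast
    then obtain \<delta>' where \<delta>': "\<delta> < \<delta>'" "\<delta>' < ht z" "ini z \<delta>' = x" using cof by blast
    have "ht x = \<delta>" "ht x = \<delta>'" using ht_ini[OF z(1)] \<delta> \<delta>' by (metis less_imp_le)+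
    then show "z \<in> {x}" using \<delta>'(1) by simp
  qed (use x in simp)
qed


text \<open>The root of the cone is determined by \<open>z\<close> and \<open>\<rho>\<close>, which is why the union over all roots
  remains closed.\<close>

definition cone_part :: "node set \<Rightarrow> real \<times> real \<times> bool \<Rightarrow> node set" where
  "cone_part F = (\<lambda>(\<rho>, q, Z). {z \<in> T. \<exists>\<eta>. cross \<rho> z \<eta> \<and> cone \<eta> (ini z \<eta>) q Z \<inter> F = {} \<and>
     (Z \<longrightarrow> bts z \<inter> {\<eta>..} = {})})"

lemma cone_part_ini:
  assumes "cross \<rho> z \<eta>" "\<eta> < \<delta>"
  shows "cross \<rho> (ini z \<delta>) \<eta>" "ini (ini z \<delta>) \<eta> = ini z \<eta>"
  using cross_ini[of \<eta> \<delta> \<rho> z] ini_ini_le[of \<eta> \<delta> z] assms by simp_all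

text \<open>The crossing happens at \<eta>, below \<open>ht z\<close>, so every initial segment
  longer than \<eta> has the same crossing and the same cone, while \<open>fv\<close> and the labels
  only decrease.\<close>

lemma cone_part_open:
  "openin X (cone_part F (\<rho>, q, Z) \<inter> {z \<in> T. fv z < r})" (is "openin _ ?W")
  unfolding openin_interval_topology
proof (intro conjI ballI disjI2)
  show "?W \<subseteq> T" by blast
  fix z assume z: "z \<in> ?W"
  then obtain \<eta> where \<eta>: "cross \<rho> z \<eta>" "cone \<eta> (ini z \<eta>) q Z \<inter> F = {}" "Z \<longrightarrow> bts z \<inter> {\<eta>..} = {}"
    by (auto simp: cone_part_def)
  have zT: "z \<in> T" "fv z < r" using z by simp_all
  have "\<eta> < ht z" using \<eta>(1) T_dom[OF zT(1)] unfolding cross_def by blast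
  moreover have "ini z \<delta> \<in> ?W" if "\<eta> < \<delta>" for \<delta>
  proof -
    have "Z \<longrightarrow> bts (ini z \<delta>) \<inter> {\<eta>..} = {}" using \<eta>(3) unfolding bts_ini by blast
    moreover have "fv (ini z \<delta>) < r" using fv_ini_le[of z \<delta>] zT(2) by simp
    ultimately show ?thesis
      using cone_part_ini[OF \<eta>(1) that] \<eta>(2) T_ini[OF zT(1)]
      unfolding cone_part_def by (simp, intro exI[of _ \<eta>]) simp
  qed
  ultimately show "\<exists>\<gamma><ht z. \<forall>\<delta>. \<gamma> < \<delta> \<and> \<delta> \<le> ht z \<longrightarrow>
      ini z \<delta> \<in> ?W" by blast
qed

text \<open>All initial segments of \<open>z\<close> in the set cross \<rho> at the same place by
  \<open>cross_unique\<close>, so the root of the cone cannot vary on the way to \<open>z\<close>.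
  The weak bound on \<open>fv\<close> passes to the limit by continuity.\<close>

lemma cone_part_closed:
  "closedin X (cone_part F (\<rho>, q, Z) \<inter> {z \<in> T. fv z \<le> r})" (is "closedin _ ?W")
proof (rule closedin_T_I)
  show "?W \<subseteq> T" by blast
  fix z assume z: "z \<in> T" "{..<ht z} \<noteq> {}" and cof: "\<And>\<gamma>. \<gamma> < ht z \<Longrightarrow>
    \<exists>\<delta>. \<gamma> < \<delta> \<and> \<delta> < ht z \<and> ini z \<delta> \<in> ?W"
  have near: "\<exists>\<delta> \<eta>. \<gamma> < \<delta> \<and> \<delta> < ht z \<and> \<eta> < \<delta> \<and> cross \<rho> z \<eta> \<and> cone \<eta> (ini z \<eta>) q Z \<inter> F = {} \<and>
      (Z \<longrightarrow> bts (ini z \<delta>) \<inter> {\<eta>..} = {}) \<and> fv (ini z \<delta>) \<le> r" if \<gamma>: "\<gamma> < ht z" for \<gamma>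
  proof -
    obtain \<delta> where \<delta>: "\<gamma> < \<delta>" "\<delta> < ht z" "ini z \<delta> \<in> ?W"
      using cof[OF \<gamma>] by blast
    then obtain \<eta> where \<eta>: "cross \<rho> (ini z \<delta>) \<eta>" "cone \<eta> (ini (ini z \<delta>) \<eta>) q Z \<inter> F = {}"
      "Z \<longrightarrow> bts (ini z \<delta>) \<inter> {\<eta>..} = {}" "fv (ini z \<delta>) \<le> r"
      by (auto simp: cone_part_def)
    have "\<eta> < \<delta>" using \<eta>(1) by (auto simp: cross_def)
    then show ?thesis
      using \<delta>(1,2) \<eta> cross_ini[of \<eta> \<delta> \<rho> z] ini_ini_le[of \<eta> \<delta> z]
      by (intro exI[of _ \<delta>] exI[of _ \<eta>]) simp
  qed
  obtain \<gamma>0 where "\<gamma>0 < ht z" using z(2) by blast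
  then obtain \<eta> \<delta>0 where \<eta>: "\<delta>0 < ht z" "cross \<rho> z \<eta>" "cone \<eta> (ini z \<eta>) q Z \<inter> F = {}" "fv (ini z \<delta>0) \<le> r"
    using near by blast
  have near': "\<exists>\<delta>. \<gamma> < \<delta> \<and> \<delta> < ht z \<and> (Z \<longrightarrow> bts (ini z \<delta>) \<inter> {\<eta>..} = {}) \<and> fv (ini z \<delta>) \<le> r"
    if "\<gamma> < ht z" for \<gamma>
    using near[OF that] cross_unique[OF \<eta>(2)] by metis
  have "fv z \<le> r"
  proof (rule fv_limit_le[OF T_dom[OF z(1)]])
    show "\<exists>\<delta>>\<gamma>. fv (ini z \<delta>) \<le> r" if "\<gamma> < ht z" for \<gamma> using near'[OF that] by blast
    show "0 \<le> r" using \<eta>(4) fv_nonneg[of "ini z \<delta>0"] by linarith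
  qed
  moreover have "bts z \<inter> {\<eta>..} = {}" if Z
  proof (rule ccontr)
    assume "bts z \<inter> {\<eta>..} \<noteq> {}"
    then obtain \<epsilon> where \<epsilon>: "\<epsilon> \<in> bts z" "\<eta> \<le> \<epsilon>" by auto
    then have "\<epsilon> < ht z" using T_dom[OF z(1)] by (auto simp: bts_def)
    then obtain \<delta> where "\<epsilon> < \<delta>" "bts (ini z \<delta>) \<inter> {\<eta>..} = {}" using near' \<open>Z\<close> by blast
    then show False using \<epsilon> by (auto simp: bts_ini)
  qed
  ultimately show "z \<in> ?W"
    using z(1) \<eta>(2,3) unfolding cone_part_def by (simp, intro exI[of _ \<eta>]) simp
qed

text \<open>A node with \<open>fv z \<le> r < q\<close> and without forbidden labels lies in its own
  cone, which misses \<open>F\<close>.\<close>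

lemma cone_part_disjoint:
  assumes "r < q"
  shows "cone_part F (\<rho>, q, Z) \<inter> {z \<in> T. fv z \<le> r} \<inter> F = {}"
proof -
  have False if "z \<in> F" "fv z \<le> r" "cone \<eta> (ini z \<eta>) q Z \<inter> F = {}" "Z \<longrightarrow> bts z \<inter> {\<eta>..} = {}" for z \<eta>
  proof -
    have "z \<in> cone \<eta> (ini z \<eta>) q Z" using that assms by (simp add: cone_def ini_le)
    then show False using that by blast
  qed
  then show ?thesis unfolding cone_part_def by (simp, blast)
qed

text \<open>Between consecutive elements of a club \<open>E\<close> the tree is countable; indexing these countable
  pieces and crossing a rational at the lower end splits the part of the tree off \<open>E\<close> into countably
  many antichains, each of which has a clopen expansion inside any given open set.\<close>

definition piece :: "omega1 set \<Rightarrow> omega1 \<Rightarrow> node set" where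
  "piece E \<eta> = {w \<in> T. last_below E (ht w) \<eta>}"

lemma countable_piece:
  assumes "club E"
  shows "countable (piece E \<eta>)"
proof -
  obtain \<nu> where \<nu>: "\<nu> \<in> E" "\<eta> < \<nu>" using assms unfolding club_def by blast
  have "ht w < \<nu>" if "w \<in> piece E \<eta>" for w
    using that \<nu> unfolding piece_def last_below_def by (auto simp: not_le[symmetric])
  then have "piece E \<eta> \<subseteq> tree_upto G \<nu>" unfolding tree_upto_T piece_def by blast
  moreover have "countable (tree_upto G \<nu>)"
    unfolding tree_upto_def using countable_lessThan_omega1 by simp
  ultimately show ?thesis by (rule countable_subset)
qed

text \<open>The union of the intervals from \<open>max (g z) \<eta>\<close> to \<open>z\<close> over
  those \<open>z\<close> outside \<open>F\<close> that have index \<open>k\<close> in their piece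
  and cross \<rho> at its lower end. These \<open>z\<close> form an antichain: below a common bound
  \<rho> determines \<eta>, and then \<open>k\<close> determines \<open>z\<close>.\<close>

definition antichain_part :: "omega1 set \<Rightarrow> (node \<Rightarrow> omega1) \<Rightarrow> node set \<Rightarrow> nat \<times> real \<Rightarrow> node set" where
  "antichain_part E g F = (\<lambda>(k, \<rho>). {w \<in> T. \<exists>z \<eta>. z \<in> T - F \<and> last_below E (ht z) \<eta> \<and> cross \<rho> z \<eta> \<and>
     to_nat_on (piece E \<eta>) z = k \<and> w \<subseteq>\<^sub>m z \<and> g z < ht w \<and> \<eta> < ht w})"

lemma antichain_partI:
  assumes "w \<in> T" "z \<in> T - F" "last_below E (ht z) \<eta>" "cross \<rho> z \<eta>"
    "to_nat_on (piece E \<eta>) z = k" "w \<subseteq>\<^sub>m z" "g z < ht w" "\<eta> < ht w"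
  shows "w \<in> antichain_part E g F (k, \<rho>)"
  using assms unfolding antichain_part_def by blast

lemma antichain_part_open:
  "openin X (antichain_part E g F (k, \<rho>))" (is "openin _ ?W")
  unfolding openin_interval_topology
proof (intro conjI ballI disjI2)
  show "?W \<subseteq> T" by (auto simp: antichain_part_def)
  fix w assume w: "w \<in> ?W"
  then obtain z \<eta> where z: "z \<in> T - F" "last_below E (ht z) \<eta>" "cross \<rho> z \<eta>"
    "to_nat_on (piece E \<eta>) z = k" "w \<subseteq>\<^sub>m z" "g z < ht w" "\<eta> < ht w"
    unfolding antichain_part_def by blast
  have wT: "w \<in> T" using w by (simp add: antichain_part_def)
  have "ini w \<delta> \<in> ?W" if \<delta>: "max (g z) \<eta> < \<delta>" "\<delta> \<le> ht w" for \<delta>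
  proof -
    have "ini w \<delta> \<subseteq>\<^sub>m z" using ini_le z(5) by (rule map_le_trans)
    moreover have "g z < \<delta>" "\<eta> < \<delta>" using \<delta>(1) by simp_all
    ultimately show ?thesis
      using z(1-4) T_ini[OF wT] ht_ini[OF wT \<delta>(2)] unfolding antichain_part_def by auto
  qed
  then show "\<exists>\<gamma><ht w. \<forall>\<delta>. \<gamma> < \<delta> \<and> \<delta> \<le> ht w \<longrightarrow> ini w \<delta> \<in> ?W"
    using z(6,7) by (intro exI[of _ "max (g z) \<eta>"]) simp
qed

text \<open>At a limit \<open>w\<close> of the set, the witnesses \<open>z\<close> for the initial
  segments of \<open>w\<close> coincide: the crossing happens inside \<open>w\<close>, which fixes
  \<eta> and the piece, and the index fixes \<open>z\<close>. So \<open>w\<close> lies below this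
  \<open>z\<close> as well.\<close>

lemma antichain_part_closed:
  assumes E: "club E"
  shows "closedin X (antichain_part E g F (k, \<rho>))" (is "closedin _ ?W")
proof (rule closedin_T_I)
  show "?W \<subseteq> T" by (auto simp: antichain_part_def)
  fix w assume w: "w \<in> T" "{..<ht w} \<noteq> {}" and cof: "\<And>\<gamma>. \<gamma> < ht w \<Longrightarrow>
    \<exists>\<delta>. \<gamma> < \<delta> \<and> \<delta> < ht w \<and> ini w \<delta> \<in> ?W"
  define near where "near \<delta> z \<eta> \<longleftrightarrow> z \<in> T - F \<and> last_below E (ht z) \<eta> \<and> cross \<rho> z \<eta> \<and>
    to_nat_on (piece E \<eta>) z = k \<and> ini w \<delta> \<subseteq>\<^sub>m z \<and> g z < \<delta> \<and> \<eta> < \<delta>" for \<delta> z \<eta>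
  have near: "\<exists>\<delta> z \<eta>. \<gamma> < \<delta> \<and> \<delta> < ht w \<and> near \<delta> z \<eta>" if \<gamma>: "\<gamma> < ht w" for \<gamma>
  proof -
    obtain \<delta> where \<delta>: "\<gamma> < \<delta>" "\<delta> < ht w" "ini w \<delta> \<in> ?W"
      using cof[OF \<gamma>] by blast
    have "ht (ini w \<delta>) = \<delta>" using ht_ini[OF w(1)] \<delta>(2) by simp
    then show ?thesis using \<delta> unfolding antichain_part_def near_def by auto
  qed
  have cross_w: "cross \<rho> w \<eta>" if "near \<delta> z \<eta>" "\<delta> < ht w" for \<delta> z \<eta>
  proof -
    have "ini z \<delta> = ini w \<delta>"
      using that map_le_iff_ini[OF dom_ini[OF T_dom[OF w(1)] less_imp_le[OF that(2)]]]
      by (simp add: near_def)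
    then show ?thesis
      using that(1) cross_ini[of \<eta> \<delta> \<rho> z] cross_ini[of \<eta> \<delta> \<rho> w] by (simp add: near_def)
  qed
  obtain \<gamma>0 where "\<gamma>0 < ht w" using w(2) by blast
  then obtain \<delta>0 z \<eta> where 0: "\<delta>0 < ht w" "near \<delta>0 z \<eta>" using near by blast
  have same: "z' = z \<and> \<eta>' = \<eta>" if "near \<delta> z' \<eta>'" "\<delta> < ht w" for \<delta> z' \<eta>'
  proof -
    have eq: "\<eta>' = \<eta>" by (rule cross_unique[OF cross_w[OF that] cross_w[OF 0(2,1)]])
    have "z \<in> piece E \<eta>" "z' \<in> piece E \<eta>" "to_nat_on (piece E \<eta>) z' = to_nat_on (piece E \<eta>) z"
      using that 0(2) eq by (simp_all add: near_def piece_def)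
    then show ?thesis using eq inj_on_to_nat_on[OF countable_piece[OF E]] by (simp add: inj_on_def)
  qed
  have "w \<subseteq>\<^sub>m z"
    unfolding map_le_def
  proof
    fix \<gamma> assume "\<gamma> \<in> dom w"
    then have "\<gamma> < ht w" using T_dom[OF w(1)] by blast
    then obtain \<delta> z' \<eta>' where \<delta>: "\<gamma> < \<delta>" "\<delta> < ht w" "near \<delta> z' \<eta>'" using near by blast
    then have "ini w \<delta> \<subseteq>\<^sub>m z" using same by (simp add: near_def)
    moreover have "\<gamma> \<in> dom (ini w \<delta>)" using \<open>\<gamma> \<in> dom w\<close> \<delta>(1) by simp
    ultimately show "w \<gamma> = z \<gamma>" using \<delta>(1) unfolding map_le_def by simp
  qed
  then show "w \<in> ?W"
    using 0 less_trans[OF _ 0(1)] unfolding near_def by (intro antichain_partI[OF w(1)]) blast+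
qed

text \<open>Levels in the club are covered by cones, levels off it by intervals below antichains,
  the root by itself. Cones require different open and closed sets because of the bound on
  \<open>fv\<close>; the other parts are clopen and are paired with themselves.\<close>

lemma complement_refinement:
  assumes F: "closedin X F"
  shows "\<exists>\<W>. countable \<W> \<and> topspace X - F \<subseteq> (\<Union>p\<in>\<W>. fst p) \<and>
    (\<forall>p\<in>\<W>. openin X (fst p) \<and> closedin X (snd p) \<and>
       fst p \<subseteq> snd p \<and> snd p \<inter> F = {})"
proof -
  have FT: "F \<subseteq> T" using closedin_subset[OF F] by (simp add: topspace_T)
  obtain E0 where E0: "club E0" "\<forall>\<alpha>\<in>E0. limit_ord \<alpha> \<and> (\<forall>x\<in>level T \<alpha>.
    limit_or_free \<alpha> F x)"
    using sealing[OF FT] by (elim exE conjE) (rule that)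
  obtain \<zeta> :: omega1 where \<zeta>: "{..<\<zeta>} = {}" using least_omega1 by blast
  define E where "E = insert \<zeta> E0"
  have E: "club E" unfolding E_def by (rule club_insert_least[OF E0(1) \<zeta>])
  \<comment> \<open>The lower end of an interval up to \<open>z\<close> that misses
    \<open>F\<close>; it exists for \<open>z\<close> outside the closed set \<open>F\<close> and
    above the root.\<close>
  define g where "g z = (SOME \<gamma>. \<gamma> < ht z \<and> (\<forall>\<delta>. \<gamma> < \<delta> \<and> \<delta> \<le> ht z \<longrightarrow> ini z \<delta> \<notin> F))" for z
  have g: "g z < ht z \<and> (\<forall>\<delta>. g z < \<delta> \<and> \<delta> \<le> ht z \<longrightarrow> ini z \<delta> \<notin> F)"
    if "z \<in> T - F" "{..<ht z} \<noteq> {}" for z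
    unfolding g_def
    by (rule someI_ex) (use closedin_T_D[OF F _ _ that(2)] that(1) in blast)
  define I1 :: "(real \<times> real \<times> bool \<times> real) set"
    where "I1 = {(\<rho>, q, Z, r). \<rho> \<in> \<rat> \<and> q \<in> \<rat> \<and> r \<in> \<rat> \<and> r < q}"
  define w1 where "w1 = (\<lambda>(\<rho>, q, Z, r). (cone_part F (\<rho>, q, Z) \<inter> {z \<in> T. fv z < r},
    cone_part F (\<rho>, q, Z) \<inter> {z \<in> T. fv z \<le> r}))"
  define w2 where "w2 i = (antichain_part E g F i, antichain_part E g F i)" for i
  define w3 :: "node set" where "w3 = {Map.empty} - F"
  define \<W> where "\<W> = insert (w3, w3) (w1 ` I1 \<union> w2 ` (UNIV \<times> \<rat>))"
  have "countable I1"
  proof -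
    have "countable (\<rat> \<times> \<rat> \<times> (UNIV :: bool set) \<times> (\<rat> :: real set) :: (real \<times> real \<times> bool \<times> real) set)"
      by (intro countable_SIGMA countable_rat) simp_all
    moreover have "I1 \<subseteq> \<rat> \<times> \<rat> \<times> UNIV \<times> \<rat>" by (auto simp: I1_def)
    ultimately show ?thesis using countable_subset by blast
  qed
  moreover have "countable (w2 ` (UNIV \<times> \<rat>))" by (intro countable_image countable_SIGMA countable_rat) simp
  ultimately have "countable \<W>" unfolding \<W>_def by simp
  moreover have "openin X (fst p) \<and> closedin X (snd p) \<and>
      fst p \<subseteq> snd p \<and> snd p \<inter> F = {}" if p: "p \<in> \<W>" for p
  proof -
    consider "p = (w3, w3)" | \<rho> q Z r where "p = w1 (\<rho>, q, Z, r)" "r < q" | k \<rho> where "p = w2 (k, \<rho>)"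
      using p unfolding \<W>_def I1_def by auto
    then show ?thesis
    proof cases
      case 1
      have h: "{..<ht (Map.empty :: node)} = {}" using T_dom[OF Map_empty_in_T, symmetric] by simp
      have "w3 \<subseteq> T" using Map_empty_in_T by (auto simp: w3_def)
      moreover have "{..<ht z} = {}" if "z \<in> w3" for z using that h by (auto simp: w3_def)
      ultimately have "openin X w3" unfolding openin_interval_topology by simp
      moreover have "closedin X w3"
      proof (rule closedin_T_I[OF \<open>w3 \<subseteq> T\<close>])
        fix z assume z: "z \<in> T" "{..<ht z} \<noteq> {}"
          and cof: "\<And>\<gamma>. \<gamma> < ht z \<Longrightarrow> \<exists>\<delta>. \<gamma> < \<delta> \<and> \<delta> < ht z \<and> ini z \<delta> \<in> w3"
        obtain \<gamma> where "\<gamma> < ht z" using z(2) by blast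
        then obtain \<delta> where \<delta>: "\<gamma> < \<delta>" "\<delta> < ht z" "ini z \<delta> = Map.empty"
          using cof unfolding w3_def by blast
        then have "{..<\<delta>} = {}" using dom_ini[OF T_dom[OF z(1)] less_imp_le[OF \<delta>(2)]] by simp
        then show "z \<in> w3" using \<delta>(1) by blast
      qed
      moreover have "w3 \<inter> F = {}" by (auto simp: w3_def)
      ultimately show ?thesis using 1 by simp
    next
      case 2
      then have "p = (cone_part F (\<rho>, q, Z) \<inter> {z \<in> T. fv z < r},
        cone_part F (\<rho>, q, Z) \<inter> {z \<in> T. fv z \<le> r})" by (simp add: w1_def)
      then show ?thesis
        using cone_part_open[of F \<rho> q Z r] cone_part_closed[of F \<rho> q Z r]
          cone_part_disjoint[OF 2(2), of F \<rho> Z]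
        by auto
    next
      case 3
      have "w \<notin> F" if w: "w \<in> antichain_part E g F (k, \<rho>)" for w
      proof -
        obtain z where z: "z \<in> T - F" "w \<subseteq>\<^sub>m z" "g z < ht w" "w \<in> T"
          using w unfolding antichain_part_def by blast
        have le: "ht w \<le> ht z" using ht_mono z by blast
        then have "g z < ht z" using z(3) by simp
        then have "{..<ht z} \<noteq> {}" by blast
        then have "ini z (ht w) \<notin> F" using g[OF z(1)] z(3) le by blast
        then show ?thesis using le_T_eq[OF z(4,2)] by simp
      qed
      then show ?thesis
        using 3 antichain_part_open antichain_part_closed[OF E] unfolding w2_def by auto
    qed
  qed
  moreover have "z \<in> (\<Union>p\<in>\<W>. fst p)" if z: "z \<in> T - F" for z
  proof -
    have zT: "z \<in> T" using z by blast
    consider "{..<ht z} = {}" | "{..<ht z} \<noteq> {}" "ht z \<in> E0" | "{..<ht z} \<noteq> {}" "ht z \<notin> E"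
      using \<zeta> unfolding E_def by blast
    then show ?thesis
    proof cases
      case 1
      then have "z \<in> w3" using T_root[OF zT] z by (simp add: w3_def)
      then show ?thesis by (simp add: \<W>_def)
    next
      case 2
      obtain \<gamma> where \<gamma>: "\<gamma> < ht z" "\<forall>\<delta>. \<gamma> < \<delta> \<and> \<delta> \<le> ht z \<longrightarrow> ini z \<delta> \<notin> F"
        using g[OF z 2(1)] by blast
      have lim: "limit_ord (ht z)" using E0(2) 2(2) by blast
      obtain \<gamma>' where \<gamma>': "\<gamma> < \<gamma>'" "\<gamma>' < ht z" using limit_ord_between[OF lim \<gamma>(1)] by blast
      \<comment> \<open>As \<open>F\<close> is closed, \<open>z\<close> is not a limit of
        \<open>F\<close>, and only the second alternative of \<open>limit_or_free\<close> is left.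
        Moving from \<gamma> up to \<open>\<gamma>'\<close> accounts for the weak inequality in the
        first.\<close>
      have "\<not> (\<exists>\<epsilon>. \<gamma>' \<le> \<epsilon> \<and> \<epsilon> < ht z \<and> ini z \<epsilon> \<in> F)"
        using \<gamma>(2) \<gamma>'(1) by (meson less_imp_le less_le_trans)
      then have "\<exists>\<eta> q Z. \<eta> < ht z \<and> q \<in> \<rat> \<and> fv z < q \<and> (Z \<longrightarrow> bts z \<inter> {\<eta>..} = {}) \<and>
          cone \<eta> (ini z \<eta>) q Z \<inter> F = {}"
        using E0(2)[rule_format, OF 2(2), THEN conjunct2, rule_format, OF T_level[OF zT]] \<gamma>'(2)
        by blast
      then obtain \<eta> q Z where \<eta>: "\<eta> < ht z" "q \<in> \<rat>" "fv z < q" "Z \<longrightarrow> bts z \<inter> {\<eta>..} = {}"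
        "cone \<eta> (ini z \<eta>) q Z \<inter> F = {}" by blast
      have "\<eta> \<in> dom z" using T_dom[OF zT] \<eta>(1) by simp
      then obtain \<rho> where \<rho>: "\<rho> \<in> \<rat>" "cross \<rho> z \<eta>"
        using cross_exists[OF T_increasing[OF zT]] by blast
      \<comment> \<open>A margin: the open set asks for \<open>fv\<close> below \<open>r\<close>,
        the closed one for at most \<open>r\<close>, and both stay below the bound of the
        cone.\<close>
      obtain r where r: "r \<in> \<rat>" "fv z < r" "r < q" using Rats_dense_in_real[OF \<eta>(3)] by blast
      have "z \<in> cone_part F (\<rho>, q, Z)" using zT \<rho>(2) \<eta>(4,5) unfolding cone_part_def by auto
      then have "z \<in> fst (w1 (\<rho>, q, Z, r))" using r(2) zT by (simp add: w1_def)
      moreover have "(\<rho>, q, Z, r) \<in> I1" using \<rho>(1) \<eta>(2) r by (simp add: I1_def)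
      ultimately show ?thesis unfolding \<W>_def by blast
    next
      case 3
      obtain \<eta> where \<eta>: "last_below E (ht z) \<eta>"
        using last_below_exists[OF E _ \<zeta> 3(2)] unfolding E_def by blast
      then have "\<eta> < ht z" by (simp add: last_below_def)
      then have "\<eta> \<in> dom z" using T_dom[OF zT] by simp
      then obtain \<rho> where \<rho>: "\<rho> \<in> \<rat>" "cross \<rho> z \<eta>"
        using cross_exists[OF T_increasing[OF zT]] by blast
      define k where "k = to_nat_on (piece E \<eta>) z"
      have "g z < ht z" using g[OF z 3(1)] by blast
      then have "z \<in> antichain_part E g F (k, \<rho>)"
        by (rule antichain_partI[OF zT z \<eta> \<rho>(2) k_def[symmetric] map_le_refl _ \<open>\<eta> < ht z\<close>])
      then have "z \<in> fst (w2 (k, \<rho>))" by (simp add: w2_def)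
      moreover have "(k, \<rho>) \<in> UNIV \<times> \<rat>" using \<rho>(1) by simp
      ultimately show ?thesis unfolding \<W>_def by blast
    qed
  qed
  then have "topspace X - F \<subseteq> (\<Union>p\<in>\<W>. fst p)" by (auto simp: topspace_T)
  ultimately show ?thesis by blast
qed

lemma perfectly_normal_T: "perfectly_normal_space X"
  by (rule perfectly_normal_spaceI[OF t1_space_T complement_refinement])

end

subsection \<open>The square\<close>

text \<open>One half of Ishikawa's characterization of countable metacompactness.\<close>

lemma countably_metacompact_expansion:
  fixes F :: "nat \<Rightarrow> 'a set"
  assumes cmc: "countably_metacompact X" and F: "\<And>n. closedin X (F n)" and dec: "\<And>m n. m \<le> n \<Longrightarrow> F n \<subseteq> F m"
    and empty: "(\<Inter>n. F n) = {}"
  shows "\<exists>U. (\<forall>n. openin X (U n) \<and> F n \<subseteq> U n) \<and> (\<forall>m n. m \<le> n \<longrightarrow> U n \<subseteq> U m) \<and> (\<Inter>n. U n) = {}"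
proof -
  define \<U> where "\<U> = range (\<lambda>n. topspace X - F n)"
  have "\<Union>\<U> = topspace X"
  proof
    show "\<Union>\<U> \<subseteq> topspace X" by (auto simp: \<U>_def)
    show "topspace X \<subseteq> \<Union>\<U>"
    proof
      fix x assume x: "x \<in> topspace X"
      obtain n where "x \<notin> F n" using empty by blast
      then show "x \<in> \<Union>\<U>" using x by (auto simp: \<U>_def)
    qed
  qed
  moreover have "openin X V" if "V \<in> \<U>" for V using that F by (auto simp: \<U>_def)
  ultimately have "countable \<U> \<and> open_cover X \<U>" by (simp add: open_cover_def \<U>_def)
  from cmc[unfolded countably_metacompact_def, rule_format, OF this]
  obtain \<V> where \<V>: "open_cover X \<V>" "\<forall>V\<in>\<V>. \<exists>U\<in>\<U>. V \<subseteq> U" "point_finite X \<V>"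
    by (elim exE conjE) (rule that)
  define U where "U n = \<Union>{V \<in> \<V>. V \<inter> F n \<noteq> {}}" for n
  have "openin X (U n)" for n
    unfolding U_def using \<V>(1) by (intro openin_Union) (simp add: open_cover_def)
  moreover have "F n \<subseteq> U n" for n
  proof
    fix x assume x: "x \<in> F n"
    then have "x \<in> \<Union>\<V>" using closedin_subset[OF F] \<V>(1) unfolding open_cover_def by blast
    then show "x \<in> U n" using x by (auto simp: U_def)
  qed
  moreover have "U n \<subseteq> U m" if "m \<le> n" for m n using dec[OF that] unfolding U_def by blast
  moreover have "(\<Inter>n. U n) = {}"
  proof (rule equals0I)
    fix x assume x: "x \<in> (\<Inter>n. U n)"
    then have "x \<in> U 0" by blast
    then have "x \<in> topspace X" using \<V>(1) by (auto simp: U_def open_cover_def)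
    then have fin: "finite {V \<in> \<V>. x \<in> V}" using \<V>(3) by (simp add: point_finite_def)
    have "\<exists>k. V \<inter> F k = {}" if V: "V \<in> \<V>" for V
    proof -
      obtain W where "W \<in> \<U>" "V \<subseteq> W" using \<V>(2) V by blast
      then show ?thesis by (auto simp: \<U>_def)
    qed
    then obtain k where k: "\<And>V. V \<in> \<V> \<Longrightarrow> V \<inter> F (k V) = {}" by metis
    \<comment> \<open>Each member of the refinement lies in the complement of some
      \<open>F k\<close>. Past the largest such index none of the finitely many members containing
      \<open>x\<close> meets \<open>F n\<close>, so \<open>x\<close> is not in
      \<open>U n\<close>.\<close>
    define n where "n = Max (k ` {V \<in> \<V>. x \<in> V})"
    have "x \<in> U n" using x by blast
    then obtain V where V: "V \<in> \<V>" "x \<in> V" "V \<inter> F n \<noteq> {}" unfolding U_def by blast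
    then have "k V \<le> n" unfolding n_def using fin by (intro Max_ge) auto
    then show False using V(1,3) k dec by blast
  qed
  ultimately show ?thesis by (intro exI[of _ U] conjI allI impI) simp_all
qed

section \<open>The coloured antichain and its closed sets\<close>

context constructed_tree
begin

definition col :: "omega1 \<Rightarrow> nat option" where "col \<alpha> = snd (G \<alpha>)"

definition A :: "(node \<times> node) set" where
  "A = {(N \<alpha> 0, N \<alpha> 1) | \<alpha>. col \<alpha> \<noteq> None}"

definition F :: "nat \<Rightarrow> (node \<times> node) set" where
  "F n = {(N \<alpha> 0, N \<alpha> 1) | \<alpha>. \<exists>m\<ge>n. col \<alpha> = Some m}"

lemma pairs_upto_A: "pairs_upto G \<alpha> = {(N \<beta> 0, N \<beta> 1) | \<beta>. \<beta> < \<alpha> \<and> col \<beta> \<noteq> None}"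
  unfolding pairs_upto_def N_def[symmetric] col_def[symmetric] by blast

lemma pairs_upto_subset_A: "pairs_upto G \<alpha> \<subseteq> A"
  unfolding pairs_upto_A A_def by blast

lemma F_subset_A: "F n \<subseteq> A"
  unfolding F_def A_def by auto

text \<open>No member of \<open>A\<close> is higher than the nodes it lies below, and at height
  \<alpha> the only candidate is the pair of that level, which is absent if the level is uncoloured.
  The second case serves the pair that is to lie in all \<open>U n\<close>.\<close>

lemma notabove_upto:
  assumes s: "s \<in> T" and ht: "ht s < \<alpha> \<or> ht s = \<alpha> \<and> col \<alpha> = None"
  shows "notabove (pairs_upto G \<alpha>) s t \<longleftrightarrow> notabove A s t"
proof
  assume *: "notabove (pairs_upto G \<alpha>) s t"
  show "notabove A s t"
    unfolding notabove_def
  proof (intro allI impI notI, elim conjE)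
    fix a b assume ab: "(a, b) \<in> A" "a \<subseteq>\<^sub>m s" "b \<subseteq>\<^sub>m t"
    then obtain \<beta> where \<beta>: "a = N \<beta> 0" "b = N \<beta> 1" "col \<beta> \<noteq> None" by (auto simp: A_def)
    have "\<beta> \<le> ht s" using ht_mono[OF N_in_T s] ab(2) \<beta>(1) ht_N by metis
    then have "\<beta> < \<alpha>" using ht \<beta>(3) by (auto simp: le_less)
    then have "(a, b) \<in> pairs_upto G \<alpha>" using \<beta> unfolding pairs_upto_A by blast
    then show False using * ab(2,3) unfolding notabove_def by blast
  qed
next
  assume "notabove A s t"
  then show "notabove (pairs_upto G \<alpha>) s t"
    using pairs_upto_subset_A unfolding notabove_def by blast
qed

lemma level_upto: "\<beta> < \<alpha> \<Longrightarrow> level (tree_upto G \<alpha>) \<beta> = level T \<beta>"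
  using level_tree_upto[of \<alpha> G \<beta>] stage_N(1) unfolding level_T N_def by blast

lemma cnd_upto:
  assumes "\<gamma> < \<alpha>"
  shows "cnd (tree_upto G \<alpha>) (pairs_upto G \<alpha>) \<gamma> s t q \<longleftrightarrow> cnd T A \<gamma> s t q"
proof -
  have "notabove (pairs_upto G \<alpha>) s t \<longleftrightarrow> notabove A s t" if "s \<in> level T \<gamma>"
    using notabove_upto[of s \<alpha> t] levelD[OF that] assms by (simp add: ht_eq)
  then show ?thesis unfolding cnd_def level_upto[OF assms] by blast
qed

lemma reach_upto: "reach (tree_upto G \<alpha>) (pairs_upto G \<alpha>) s t q = {p \<in> reach T A s t q. ht (fst p) < \<alpha>}"
proof -
  have "p \<in> reach (tree_upto G \<alpha>) (pairs_upto G \<alpha>) s t q \<longleftrightarrow> p \<in> reach T A s t q \<and> ht (fst p) < \<alpha>" for p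
  proof -
    obtain x y where p: "p = (x, y)" by (cases p)
    have "ht x = ht y" if "dom x = dom y" unfolding ht_def that ..
    then show ?thesis
      using notabove_upto[of x \<alpha> y] unfolding reach_def tree_upto_T p by auto
  qed
  then show ?thesis by blast
qed

text \<open>Members below a common pair are comparable in both coordinates, and the higher one was
  chosen \<open>notabove\<close> all lower ones.\<close>

lemma A_antichain:
  assumes "(x, y) \<in> A" "(x', y') \<in> A" "x \<subseteq>\<^sub>m s" "y \<subseteq>\<^sub>m t" "x' \<subseteq>\<^sub>m s" "y' \<subseteq>\<^sub>m t"
  shows "(x, y) = (x', y')"
proof -
  have False if \<beta>: "\<beta> < \<beta>'" "col \<beta> \<noteq> None" "col \<beta>' \<noteq> None"
    and le: "N \<beta> 0 \<subseteq>\<^sub>m s" "N \<beta> 1 \<subseteq>\<^sub>m t" "N \<beta>' 0 \<subseteq>\<^sub>m s" "N \<beta>' 1 \<subseteq>\<^sub>m t" for \<beta> \<beta>'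
  proof -
    have "N \<beta> 0 \<subseteq>\<^sub>m N \<beta>' 0" "N \<beta> 1 \<subseteq>\<^sub>m N \<beta>' 1"
      using map_le_comparable[OF le(1,3) stage_N(1) stage_N(1) less_imp_le[OF \<beta>(1)]]
        map_le_comparable[OF le(2,4) stage_N(1) stage_N(1) less_imp_le[OF \<beta>(1)]] by simp_all
    moreover have "(N \<beta> 0, N \<beta> 1) \<in> pairs_upto G \<beta>'" using \<beta>(1,2) unfolding pairs_upto_A by blast
    moreover have "notabove (pairs_upto G \<beta>') (N \<beta>' 0) (N \<beta>' 1)"
      using stage_N(6) \<beta>(3) unfolding col_def by blast
    ultimately show False unfolding notabove_def by blast
  qed
  then show ?thesis using assms unfolding A_def by (smt (verit) linorder_neqE mem_Collect_eq prod.inject)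
qed

lemma open_below: "s \<in> T \<Longrightarrow> openin X {z \<in> T. z \<subseteq>\<^sub>m s}"
  unfolding openin_interval_topology
proof (intro conjI ballI)
  fix z assume z: "z \<in> {z \<in> T. z \<subseteq>\<^sub>m s}"
  have "ini z \<delta> \<in> {z \<in> T. z \<subseteq>\<^sub>m s}" for \<delta>
    using z T_ini map_le_trans[OF ini_le] by simp
  then show "{..<ht z} = {} \<or> (\<exists>\<gamma><ht z. \<forall>\<delta>. \<gamma> < \<delta> \<and> \<delta> \<le> ht z \<longrightarrow> ini z \<delta> \<in> {z \<in> T. z \<subseteq>\<^sub>m s})"
    by blast
qed blast

abbreviation X2 :: "(node \<times> node) topology" where
  "X2 \<equiv> prod_topology X X"

text \<open>The rectangle of all predecessors of \<open>s\<close> and \<open>t\<close> is open and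
  contains at most one member of \<open>F n\<close>. That member differs from \<open>(s, t)\<close>
  in some coordinate, where a single point can be removed.\<close>

lemma closedin_F: "closedin X2 (F n)"
  unfolding closedin_def
proof
  have "A \<subseteq> T \<times> T" using N_in_T unfolding A_def by blast
  then show "F n \<subseteq> topspace X2" using F_subset_A[of n] by (simp add: topspace_T)
  show "openin X2 (topspace X2 - F n)"
    unfolding openin_prod_topology_alt
  proof (intro allI impI)
    fix s t assume st: "(s, t) \<in> topspace X2 - F n"
    then have sT: "s \<in> T" "t \<in> T" "(s, t) \<notin> F n" by (simp_all add: topspace_T)
    define V where "V u = {z \<in> T. z \<subseteq>\<^sub>m u}" for u
    have V: "openin X (V s)" "openin X (V t)" "s \<in> V s" "t \<in> V t"
      unfolding V_def using open_below sT by simp_all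
    have VT: "V u \<subseteq> T" for u by (auto simp: V_def)
    have sing: "closedin X {x}" if "x \<in> T" for x
      using t1_space_T that unfolding t1_space_closedin_singleton topspace_T by blast
    show "\<exists>U W. openin X U \<and> openin X W \<and> s \<in> U \<and> t \<in> W \<and>
        U \<times> W \<subseteq> topspace X2 - F n"
    proof (cases "V s \<times> V t \<inter> F n = {}")
      case True
      then have "V s \<times> V t \<subseteq> topspace X2 - F n" using VT[of s] VT[of t] by (simp add: topspace_T) blast
      then show ?thesis using V by blast
    next
      case False
      then obtain x y where xy: "(x, y) \<in> F n" "x \<in> V s" "y \<in> V t" by blast
      have only: "(x', y') = (x, y)" if "(x', y') \<in> F n" "x' \<in> V s" "y' \<in> V t" for x' y'
        using A_antichain[of x' y' x y s t] that xy F_subset_A[of n] unfolding V_def by blast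
      have "x \<noteq> s \<or> y \<noteq> t" using xy(1) sT(3) by blast
      then show ?thesis
      proof
        assume "x \<noteq> s"
        have "openin X (V s - {x})"
          using V(1) sing xy(2) VT by (intro openin_diff) auto
        moreover have "(V s - {x}) \<times> V t \<subseteq> topspace X2 - F n"
          using only VT by (fastforce simp: topspace_T)
        ultimately show ?thesis using V \<open>x \<noteq> s\<close> by blast
      next
        assume "y \<noteq> t"
        have "openin X (V t - {y})"
          using V(2) sing xy(3) VT by (intro openin_diff) auto
        moreover have "V s \<times> (V t - {y}) \<subseteq> topspace X2 - F n"
          using only VT by (fastforce simp: topspace_T)
        ultimately show ?thesis using V \<open>y \<noteq> t\<close> by blast
      qed
    qed
  qed
qed

text \<open>A pair determines its level, and a level has at most one colour.\<close>

lemma F_empty: "(\<Inter>n. F n) = {}"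
proof -
  have "p \<notin> (\<Inter>n. F n)" for p
  proof
    assume p: "p \<in> (\<Inter>n. F n)"
    then have "p \<in> F 0" by blast
    then obtain \<alpha> m where \<alpha>: "p = (N \<alpha> 0, N \<alpha> 1)" "col \<alpha> = Some m" by (auto simp: F_def)
    have "p \<in> F (Suc m)" using p by blast
    then obtain \<beta> k where \<beta>: "p = (N \<beta> 0, N \<beta> 1)" "col \<beta> = Some k" "Suc m \<le> k" by (auto simp: F_def)
    have "\<alpha> = \<beta>" using \<alpha>(1) \<beta>(1) ht_N by (metis prod.inject)
    then show False using \<alpha>(2) \<beta>(2,3) by simp
  qed
  then show ?thesis by blast
qed

section \<open>Predicted open sets and reflection\<close>

lemma guess_pairs_correct:
  assumes "{(\<beta>, n). \<exists>k i j. n = to_nat (k, i, j) \<and> (N \<beta> i, N \<beta> j) \<in> U k} \<inter> ({..<\<alpha>} \<times> UNIV) = \<Omega> \<alpha>"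
    and p: "s \<in> T" "t \<in> T" "ht s = ht t" "ht s < \<alpha>"
  shows "(s, t) \<in> guess_pairs \<Omega> G \<alpha> k \<longleftrightarrow> (s, t) \<in> U k"
proof -
  have code: "(\<beta>, to_nat (k, i, j)) \<in> \<Omega> \<alpha> \<longleftrightarrow> (N \<beta> i, N \<beta> j) \<in> U k" if "\<beta> < \<alpha>" for \<beta> i j
    unfolding assms(1)[symmetric] using that by auto
  obtain \<beta> i where s: "s = N \<beta> i" using p(1) by (rule T_cases)
  obtain \<beta>' j where t: "t = N \<beta>' j" using p(2) by (rule T_cases)
  have eq: "\<beta>' = \<beta>" "\<beta> < \<alpha>" using p(3,4) s t by simp_all
  show ?thesis
  proof
    assume "(s, t) \<in> guess_pairs \<Omega> G \<alpha> k"
    then obtain \<gamma> i' j' where "(s, t) = (N \<gamma> i', N \<gamma> j')" "\<gamma> < \<alpha>" "(\<gamma>, to_nat (k, i', j')) \<in> \<Omega> \<alpha>"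
      unfolding guess_pairs_def N_def by blast
    then show "(s, t) \<in> U k" using code by simp
  next
    assume "(s, t) \<in> U k"
    then have "(\<beta>, to_nat (k, i, j)) \<in> \<Omega> \<alpha>" using code[OF eq(2)] s t eq(1) by simp
    then show "(s, t) \<in> guess_pairs \<Omega> G \<alpha> k"
      unfolding guess_pairs_def N_def[symmetric] s t eq(1) using eq(2) by blast
  qed
qed

abbreviation forces_into :: "(node \<times> node) set \<Rightarrow> node \<Rightarrow> node \<Rightarrow> real \<Rightarrow> omega1 \<Rightarrow> bool" where
  "forces_into V s t q \<gamma>' \<equiv> \<exists>s' t' q'. cnd T A \<gamma>' s' t' q' \<and> s \<subseteq>\<^sub>m s' \<and> t \<subseteq>\<^sub>m t' \<and> q' \<le> q \<and>
     reach T A s' t' q' \<subseteq> V"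

text \<open>Closure of \<beta> under two kinds of witnesses: pairs showing that a condition does not
  yet force into \<open>U k\<close>, and stronger conditions that do.\<close>

definition reflecting :: "(nat \<Rightarrow> (node \<times> node) set) \<Rightarrow> omega1 \<Rightarrow> bool" where
  "reflecting U \<beta> \<longleftrightarrow> (\<forall>\<gamma><\<beta>. \<forall>s t q k. cnd T A \<gamma> s t q \<longrightarrow>
     (\<not> reach T A s t q \<subseteq> U k \<longrightarrow> (\<exists>s' t'. (s', t') \<in> reach T A s t q \<and> (s', t') \<notin> U k \<and> ht s' < \<beta>)) \<and>
     ((\<exists>\<gamma>'. forces_into (U k) s t q \<gamma>') \<longrightarrow>
      (\<exists>\<gamma>'<\<beta>. forces_into (U k) s t q \<gamma>')))"

lemma club_reflecting: "\<exists>K. club K \<and> (\<forall>\<beta>\<in>K. reflecting U \<beta>)"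
proof -
  define P1 where "P1 = (\<lambda>(s, t, q, k) p. p \<in> reach T A s t q \<and> p \<notin> U k)"
  define P2 where "P2 = (\<lambda>(s, t, q, k) \<gamma>'. forces_into (U k) s t q \<gamma>')"
  define h1 where "h1 x = ht (fst (SOME p. P1 x p))" for x
  define h2 where "h2 x = (SOME \<gamma>. P2 x \<gamma>)" for x
  define S where "S \<gamma> = range (N \<gamma>) \<times> range (N \<gamma>) \<times> (\<rat> :: real set) \<times> (UNIV :: nat set)" for \<gamma>
  have S: "countable (S \<gamma>)" for \<gamma> unfolding S_def by (intro countable_SIGMA countable_rat) simp_all
  define K where "K = {\<beta>. \<forall>\<gamma><\<beta>. \<forall>x\<in>S \<gamma>. h1 x < \<beta>} \<inter> {\<beta>. \<forall>\<gamma><\<beta>. \<forall>x\<in>S \<gamma>. h2 x < \<beta>}"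
  have "club K" unfolding K_def by (intro club_Int club_closure_points S)
  moreover have "reflecting U \<beta>" if "\<beta> \<in> K" for \<beta>
    unfolding reflecting_def
  proof (intro allI impI conjI)
    fix \<gamma> s t q k assume \<gamma>: "\<gamma> < \<beta>" and c: "cnd T A \<gamma> s t q"
    have "(s, t, q, k) \<in> S \<gamma>" using c unfolding S_def cnd_def level_T by blast
    then have h: "h1 (s, t, q, k) < \<beta>" "h2 (s, t, q, k) < \<beta>" using \<open>\<beta> \<in> K\<close> \<gamma> unfolding K_def by blast+
    { assume "\<not> reach T A s t q \<subseteq> U k"
      then have "\<exists>p. P1 (s, t, q, k) p" by (auto simp: P1_def)
      then have "P1 (s, t, q, k) (SOME p. P1 (s, t, q, k) p)" by (rule someI_ex)
      moreover obtain s' t' where p: "(SOME p. P1 (s, t, q, k) p) = (s', t')" by (metis surj_pair)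
      ultimately have "P1 (s, t, q, k) (s', t')" "ht s' < \<beta>" using h(1) by (simp_all add: h1_def)
      then show "\<exists>s' t'. (s', t') \<in> reach T A s t q \<and> (s', t') \<notin> U k \<and> ht s' < \<beta>"
        unfolding P1_def by auto }
    { assume "\<exists>\<gamma>'. forces_into (U k) s t q \<gamma>'"
      then have "\<exists>\<gamma>'. P2 (s, t, q, k) \<gamma>'" by (simp add: P2_def)
      then have "P2 (s, t, q, k) (h2 (s, t, q, k))" unfolding h2_def by (rule someI_ex)
      then show "\<exists>\<gamma>'<\<beta>. forces_into (U k) s t q \<gamma>'"
        using h(2) by (intro exI[of _ "h2 (s, t, q, k)"]) (simp add: P2_def) }
  qed
  ultimately show ?thesis by blast
qed

lemma reachD:
  assumes "(s', t') \<in> reach T A s t q"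
  shows "s' \<in> T" "t' \<in> T" "ht s' = ht t'" "s \<subseteq>\<^sub>m s'" "t \<subseteq>\<^sub>m t'"
    "q \<in> \<rat> \<Longrightarrow> cnd T A (ht s') s' t' q"
proof -
  have *: "s' \<in> T" "t' \<in> T" "dom s' = dom t'" "s \<subseteq>\<^sub>m s'" "t \<subseteq>\<^sub>m t'" "fv s' < q" "fv t' < q" "notabove A s' t'"
    using assms by (simp_all add: reach_def)
  then show "s' \<in> T" "t' \<in> T" "s \<subseteq>\<^sub>m s'" "t \<subseteq>\<^sub>m t'" by simp_all
  show ht: "ht s' = ht t'" unfolding ht_def *(3) ..
  then show "cnd T A (ht s') s' t' q" if "q \<in> \<rat>"
    using * that T_level[of s'] T_level[of t'] by (simp add: cnd_def)
qed

text \<open>Everything happens at one level \<alpha> at which the whole sequence \<open>U\<close> is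
  predicted. The prediction agrees with \<open>U\<close> on pairs of equal height below \<alpha>;
  pairs of other heights are never tested.\<close>

lemma expansion_meets:
  assumes U: "\<And>n. openin X2 (U n)" "\<And>n. F n \<subseteq> U n" "\<And>m n. m \<le> n \<Longrightarrow> U n \<subseteq> U m"
  shows "(\<Inter>n. U n) \<noteq> {}"
proof -
  obtain K where K: "club K" "\<And>\<beta>. \<beta> \<in> K \<Longrightarrow> reflecting U \<beta>" using club_reflecting[of U] by blast
  obtain E where E: "club E" "\<forall>\<alpha>\<in>E. acc_of (C \<alpha> \<inter> K) \<alpha>"
    using hit[OF club_uncountable[OF K(1)]] by (elim exE conjE) (rule that)
  define B where "B = {(\<beta>, n). \<exists>k i j. n = to_nat (k, i, j) \<and> (N \<beta> i, N \<beta> j) \<in> U k}"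
  \<comment> \<open>Membership in \<open>E\<close> makes the ladder of \<alpha> meet
    \<open>K\<close> cofinally, which provides ready ladder points. Membership of \<alpha> itself in
    \<open>K\<close> lifts inclusions from pairs below \<alpha> to all pairs.\<close>
  obtain \<alpha> where \<alpha>: "B \<inter> ({..<\<alpha>} \<times> UNIV) = \<Omega> \<alpha>" "\<alpha> \<in> E" "\<alpha> \<in> K"
    using predict[of B] club_Int[OF E(1) K(1)] unfolding stationary_def by blast
  have acc: "acc_of (C \<alpha> \<inter> K) \<alpha>" using E(2) \<alpha>(2) by blast
  have lim: "limit_ord \<alpha>" by (rule acc_of_limit[OF acc])
  define TT AA UU where "TT = tree_upto G \<alpha>" and "AA = pairs_upto G \<alpha>" and "UU = guess_pairs \<Omega> G \<alpha>"
  define b c where "b = N \<alpha> 0" and "c = N \<alpha> 1"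
  have UU: "(s, t) \<in> UU k \<longleftrightarrow> (s, t) \<in> U k" if "s \<in> T" "t \<in> T" "ht s = ht t" "ht s < \<alpha>" for s t k
    unfolding UU_def by (rule guess_pairs_correct[OF \<alpha>(1)[unfolded B_def] that])
  have st: "if \<exists>k. dense TT AA (C \<alpha>) \<alpha> (avoids (UU k))
    then \<exists>k. col \<alpha> = Some k \<and> (\<forall>\<gamma><\<alpha>. \<exists>\<epsilon>. \<gamma> \<le> \<epsilon> \<and> \<epsilon> < \<alpha> \<and> (ini b \<epsilon>, ini c \<epsilon>) \<notin> UU k)
    else col \<alpha> = None \<and> (dense TT AA (C \<alpha>) \<alpha> (enters TT AA UU) \<longrightarrow> notabove AA b c \<and>
      (\<forall>k. \<exists>\<epsilon> r. \<epsilon> < \<alpha> \<and> fv b < r \<and> fv c < r \<and> cnd TT AA \<epsilon> (ini b \<epsilon>) (ini c \<epsilon>) r \<and>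
         reach TT AA (ini b \<epsilon>) (ini c \<epsilon>) r \<subseteq> UU k))"
    using G[of \<alpha>] lim unfolding stage_rec_def stage_def TT_def AA_def UU_def b_def c_def col_def N_def
    by blast
  have cnd_TT: "cnd TT AA \<gamma> s t q \<longleftrightarrow> cnd T A \<gamma> s t q" if "\<gamma> < \<alpha>" for \<gamma> s t q
    unfolding TT_def AA_def by (rule cnd_upto[OF that])
  have reach_TT: "reach TT AA s t q = {p \<in> reach T A s t q. ht (fst p) < \<alpha>}" for s t q
    unfolding TT_def AA_def by (rule reach_upto)
  have ladder_K: "\<exists>\<beta>\<in>C \<alpha>. \<gamma> < \<beta> \<and> \<beta> < \<alpha> \<and> reflecting U \<beta>" if "\<gamma> < \<alpha>" for \<gamma>
    using acc that K(2) unfolding acc_of_def by blast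
  have bc: "b \<in> T" "c \<in> T" "ht b = \<alpha>" "ht c = \<alpha>" by (simp_all add: b_def c_def N_in_T)
  show ?thesis
  proof (cases "\<exists>k. dense TT AA (C \<alpha>) \<alpha> (avoids (UU k))")
    case True
    then obtain k where k: "col \<alpha> = Some k" "\<And>\<gamma>. \<gamma> < \<alpha> \<Longrightarrow> \<exists>\<epsilon>. \<gamma> \<le> \<epsilon> \<and> \<epsilon> < \<alpha> \<and> (ini b \<epsilon>, ini c \<epsilon>) \<notin> UU k"
      using st by auto
    have "(b, c) \<in> F k" using k(1) unfolding F_def b_def c_def by blast
    then have "(b, c) \<in> U k" using U(2) by blast
    from U(1)[of k, unfolded openin_prod_topology_alt, rule_format, OF this]
    obtain V W where VW: "openin X V" "openin X W"
      "b \<in> V" "c \<in> W" "V \<times> W \<subseteq> U k"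
      by (elim exE conjE) (rule that)
    have ne: "{..<\<alpha>} \<noteq> {}" using limit_ord_nonempty[OF lim] by blast
    obtain \<gamma> where \<gamma>: "\<gamma> < \<alpha>" "\<And>\<delta>. \<gamma> < \<delta> \<Longrightarrow> \<delta> \<le> \<alpha> \<Longrightarrow> ini b \<delta> \<in> V"
      using VW(1)[unfolded openin_interval_topology, THEN conjunct2, rule_format, OF VW(3)] ne bc(3)
      by blast
    obtain \<gamma>' where \<gamma>': "\<gamma>' < \<alpha>" "\<And>\<delta>. \<gamma>' < \<delta> \<Longrightarrow> \<delta> \<le> \<alpha> \<Longrightarrow> ini c \<delta> \<in> W"
      using VW(2)[unfolded openin_interval_topology, THEN conjunct2, rule_format, OF VW(4)] ne bc(4)
      by blast
    have "max \<gamma> \<gamma>' < \<alpha>" using \<gamma>(1) \<gamma>'(1) by simp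
    then obtain \<delta> where \<delta>: "max \<gamma> \<gamma>' < \<delta>" "\<delta> < \<alpha>" using limit_ord_between[OF lim] by blast
    obtain \<epsilon> where \<epsilon>: "\<delta> \<le> \<epsilon>" "\<epsilon> < \<alpha>" "(ini b \<epsilon>, ini c \<epsilon>) \<notin> UU k" using k(2)[OF \<delta>(2)] by blast
    have "ini b \<epsilon> \<in> V" "ini c \<epsilon> \<in> W" using \<gamma>(2) \<gamma>'(2) \<epsilon> \<delta> by auto
    then have "(ini b \<epsilon>, ini c \<epsilon>) \<in> U k" using VW(5) by blast
    moreover have "ht (ini b \<epsilon>) = \<epsilon>" "ht (ini c \<epsilon>) = \<epsilon>" using ht_ini bc \<epsilon>(2) by simp_all
    ultimately have "(ini b \<epsilon>, ini c \<epsilon>) \<in> UU k" using UU T_ini bc(1,2) \<epsilon>(2) by simp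
    then show ?thesis using \<epsilon>(3) by blast
  next
    case False
    \<comment> \<open>Otherwise every stronger condition could reach a pair outside
      \<open>U k\<close>, by reflection below each suitable ladder point, and avoiding
      \<open>U k\<close> would be dense below the given condition.\<close>
    have ex: "\<exists>\<gamma>'. forces_into (U k) s t q \<gamma>'"
      if c0: "cnd T A \<gamma> s t q" "\<gamma> < \<alpha>" for \<gamma> s t q k
    proof (rule ccontr)
      assume none: "\<not> ?thesis"
      have "\<exists>\<beta>\<in>C \<alpha>. \<gamma>1 < \<beta> \<and> ready TT AA (avoids (UU k)) s t q \<beta>" if \<gamma>1: "\<gamma>1 < \<alpha>" for \<gamma>1
      proof -
        obtain \<beta> where \<beta>: "\<beta> \<in> C \<alpha>" "\<gamma>1 < \<beta>" "\<beta> < \<alpha>" "reflecting U \<beta>" using ladder_K[OF \<gamma>1] by blast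
        have "ready TT AA (avoids (UU k)) s t q \<beta>"
          unfolding ready_def
        proof (intro allI impI, elim conjE)
          fix j \<gamma>2 s2 t2 q2 assume 2: "\<gamma>2 < \<beta>" "cnd TT AA \<gamma>2 s2 t2 q2" "s \<subseteq>\<^sub>m s2" "t \<subseteq>\<^sub>m t2" "q2 \<le> q"
          have c2: "cnd T A \<gamma>2 s2 t2 q2" using 2(1,2) cnd_TT \<beta>(3) by simp
          then have "\<not> reach T A s2 t2 q2 \<subseteq> U k" using none 2(3-5) by blast
          then obtain s' t' where s': "(s', t') \<in> reach T A s2 t2 q2" "(s', t') \<notin> U k" "ht s' < \<beta>"
            using \<beta>(4) 2(1) c2 unfolding reflecting_def by blast
          have lt: "ht s' < \<alpha>" using s'(3) \<beta>(3) by simp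
          have "q2 \<in> \<rat>" using c2 by (simp add: cnd_def)
          then have "cnd TT AA (ht s') s' t' q2"
            using reachD(6)[OF s'(1)] unfolding cnd_TT[OF lt] by blast
          moreover have "avoids (UU k) j s' t' q2"
            using UU reachD(1-3)[OF s'(1)] lt s'(2) by (simp add: avoids_def)
          ultimately show "\<exists>\<gamma>'<\<beta>. \<exists>s' t' q'. cnd TT AA \<gamma>' s' t' q' \<and> s2 \<subseteq>\<^sub>m s' \<and> t2 \<subseteq>\<^sub>m t' \<and> q' \<le> q2 \<and>
              avoids (UU k) j s' t' q'"
            using s'(3) reachD(4,5)[OF s'(1)] by blast
        qed
        then show ?thesis using \<beta>(1,2) by blast
      qed
      moreover have "cnd TT AA \<gamma> s t q" using c0 cnd_TT by simp
      ultimately have "dense TT AA (C \<alpha>) \<alpha> (avoids (UU k))"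
        unfolding dense_def using c0(2) by blast
      then show False using False by blast
    qed
    have "dense TT AA (C \<alpha>) \<alpha> (enters TT AA UU)"
    proof -
      obtain \<zeta> :: omega1 where \<zeta>: "{..<\<zeta>} = {}" "\<forall>\<gamma>. \<zeta> \<le> \<gamma>" using least_omega1 by blast
      have "\<zeta> < \<alpha>" using \<zeta>(2) limit_ord_nonempty[OF lim] le_less_trans by blast
      have "Map.empty \<in> level T \<zeta>" using Map_empty_in_T \<zeta>(1) by (simp add: level_def)
      moreover have "notabove A Map.empty Map.empty"
        unfolding notabove_def
      proof (intro allI impI notI, elim conjE)
        fix x y assume xy: "(x, y) \<in> A" "x \<subseteq>\<^sub>m Map.empty"
        then obtain \<beta> where \<beta>: "x = N \<beta> 0" "col \<beta> \<noteq> None" by (auto simp: A_def)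
        then have "acc_of (bts (N \<beta> 0) \<inter> bts (N \<beta> 1)) \<beta>" using stage_N(6) unfolding col_def by blast
        then have "{..<\<beta>} \<noteq> {}" by (simp add: acc_of_def)
        moreover have "dom x = {}" using map_le_implies_dom_le[OF xy(2)] by simp
        ultimately show False using stage_N(1)[of \<beta> 0] \<beta>(1) by simp
      qed
      \<comment> \<open>The empty pair with the bound \<open>1\<close>, which every node
        obeys.\<close>
      ultimately have "cnd T A \<zeta> Map.empty Map.empty 1" by (simp add: cnd_def)
      then have "cnd TT AA \<zeta> Map.empty Map.empty 1" using cnd_TT[OF \<open>\<zeta> < \<alpha>\<close>] by simp
      moreover have "\<exists>\<beta>\<in>C \<alpha>. \<gamma>1 < \<beta> \<and> ready TT AA (enters TT AA UU) Map.empty Map.empty 1 \<beta>"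
        if \<gamma>1: "\<gamma>1 < \<alpha>" for \<gamma>1
      proof -
        obtain \<beta> where \<beta>: "\<beta> \<in> C \<alpha>" "\<gamma>1 < \<beta>" "\<beta> < \<alpha>" "reflecting U \<beta>" using ladder_K[OF \<gamma>1] by blast
        have "ready TT AA (enters TT AA UU) Map.empty Map.empty 1 \<beta>"
          unfolding ready_def
        proof (intro allI impI, elim conjE)
          fix k \<gamma> s t q assume \<gamma>: "\<gamma> < \<beta>" "cnd TT AA \<gamma> s t q"
          have "\<gamma> < \<alpha>" using \<gamma>(1) \<beta>(3) by simp
          then have c0: "cnd T A \<gamma> s t q" using \<gamma>(2) cnd_TT by simp
          obtain \<gamma>' s' t' q' where s': "\<gamma>' < \<beta>" "cnd T A \<gamma>' s' t' q'" "s \<subseteq>\<^sub>m s'" "t \<subseteq>\<^sub>m t'" "q' \<le> q"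
            "reach T A s' t' q' \<subseteq> U k"
            using \<beta>(4)[unfolded reflecting_def, rule_format, OF \<gamma>(1) c0, THEN conjunct2, rule_format,
                OF ex[OF c0 \<open>\<gamma> < \<alpha>\<close>]] by blast
          have "\<gamma>' < \<alpha>" using s'(1) \<beta>(3) by simp
          then have "cnd TT AA \<gamma>' s' t' q'" using s'(2) cnd_TT by simp
          moreover have "enters TT AA UU k s' t' q'"
            unfolding enters_def reach_TT
          proof (intro allI impI subsetI)
            fix j p assume j: "j \<le> k" and "p \<in> {p \<in> reach T A s' t' q'. ht (fst p) < \<alpha>}"
            then obtain x y where p: "p = (x, y)" "(x, y) \<in> reach T A s' t' q'" "ht x < \<alpha>" by (cases p) auto
            \<comment> \<open>The condition was found for index \<open>k\<close> only; since
              \<open>U\<close> is decreasing it serves all \<open>j \<le> k\<close>.\<close>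
            then have "(x, y) \<in> U j" using s'(6) U(3)[OF j] by blast
            then show "p \<in> UU j" using UU reachD(1-3)[OF p(2)] p(1,3) by simp
          qed
          ultimately show "\<exists>\<gamma>'<\<beta>. \<exists>s' t' q'. cnd TT AA \<gamma>' s' t' q' \<and> s \<subseteq>\<^sub>m s' \<and> t \<subseteq>\<^sub>m t' \<and> q' \<le> q \<and>
              enters TT AA UU k s' t' q'"
            using s' by blast
        qed
        then show ?thesis using \<beta>(1,2) by blast
      qed
      ultimately show ?thesis unfolding dense_def using \<open>\<zeta> < \<alpha>\<close> by blast
    qed
    then have colour: "col \<alpha> = None" and na: "notabove AA b c"
      and lies: "\<And>k. \<exists>\<epsilon> r. \<epsilon> < \<alpha> \<and> fv b < r \<and> fv c < r \<and> cnd TT AA \<epsilon> (ini b \<epsilon>) (ini c \<epsilon>) r \<and>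
         reach TT AA (ini b \<epsilon>) (ini c \<epsilon>) r \<subseteq> UU k"
      using st False by auto
    \<comment> \<open>An uncoloured level adds nothing to \<open>A\<close>, so the pair avoids all
      of \<open>A\<close> and not only its earlier members.\<close>
    have naA: "notabove A b c" using notabove_upto[OF bc(1)] na bc(3) colour unfolding AA_def by blast
    have "(b, c) \<in> U k" for k
    proof -
      obtain \<epsilon> r where \<epsilon>: "\<epsilon> < \<alpha>" "fv b < r" "fv c < r" "cnd TT AA \<epsilon> (ini b \<epsilon>) (ini c \<epsilon>) r"
        "reach TT AA (ini b \<epsilon>) (ini c \<epsilon>) r \<subseteq> UU k" using lies by blast
      have c0: "cnd T A \<epsilon> (ini b \<epsilon>) (ini c \<epsilon>) r" using \<epsilon>(1,4) cnd_TT by simp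
      \<comment> \<open>The construction speaks only about pairs below \<alpha>. As \<alpha> is
        reflecting, a counterexample of any height yields one below \<alpha>.\<close>
      have "reach T A (ini b \<epsilon>) (ini c \<epsilon>) r \<subseteq> U k"
      proof (rule ccontr)
        assume "\<not> reach T A (ini b \<epsilon>) (ini c \<epsilon>) r \<subseteq> U k"
        then obtain s' t' where s': "(s', t') \<in> reach T A (ini b \<epsilon>) (ini c \<epsilon>) r" "(s', t') \<notin> U k" "ht s' < \<alpha>"
          using K(2)[OF \<alpha>(3), unfolded reflecting_def, rule_format, OF \<epsilon>(1) c0, THEN conjunct1, rule_format]
          by blast
        then have "(s', t') \<in> UU k" using \<epsilon>(5) unfolding reach_TT by auto
        then show False using UU reachD(1-3)[OF s'(1)] s'(2,3) by simp
      qed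
      moreover have "dom b = dom c" using stage_N(1) unfolding b_def c_def by simp
      then have "(b, c) \<in> reach T A (ini b \<epsilon>) (ini c \<epsilon>) r"
        using bc(1,2) \<epsilon>(2,3) naA ini_le unfolding reach_def by simp
      ultimately show ?thesis by blast
    qed
    then show ?thesis by blast
  qed
qed

lemma not_countably_metacompact_square: "\<not> countably_metacompact X2"
proof
  assume "countably_metacompact X2"
  moreover have "F n \<subseteq> F m" if "m \<le> n" for m n using that le_trans unfolding F_def by blast
  ultimately obtain U where "\<forall>n. openin X2 (U n) \<and> F n \<subseteq> U n" "\<forall>m n. m \<le> n \<longrightarrow> U n \<subseteq> U m" "(\<Inter>n. U n) = {}"
    using countably_metacompact_expansion[OF _ closedin_F _ F_empty] by metis
  then show False using expansion_meets[of U] by blast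
qed

end

theorem theorem2p21:
  assumes "proxy_omega1"
  shows "\<exists>T :: (omega1 \<rightharpoonup> nat) set.
           aleph1_tree T \<and> real_embeddable T \<and> almost_Souslin T \<and>
           perfectly_normal_space (interval_topology T) \<and>
           \<not> countably_metacompact
               (prod_topology (interval_topology T) (interval_topology T))"
proof -
  obtain C where C: "ladder_system C"
    "\<forall>B. uncountable B \<longrightarrow> (\<exists>E. club E \<and> (\<forall>\<alpha>\<in>E. acc_of (C \<alpha> \<inter> B) \<alpha>))"
    using assms unfolding proxy_omega1_def by (elim conjE exE) (rule that)
  obtain \<Omega> :: "omega1 \<Rightarrow> (omega1 \<times> nat) set"
    where \<Omega>: "\<forall>B. stationary {\<alpha>. B \<inter> ({..<\<alpha>} \<times> UNIV) = \<Omega> \<alpha>}"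
    using diamond_product assms unfolding proxy_omega1_def by blast
  obtain G where G: "\<forall>\<alpha>. stage_rec C \<Omega> G \<alpha> (G \<alpha>)" using stage_rec_exists[OF C(1)] by blast
  interpret constructed_tree C \<Omega> G
    by unfold_locales (simp_all add: C \<Omega> G)
  show ?thesis
    using aleph1_tree_T real_embeddable_T almost_Souslin_T perfectly_normal_T
      not_countably_metacompact_square by blast
qed

end
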